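(* Let $1\le\beta<\alpha$. Then: (i) The Riesz fractional derivative of order $\beta$, $D^\beta: Lip_\alpha(\gamma)\to Lip_{\alpha-\beta}(\gamma)$, is bounded. (ii) The Bessel fractional derivative of order $\beta$, $\mathcal{D}^\beta: Lip_\alpha(\gamma)\to Lip_{\alpha-\beta}(\gamma)$, is bounded. Here an operator $S$ is bounded from $Lip_\alpha(\gamma)$ to $Lip_{\alpha-\beta}(\gamma)$ if $Sf\in Lip_{\alpha-\beta}(\gamma)$ for every $f\in Lip_\alpha(\gamma)$ and there is a constant $C$, independent of $f$, such that $\|Sf\|_{Lip_{\alpha-\beta}(\gamma)}\le C\|f\|_{Lip_\alpha(\gamma)}$ for all $f\in Lip_\alpha(\gamma)$.
   Context: Fix $d\ge 1$ and let $d\gamma(x)=\pi^{-d/2}e^{-|x|^2}dx$ be the Gaussian measure on $\mathbb{R}^d$; $\|\cdot\|_\infty$ is the norm of $L^\infty=L^\infty(\gamma)$. The Ornstein-Uhlenbeck semigroup is $T_0f=f$ and, for $t>0$, $$T_tf(x)=\frac{1}{\pi^{d/2}(1-e^{-2t})^{d/2}}\int_{\mathbb{R}^d}\exp\left(-\frac{|y-e^{-t}x|^2}{1-e^{-2t}}\right)f(y)\,dy ,$$ with generator $L=\frac12\Delta-\langle x,\nabla\rangle$. The Poisson-Hermite semigroup (generator $-(-L)^{1/2}$) is $$P_tf(x)=\frac{1}{\sqrt{\pi}}\int_0^\infty\frac{e^{-u}}{\sqrt{u}}\,T_{t^2/4u}f(x)\,du,\quad t>0,\qquad P_0f=f.$$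 Gaussian Lipschitz spaces: for $\alpha>0$ let $n$ be the smallest integer greater than $\alpha$. $Lip_\alpha(\gamma)$ is the set of $f\in L^\infty$ for which there is a constant $A$ such that $\left\|\frac{\partial^nP_tf}{\partial t^n}\right\|_\infty\le A\,t^{-n+\alpha}$ for all $t>0$. The smallest such $A$ is denoted $A_\alpha(f)$, and $\|f\|_{Lip_\alpha(\gamma)}=\|f\|_\infty+A_\alpha(f)$. For $\beta\ge 1$ let $k$ be the smallest integer with $\beta<k$ and put $c^k_\beta=\int_0^\infty u^{-\beta-1}(e^{-u}-1)^k\,du$. The Riesz fractional derivative (formally $D^\beta=(-L)^{\beta/2}$) and the Bessel fractional derivative (formally $\mathcal{D}^\beta=(I+\sqrt{-L})^\beta$) of order $\beta$ are given by $$D^\beta f=\frac{1}{c^k_\beta}\int_0^\infty s^{-\beta-1}(P_s-I)^kf\,ds,\qquad \mathcal{D}^\beta f=\frac{1}{c^k_\beta}\int_0^\infty s^{-\beta-1}(e^{-s}P_s-I)^kf\,ds ,$$ where $I$ is the identity operator and the powers are operator powers. *)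

theory Defs
  imports "HOL-Probability.Essential_Supremum" "HOL-Analysis.Analysis"
begin

section \<open>The Gaussian measure and its \<open>L\<^sup>\<infinity>\<close> space\<close>

text \<open>The dimension is \<open>d = CARD('d) \<ge> 1\<close>.  Elements of \<open>L\<^sup>\<infinity>\<close> are represented by Borel functions;
  all norms below are essential suprema, so they do not depend on the representative.\<close>

definition gauss :: "(real ^ 'd::finite) measure" where
  "gauss = density lborel
     (\<lambda>x. ennreal (pi powr (- real CARD('d) / 2) * exp (- (norm x)\<^sup>2)))"

definition Linf_norm :: "(real ^ 'd::finite \<Rightarrow> real) \<Rightarrow> ereal" where
  "Linf_norm f = esssup gauss (\<lambda>x. ereal \<bar>f x\<bar>)"

text \<open>\<^const>\<open>esssup\<close> is \<open>\<infinity>\<close> on non-measurable functions.\<close>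

definition Linf :: "(real ^ 'd::finite \<Rightarrow> real) set" where
  "Linf = {f. f \<in> borel_measurable gauss \<and> Linf_norm f < \<infinity>}"


section \<open>The Ornstein-Uhlenbeck and Poisson-Hermite semigroups\<close>

definition OU :: "real \<Rightarrow> (real ^ 'd::finite \<Rightarrow> real) \<Rightarrow> (real ^ 'd \<Rightarrow> real)" where
  "OU t f x =
     (if t = 0 then f x
      else 1 / (pi powr (real CARD('d) / 2) * (1 - exp (- 2 * t)) powr (real CARD('d) / 2)) *
        (LINT y|lborel. exp (- (norm (y - exp (- t) *\<^sub>R x))\<^sup>2 / (1 - exp (- 2 * t))) * f y))"

definition PH :: "real \<Rightarrow> (real ^ 'd::finite \<Rightarrow> real) \<Rightarrow> (real ^ 'd \<Rightarrow> real)" where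
  "PH t f x =
     (if t = 0 then f x
      else 1 / sqrt pi * (LINT u:{0<..}|lborel. exp (- u) / sqrt u * OU (t\<^sup>2 / (4 * u)) f x))"

text \<open>The \<open>n\<close>-th derivative \<open>\<partial>\<^sup>nP\<^sub>tf/\<partial>t\<^sup>n\<close>, taken pointwise in \<open>x\<close>; for \<open>f\<close> in \<^const>\<open>Linf\<close> and \<open>t > 0\<close>
  it exists at every \<open>x\<close>.\<close>

definition PH_deriv :: "nat \<Rightarrow> real \<Rightarrow> (real ^ 'd::finite \<Rightarrow> real) \<Rightarrow> (real ^ 'd \<Rightarrow> real)" where
  "PH_deriv n t f x = (deriv ^^ n) (\<lambda>r. PH r f x) t"


section \<open>Gaussian Lipschitz spaces\<close>

definition least_above :: "real \<Rightarrow> nat" where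
  "least_above \<alpha> = (LEAST n::nat. \<alpha> < real n)"

definition Lip_bound :: "real \<Rightarrow> (real ^ 'd::finite \<Rightarrow> real) \<Rightarrow> real \<Rightarrow> bool" where
  "Lip_bound \<alpha> f A \<longleftrightarrow>
     (\<forall>t>0. Linf_norm (PH_deriv (least_above \<alpha>) t f)
              \<le> ereal (A * t powr (- real (least_above \<alpha>) + \<alpha>)))"

definition Lip :: "real \<Rightarrow> (real ^ 'd::finite \<Rightarrow> real) set" where
  "Lip \<alpha> = {f \<in> Linf. \<exists>A. Lip_bound \<alpha> f A}"

definition Lip_const :: "real \<Rightarrow> (real ^ 'd::finite \<Rightarrow> real) \<Rightarrow> real" where
  "Lip_const \<alpha> f = (LEAST A. Lip_bound \<alpha> f A)"

definition Lip_norm :: "real \<Rightarrow> (real ^ 'd::finite \<Rightarrow> real) \<Rightarrow> real" where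
  "Lip_norm \<alpha> f = real_of_ereal (Linf_norm f) + Lip_const \<alpha> f"

definition bounded_Lip ::
  "real \<Rightarrow> real \<Rightarrow> ((real ^ 'd::finite \<Rightarrow> real) \<Rightarrow> (real ^ 'd \<Rightarrow> real)) \<Rightarrow> bool" where
  "bounded_Lip \<alpha> \<alpha>' S \<longleftrightarrow>
     (\<forall>f \<in> Lip \<alpha>. S f \<in> Lip \<alpha>') \<and>
     (\<exists>C. \<forall>f \<in> Lip \<alpha>. Lip_norm \<alpha>' (S f) \<le> C * Lip_norm \<alpha> f)"


section \<open>Fractional derivatives\<close>

definition frac_const :: "real \<Rightarrow> real" where
  "frac_const \<beta> =
     (LINT u:{0<..}|lborel. u powr (- \<beta> - 1) * (exp (- u) - 1) ^ least_above \<beta>)"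

definition riesz_integrand :: "real \<Rightarrow> (real ^ 'd::finite \<Rightarrow> real) \<Rightarrow> real ^ 'd \<Rightarrow> real \<Rightarrow> real" where
  "riesz_integrand \<beta> f x s =
     s powr (- \<beta> - 1) * ((\<lambda>g y. PH s g y - g y) ^^ least_above \<beta>) f x"

definition bessel_integrand :: "real \<Rightarrow> (real ^ 'd::finite \<Rightarrow> real) \<Rightarrow> real ^ 'd \<Rightarrow> real \<Rightarrow> real" where
  "bessel_integrand \<beta> f x s =
     s powr (- \<beta> - 1) * ((\<lambda>g y. exp (- s) * PH s g y - g y) ^^ least_above \<beta>) f x"

definition riesz_deriv :: "real \<Rightarrow> (real ^ 'd::finite \<Rightarrow> real) \<Rightarrow> (real ^ 'd \<Rightarrow> real)" where
  "riesz_deriv \<beta> f x = 1 / frac_const \<beta> * (LINT s:{0<..}|lborel. riesz_integrand \<beta> f x s)"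

definition bessel_deriv :: "real \<Rightarrow> (real ^ 'd::finite \<Rightarrow> real) \<Rightarrow> (real ^ 'd \<Rightarrow> real)" where
  "bessel_deriv \<beta> f x = 1 / frac_const \<beta> * (LINT s:{0<..}|lborel. bessel_integrand \<beta> f x s)"

text \<open>An operator given by an integral \<open>\<integral>\<^sub>0\<^sup>\<infinity> I f x s ds\<close> is well defined on a set of functions if
  the integral converges absolutely for almost every \<open>x\<close>.  This is needed because the Bochner
  integral of a non-integrable function is \<open>0\<close> by convention.\<close>

definition well_defined_on ::
  "(real ^ 'd::finite \<Rightarrow> real) set
     \<Rightarrow> ((real ^ 'd \<Rightarrow> real) \<Rightarrow> real ^ 'd \<Rightarrow> real \<Rightarrow> real) \<Rightarrow> bool" where
  "well_defined_on F I \<longleftrightarrow> (\<forall>f \<in> F. AE x in gauss. set_integrable lborel {0<..} (I f x))"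

end

theory Submission
  imports Defs "HOL-Probability.Distributions" "HOL-Real_Asymp.Real_Asymp"
begin

text \<open>
Write \<open>u(t, x) = P\<^sub>t f(x)\<close> and treat the two derivatives together: \<open>\<kappa> = 0\<close> is the Riesz and \<open>\<kappa> = 1\<close> the Bessel
case.  By the semigroup law, \<open>(e\<^bsup>-\<kappa>s\<^esup> P\<^sub>s - I)\<^sup>k f(x)\<close> is the \<open>k\<close>-th forward difference with step \<open>s\<close>, taken at
time \<open>0\<close>, of the function \<open>t \<mapsto> e\<^bsup>-\<kappa>t\<^esup> u(t, x)\<close> (\<open>frac_op_iter_eq_fwd_diff\<close>).  If \<open>\<partial>\<^sup>m P\<^sub>t / \<partial>t\<^sup>m\<close> is applied to it,
the result is \<open>e\<^bsup>\<kappa>t\<^esup>\<close> times the same difference, taken at time \<open>t\<close>, of \<open>r \<mapsto> e\<^bsup>-\<kappa>r\<^esup> \<partial>\<^sup>m u(r, x) / \<partial>r\<^sup>m\<close>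
(\<open>poisson_frac_op_iter\<close>).  So the theorem is a statement about functions of one variable at a fixed point \<open>x\<close>.

Put \<open>L = \<parallel>f\<parallel>\<^sub>\<infinity> + A\<^sub>\<alpha>(f)\<close>.  The Lipschitz condition on the derivative of order \<open>n\<close> passes to all higher orders,
\<open>|\<partial>\<^sup>j u / \<partial>t\<^sup>j| \<le> C L t\<^bsup>\<alpha>-j\<^esup>\<close>, because half of the time can be spent on extra derivatives
(\<open>Lip_imp_lip_profile\<close>), and by integration to the lower orders near \<open>0\<close> (\<open>lip_profile_near_zero\<close>).  A function
whose \<open>k\<close>-th derivative is \<open>O(r\<^bsup>-\<gamma>\<^esup>)\<close> has \<open>k\<close>-th differences \<open>O(s\<^bsup>k-g\<^esup> r\<^bsup>g-\<gamma>\<^esup>)\<close> for every \<open>g\<close> with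
\<open>0 \<le> g < k\<close> and \<open>g \<le> \<gamma>\<close> (\<open>fwd_diff_iter_bound\<close>).

For the sup norm one takes \<open>m = 0\<close> and \<open>g = \<gamma>\<close> with \<open>\<gamma> \<ge> 0\<close> between \<open>k - \<alpha>\<close> and \<open>k - \<beta>\<close>; then \<open>r\<close> may tend to \<open>0\<close> and the difference is
\<open>O(s\<^bsup>k-\<gamma>\<^esup>)\<close>, which is integrable against \<open>s\<^bsup>-\<beta>-1\<^esup>\<close> near \<open>0\<close>; at infinity boundedness of \<open>f\<close> suffices.  For the
Lipschitz bound \<open>m\<close> is the least integer above \<open>\<alpha> - \<beta>\<close> and \<open>\<gamma> = m + k - \<alpha>\<close>; with \<open>g = 0\<close> for \<open>s \<le> t\<close> and some
\<open>g > k - \<beta>\<close> for \<open>s > t\<close> the integral over \<open>s\<close> is \<open>O(t\<^bsup>\<alpha>-\<beta>-m\<^esup>)\<close> by homogeneity.  Only \<open>t \<le> 1\<close> needs this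
argument, since for \<open>t \<ge> 1\<close> the Lipschitz bound follows from the boundedness of the fractional derivative
(\<open>frac_deriv_Lip_estimate\<close>).

The facts about the semigroup rest on the representation \<open>P\<^sub>t f(x) = \<integral> h(t, s) T\<^sub>s f(x) ds\<close> with the explicit density
\<open>h\<close> of the one-sided stable law of index \<open>1/2\<close> (\<open>PH_eq_poisson\<close>).  All time derivatives fall on \<open>h\<close>, and the
semigroup law follows from the one of \<open>T\<^sub>s\<close> and from \<open>h(t, \<cdot>) * h(r, \<cdot>) = h(t + r, \<cdot>)\<close>, for which there is an
explicit primitive (\<open>subord_convolution\<close>).  The differences at time \<open>0\<close> involve \<open>f\<close> itself, so \<open>u(t, x) \<rightarrow> f(x)\<close>
as \<open>t \<rightarrow> 0\<close> is needed for almost every \<open>x\<close>.  Since \<open>\<alpha> > 1\<close>, the limit exists everywhere, and the symmetry of \<open>T\<^sub>s\<close>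
with respect to \<open>\<gamma>\<close> identifies it (\<open>poisson_AE_initial_value\<close>).
\<close>

section \<open>Iterated forward differences\<close>

definition fwd_diff :: "real \<Rightarrow> (real \<Rightarrow> real) \<Rightarrow> real \<Rightarrow> real" where
  "fwd_diff s g r = g (r + s) - g r"

lemma fwd_diff_iter_Suc:
  "(fwd_diff s ^^ Suc k) g r = (fwd_diff s ^^ k) g (r + s) - (fwd_diff s ^^ k) g r"
  by (simp add: fwd_diff_def)

text \<open>Comparing derivatives replaces the integral of \<open>\<phi>\<close>, so no integrability of \<open>g'\<close> has to be discussed.\<close>
lemma abs_increment_le_by_derivative:
  fixes g \<Phi> :: "real \<Rightarrow> real"
  assumes ab: "a \<le> b"
    and g: "\<And>v. a \<le> v \<Longrightarrow> v \<le> b \<Longrightarrow> (g has_real_derivative g' v) (at v)"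
    and \<Phi>: "\<And>v. a \<le> v \<Longrightarrow> v \<le> b \<Longrightarrow> (\<Phi> has_real_derivative \<phi> v) (at v)"
    and le: "\<And>v. a \<le> v \<Longrightarrow> v \<le> b \<Longrightarrow> \<bar>g' v\<bar> \<le> \<phi> v"
  shows "\<bar>g b - g a\<bar> \<le> \<Phi> b - \<Phi> a"
proof -
  have "(\<lambda>v. \<Phi> v - g v) a \<le> (\<lambda>v. \<Phi> v - g v) b"
  proof (rule DERIV_nonneg_imp_nondecreasing[OF ab])
    fix v assume v: "a \<le> v" "v \<le> b"
    show "\<exists>y. ((\<lambda>v. \<Phi> v - g v) has_real_derivative y) (at v) \<and> 0 \<le> y"
      using le[OF v] by (intro exI[of _ "\<phi> v - g' v"] conjI DERIV_diff \<Phi> g v) auto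
  qed
  moreover have "(\<lambda>v. \<Phi> v + g v) a \<le> (\<lambda>v. \<Phi> v + g v) b"
  proof (rule DERIV_nonneg_imp_nondecreasing[OF ab])
    fix v assume v: "a \<le> v" "v \<le> b"
    show "\<exists>y. ((\<lambda>v. \<Phi> v + g v) has_real_derivative y) (at v) \<and> 0 \<le> y"
      using le[OF v] by (intro exI[of _ "\<phi> v + g' v"] conjI DERIV_add \<Phi> g v) auto
  qed
  ultimately show ?thesis by auto
qed

text \<open>For a concave power the increment over a step \<open>s\<close> decreases in the left end point, so it is at most
  its limit as the left end point tends to \<open>0\<close>.\<close>
lemma powr_increment_le:
  fixes e r s :: real
  assumes "0 < e" "e \<le> 1" "0 < r" "0 < s"
  shows "(r + s) powr e - r powr e \<le> s powr e"
proof -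
  have "(\<lambda>v. (v + s) powr e - v powr e) r \<le> s powr e"
  proof -
    have mono: "(r + s) powr e - r powr e \<le> (v + s) powr e - v powr e" if v: "0 < v" "v \<le> r" for v
    proof (rule DERIV_nonpos_imp_nonincreasing[OF v(2)])
      fix w assume w: "v \<le> w" "w \<le> r"
      have "((\<lambda>v. (v + s) powr e - v powr e) has_real_derivative
              e * (w + s) powr (e - 1) - e * w powr (e - 1)) (at w)"
        using v w assms by (auto intro!: derivative_eq_intros)
      moreover have "(w + s) powr (e - 1) \<le> w powr (e - 1)"
        using v w assms by (intro powr_mono2') auto
      ultimately show "\<exists>y. ((\<lambda>v. (v + s) powr e - v powr e) has_real_derivative y) (at w) \<and> y \<le> 0"
        using assms by (intro exI conjI) (auto simp: mult_left_mono)
    qed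
    have "((\<lambda>v. (v + s) powr e - v powr e) \<longlongrightarrow> (0 + s) powr e - 0 powr e) (at_right 0)"
      using assms by (intro tendsto_intros tendsto_powr') (auto simp: eventually_at_filter)
    then have "((\<lambda>v. (v + s) powr e - v powr e) \<longlongrightarrow> s powr e) (at_right 0)" by simp
    then show ?thesis
    proof (rule tendsto_lowerbound)
      show "\<forall>\<^sub>F v in at_right 0. (r + s) powr e - r powr e \<le> (v + s) powr e - v powr e"
        unfolding eventually_at_right_field using assms(3) mono by (intro exI[of _ r]) auto
    qed simp
  qed
  then show ?thesis by simp
qed

lemma fwd_diff_iter_has_derivative:
  fixes g :: "real \<Rightarrow> real"
  assumes "\<And>r. 0 < r \<Longrightarrow> (g has_real_derivative g' r) (at r)" "0 < s" "0 < r"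
  shows "((fwd_diff s ^^ k) g has_real_derivative (fwd_diff s ^^ k) g' r) (at r)"
  using assms
proof (induction k arbitrary: r)
  case 0 then show ?case by simp
next
  case (Suc k)
  have 1: "((fwd_diff s ^^ k) g has_real_derivative (fwd_diff s ^^ k) g' r) (at r)"
    using Suc by auto
  have 2: "((fwd_diff s ^^ k) g has_real_derivative (fwd_diff s ^^ k) g' (r + s)) (at (r + s))"
    using Suc by auto
  show ?case unfolding fwd_diff_iter_Suc
    by (rule DERIV_diff[OF DERIV_shift[THEN iffD1, OF 2] 1])
qed

lemma fwd_diff_iter_cong:
  assumes "\<And>r. 0 \<le> r \<Longrightarrow> g1 r = g2 r" "0 \<le> s" "0 \<le> r"
  shows "(fwd_diff s ^^ k) g1 r = (fwd_diff s ^^ k) g2 r"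
  using assms(3) by (induction k arbitrary: r) (auto simp: fwd_diff_iter_Suc assms simp del: funpow.simps(2))

lemma fwd_diff_iter_cong_pos:
  assumes "\<And>r. 0 < r \<Longrightarrow> g1 r = g2 r" "0 \<le> s" "0 < r"
  shows "(fwd_diff s ^^ k) g1 r = (fwd_diff s ^^ k) g2 r"
  using assms(3)
  by (induction k arbitrary: r)
    (use assms(2) in \<open>auto simp: fwd_diff_iter_Suc assms(1) add_pos_nonneg simp del: funpow.simps(2)\<close>)

lemma fwd_diff_iter_le:
  assumes "\<And>r. 0 \<le> r \<Longrightarrow> \<bar>g r\<bar> \<le> M" "0 \<le> s" "0 \<le> r"
  shows "\<bar>(fwd_diff s ^^ k) g r\<bar> \<le> 2 ^ k * M"
  using assms(3)
proof (induction k arbitrary: r)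
  case 0 then show ?case using assms by simp
next
  case (Suc k)
  have "\<bar>(fwd_diff s ^^ k) g (r + s)\<bar> \<le> 2 ^ k * M" "\<bar>(fwd_diff s ^^ k) g r\<bar> \<le> 2 ^ k * M"
    using Suc assms by auto
  then show ?case unfolding fwd_diff_iter_Suc power_Suc by linarith
qed

text \<open>Used with \<open>r = 0\<close>, where differences of a function on \<open>[0, \<infinity>)\<close> are obtained as limits of
  differences in the open half line.\<close>
lemma tendsto_fwd_diff_iter:
  fixes T :: "'a \<Rightarrow> real"
  assumes "\<And>r. 0 \<le> r \<Longrightarrow> ((\<lambda>i. g (r + T i)) \<longlongrightarrow> g r) F" "0 \<le> s" "0 \<le> r"
  shows "((\<lambda>i. (fwd_diff s ^^ k) g (r + T i)) \<longlongrightarrow> (fwd_diff s ^^ k) g r) F"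
  using assms(3)
proof (induction k arbitrary: r)
  case 0 then show ?case using assms by simp
next
  case (Suc k)
  have "((\<lambda>i. (fwd_diff s ^^ k) g (r + s + T i)) \<longlongrightarrow> (fwd_diff s ^^ k) g (r + s)) F"
    using Suc.IH[of "r + s"] Suc.prems assms(2) by linarith
  from tendsto_diff[OF this Suc.IH[OF Suc.prems]] show ?case
    unfolding fwd_diff_iter_Suc by (simp add: add_ac)
qed

lemma measurable_fwd_diff_iter:
  assumes w: "(\<lambda>(r, y). w r y) \<in> borel_measurable (borel \<Otimes>\<^sub>M B)"
    and [measurable]: "g \<in> borel_measurable N" "b \<in> N \<rightarrow>\<^sub>M B" "a \<in> borel_measurable N"
  shows "(\<lambda>z. (fwd_diff (g z) ^^ k) (\<lambda>r. w r (b z)) (a z)) \<in> borel_measurable N"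
  using assms(4)
proof (induction k arbitrary: a)
  case 0
  note [measurable] = 0 w
  show ?case by simp
next
  case (Suc k)
  note [measurable] = Suc.prems
  show ?case unfolding fwd_diff_iter_Suc by (intro borel_measurable_diff Suc.IH) measurable
qed

text \<open>Each difference is an integral of the derivative over a step, and
  \<open>\<integral>\<^bsub>r\<^esub>\<^bsup>r+s\<^esup> v\<^bsup>-\<eta>\<^esup> dv \<le> s\<^bsup>1-\<eta>\<^esup> / (1 - \<eta>)\<close>.  A step therefore turns a part \<open>r\<^bsup>-\<eta>\<^esup>\<close> of the singularity at
  \<open>0\<close> into a slower growth in \<open>s\<close>.  For \<open>\<eta> = 0\<close> this is the bound \<open>s\<^sup>k r\<^bsup>-\<gamma>\<^esup>\<close> of Taylor type, which is the
  good one for small \<open>s\<close>; a positive \<open>\<eta>\<close> is needed for large \<open>s\<close>.\<close>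
lemma fwd_diff_iter_bound:
  fixes F :: "nat \<Rightarrow> real \<Rightarrow> real"
  assumes "\<And>i r. i < k \<Longrightarrow> 0 < r \<Longrightarrow> (F i has_real_derivative F (Suc i) r) (at r)"
    and "\<And>r. 0 < r \<Longrightarrow> \<bar>F k r\<bar> \<le> B * r powr (-\<gamma>)"
    and "0 \<le> \<eta>" "\<eta> < 1" "real k * \<eta> \<le> \<gamma>" "0 < s" "0 < r"
  shows "\<bar>(fwd_diff s ^^ k) (F 0) r\<bar>
           \<le> B * (1 / (1 - \<eta>)) ^ k * s powr (real k * (1 - \<eta>)) * r powr (-(\<gamma> - real k * \<eta>))"
  using assms
proof (induction k arbitrary: F r)
  case 0
  then show ?case using assms(2) by simp
next
  case (Suc k)
  \<comment> \<open>The derivative of the \<open>k\<close>-th difference of \<open>F 0\<close> is the \<open>k\<close>-th difference of \<open>F 1\<close>.\<close>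
  define c where "c = B * (1 / (1 - \<eta>)) ^ k * s powr (real k * (1 - \<eta>))"
  define d where "d = \<gamma> - real (Suc k) * \<eta>"
  have B: "0 \<le> B"
  proof -
    have "0 \<le> B * 1 powr (-\<gamma>)" using Suc.prems(2)[of 1] abs_ge_zero[of "F (Suc k) 1"] by linarith
    then show ?thesis by simp
  qed
  then have c: "0 \<le> c" using Suc.prems unfolding c_def by auto
  have d: "0 \<le> d" using Suc.prems unfolding d_def by auto
  have kg: "real k * \<eta> \<le> \<gamma>" using Suc.prems by (auto simp: algebra_simps)
  have IH: "\<bar>(fwd_diff s ^^ k) (F 1) v\<bar> \<le> c * v powr (-(d + \<eta>))" if "0 < v" for v
    using Suc.IH[of "\<lambda>i. F (Suc i)" v] Suc.prems kg that by (simp add: c_def d_def algebra_simps)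
  have "\<bar>(fwd_diff s ^^ k) (F 0) (r + s) - (fwd_diff s ^^ k) (F 0) r\<bar>
      \<le> (c * r powr (-d) * (1 / (1 - \<eta>)) * (r + s) powr (1 - \<eta>)) - (c * r powr (-d) * (1 / (1 - \<eta>)) * r powr (1 - \<eta>))"
  proof (rule abs_increment_le_by_derivative[where g' = "(fwd_diff s ^^ k) (F 1)"
        and \<Phi> = "\<lambda>v. c * r powr (-d) * (1 / (1 - \<eta>)) * v powr (1 - \<eta>)"
        and \<phi> = "\<lambda>v. c * r powr (-d) * v powr (-\<eta>)"])
    show "r \<le> r + s" using Suc.prems by simp
    fix v assume v: "r \<le> v" "v \<le> r + s"
    then have v0: "0 < v" using Suc.prems by auto
    show "((fwd_diff s ^^ k) (F 0) has_real_derivative (fwd_diff s ^^ k) (F 1) v) (at v)"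
      using Suc.prems v0 by (intro fwd_diff_iter_has_derivative) auto
    have "((\<lambda>v. v powr (1 - \<eta>)) has_real_derivative (1 - \<eta>) * v powr (1 - \<eta> - 1)) (at v)"
      using v0 by (auto intro!: derivative_eq_intros)
    from DERIV_cmult[OF this, of "c * r powr (-d) * (1 / (1 - \<eta>))"]
    show "((\<lambda>v. c * r powr (-d) * (1 / (1 - \<eta>)) * v powr (1 - \<eta>)) has_real_derivative c * r powr (-d) * v powr (-\<eta>)) (at v)"
      using Suc.prems(4) by (auto elim!: DERIV_cong)
    have "\<bar>(fwd_diff s ^^ k) (F 1) v\<bar> \<le> c * (v powr (-d) * v powr (-\<eta>))"
      using IH[OF v0] by (simp add: powr_add[symmetric])
    also have "\<dots> \<le> c * (r powr (-d) * v powr (-\<eta>))"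
      using v Suc.prems d c by (intro mult_left_mono mult_right_mono powr_mono2') auto
    finally show "\<bar>(fwd_diff s ^^ k) (F 1) v\<bar> \<le> c * r powr (-d) * v powr (-\<eta>)" by simp
  qed
  also have "\<dots> = c * r powr (-d) * (1 / (1 - \<eta>)) * ((r + s) powr (1 - \<eta>) - r powr (1 - \<eta>))"
    by (simp add: algebra_simps)
  also have "\<dots> \<le> c * r powr (-d) * (1 / (1 - \<eta>)) * s powr (1 - \<eta>)"
    using c Suc.prems by (intro mult_left_mono powr_increment_le) auto
  also have "\<dots> = B * (1 / (1 - \<eta>)) ^ Suc k * (s powr (real k * (1 - \<eta>)) * s powr (1 - \<eta>)) * r powr (-d)"
    by (simp add: c_def)
  also have "s powr (real k * (1 - \<eta>)) * s powr (1 - \<eta>) = s powr (real (Suc k) * (1 - \<eta>))"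
    unfolding powr_add[symmetric] by (simp add: algebra_simps)
  finally show ?case unfolding fwd_diff_iter_Suc d_def .
qed

section \<open>Functions of time with Lipschitz type derivative bounds\<close>

text \<open>What remains of a function \<open>f\<close> of the Lipschitz space at one point \<open>x\<close>: \<open>u j r\<close> stands for
  \<open>\<partial>\<^sup>j P\<^sub>r f(x) / \<partial>r\<^sup>j\<close> and \<open>L\<close> for \<open>\<parallel>f\<parallel>\<^sub>\<infinity> + A\<close>.  The constants \<open>c\<close> depend neither on \<open>f\<close> nor on \<open>x\<close>; this is
  why the estimates below put the quantifiers over \<open>L\<close> and \<open>u\<close> inside.\<close>
definition lip_profile :: "real \<Rightarrow> nat \<Rightarrow> (nat \<Rightarrow> real) \<Rightarrow> real \<Rightarrow> (nat \<Rightarrow> real \<Rightarrow> real) \<Rightarrow> bool" where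
  "lip_profile \<alpha> n c L u \<longleftrightarrow> 0 \<le> L \<and>
     (\<forall>j. \<forall>r>0. (u j has_real_derivative u (Suc j) r) (at r)) \<and>
     (\<forall>j. \<forall>r>0. \<bar>u j r\<bar> \<le> c j * L * r powr (- real j)) \<and>
     (\<forall>j\<ge>n. \<forall>r>0. \<bar>u j r\<bar> \<le> c j * L * r powr (\<alpha> - real j))"

text \<open>Below order \<open>\<alpha>\<close> the derivatives are bounded near \<open>0\<close>, except for a logarithm at order exactly \<open>\<alpha>\<close>,
  which the strict inequality on \<open>b\<close> absorbs.  The bound comes from order \<open>n\<close> by integrating the next derivative
  from \<open>r\<close> to \<open>1\<close>.\<close>
lemma lip_profile_near_zero:
  fixes b :: real
  assumes n: "\<alpha> < real n" and c: "\<And>j. 0 \<le> c j"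
    and b: "0 \<le> b" "real j - \<alpha> < b \<or> (n \<le> j \<and> real j - \<alpha> \<le> b)"
  shows "\<exists>C\<ge>0. \<forall>L u r. lip_profile \<alpha> n c L u \<longrightarrow> 0 < r \<longrightarrow> r \<le> 1 \<longrightarrow> \<bar>u j r\<bar> \<le> C * L * r powr (-b)"
proof -
  have top: "\<exists>C\<ge>0. \<forall>L u r. lip_profile \<alpha> n c L u \<longrightarrow> 0 < r \<longrightarrow> r \<le> 1 \<longrightarrow> \<bar>u j r\<bar> \<le> C * L * r powr (-b)"
    if j: "n \<le> j" "real j - \<alpha> \<le> b" for j b
  proof (intro exI[of _ "c j"] conjI allI impI c)
    fix L u and r :: real assume *: "lip_profile \<alpha> n c L u" "0 < r" "r \<le> 1"
    have "\<bar>u j r\<bar> \<le> c j * L * r powr (\<alpha> - real j)" using * j unfolding lip_profile_def by auto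
    also have "\<dots> \<le> c j * L * r powr (-b)"
      using * j c by (intro mult_left_mono powr_mono') (auto simp: lip_profile_def)
    finally show "\<bar>u j r\<bar> \<le> c j * L * r powr (-b)" .
  qed
  show ?thesis
  proof (cases "n \<le> j")
    case True
    then show ?thesis using b by (intro top) auto
  next
    case False
    with b have "j \<le> n" "real j - \<alpha> < b" by auto
    then show ?thesis using b(1)
    proof (induction j arbitrary: b rule: inc_induct)
      case base
      then show ?case by (intro top) auto
    next
      case (step j)
      \<comment> \<open>The next derivative is \<open>O(v\<^bsup>-b-\<delta>\<^esup>)\<close>; the factor \<open>v\<^bsup>-\<delta>\<^esup>\<close> is integrable at \<open>0\<close> because \<open>\<delta> < 1\<close>.\<close>
      define e where "e = real (Suc j) - \<alpha> - b"
      define \<delta> where "\<delta> = max 0 ((e + 1) / 2)"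
      have e: "e < 1" using step.prems by (auto simp: e_def)
      have \<delta>: "0 \<le> \<delta>" "\<delta> < 1" "e < \<delta>" using e by (auto simp: \<delta>_def max_def)
      obtain C where C: "0 \<le> C" "\<And>L u r. lip_profile \<alpha> n c L u \<Longrightarrow> 0 < r \<Longrightarrow> r \<le> 1 \<Longrightarrow> \<bar>u (Suc j) r\<bar> \<le> C * L * r powr (-(b + \<delta>))"
      proof -
        have "real (Suc j) - \<alpha> < b + \<delta>" "0 \<le> b + \<delta>" using \<delta> step.prems by (auto simp: e_def)
        from step.IH[OF this] show ?thesis using that by blast
      qed
      show ?case
      proof (intro exI[of _ "c j + C / (1 - \<delta>)"] conjI allI impI)
        show "0 \<le> c j + C / (1 - \<delta>)" using c C \<delta> by auto
        fix L u and r :: real assume *: "lip_profile \<alpha> n c L u" "0 < r" "r \<le> 1"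
        then have L: "0 \<le> L" by (auto simp: lip_profile_def)
        have one: "\<bar>u j 1\<bar> \<le> c j * L"
          using *(1) unfolding lip_profile_def
        proof (elim conjE)
          assume "\<forall>j. \<forall>r>0. \<bar>u j r\<bar> \<le> c j * L * r powr - real j"
          from this[rule_format, of 1 j] show ?thesis by simp
        qed
        define q where "q = C * L * r powr (-b)"
        have q: "0 \<le> q" using C L by (auto simp: q_def)
        have "\<bar>u j 1 - u j r\<bar> \<le> q / (1 - \<delta>) * 1 powr (1 - \<delta>) - q / (1 - \<delta>) * r powr (1 - \<delta>)"
        proof (rule abs_increment_le_by_derivative[where g' = "u (Suc j)" and \<Phi> = "\<lambda>v. q / (1 - \<delta>) * v powr (1 - \<delta>)"
              and \<phi> = "\<lambda>v. q * v powr (-\<delta>)"])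
          show "r \<le> 1" by fact
          fix v assume v: "r \<le> v" "v \<le> 1"
          then have v0: "0 < v" using * by auto
          show "(u j has_real_derivative u (Suc j) v) (at v)" using * v0 by (auto simp: lip_profile_def)
          have "((\<lambda>v. v powr (1 - \<delta>)) has_real_derivative (1 - \<delta>) * v powr (1 - \<delta> - 1)) (at v)"
            using v0 by (auto intro!: derivative_eq_intros)
          from DERIV_cmult[OF this, of "q / (1 - \<delta>)"]
          show "((\<lambda>v. q / (1 - \<delta>) * v powr (1 - \<delta>)) has_real_derivative q * v powr (-\<delta>)) (at v)"
            using \<delta>(2) by (auto elim!: DERIV_cong)
          have "\<bar>u (Suc j) v\<bar> \<le> C * L * (v powr (-b) * v powr (-\<delta>))"
            using C(2)[OF *(1) v0 v(2)] by (simp add: powr_add[symmetric])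
          also have "\<dots> \<le> C * L * (r powr (-b) * v powr (-\<delta>))"
            using v * step.prems C L by (intro mult_left_mono mult_right_mono powr_mono2') auto
          finally show "\<bar>u (Suc j) v\<bar> \<le> q * v powr (-\<delta>)" by (simp add: q_def)
        qed
        also have "\<dots> \<le> q / (1 - \<delta>)" using q \<delta> by simp
        finally have "\<bar>u j r\<bar> \<le> c j * L + q / (1 - \<delta>)" using one by linarith
        also have "\<dots> \<le> c j * L * r powr (-b) + q / (1 - \<delta>)"
        proof -
          have "1 \<le> r powr (-b)" using * step.prems powr_mono'[of "-b" 0 r] by simp
          then have "c j * L * 1 \<le> c j * L * r powr (-b)" using c L by (intro mult_left_mono) auto
          then show ?thesis by simp
        qed
        finally show "\<bar>u j r\<bar> \<le> (c j + C / (1 - \<delta>)) * L * r powr (-b)"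
          by (simp add: q_def algebra_simps)
      qed
    qed
  qed
qed

text \<open>If \<open>a l\<close> is the \<open>l\<close>-th derivative of \<open>a 0\<close>, then the derivative of \<open>exp (-\<kappa> r) * a 0 r\<close> is
  \<open>exp (-\<kappa> r) * damped_deriv \<kappa> a 0 r\<close>.  Acting on the whole family, it can be iterated without the
  Leibniz formula.\<close>
definition damped_deriv :: "real \<Rightarrow> (nat \<Rightarrow> real \<Rightarrow> real) \<Rightarrow> nat \<Rightarrow> real \<Rightarrow> real" where
  "damped_deriv \<kappa> a l r = a (Suc l) r - \<kappa> * a l r"

lemma damped_deriv_iter_Suc:
  "(damped_deriv \<kappa> ^^ Suc i) a l r = (damped_deriv \<kappa> ^^ i) a (Suc l) r - \<kappa> * (damped_deriv \<kappa> ^^ i) a l r"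
  by (simp add: damped_deriv_def)

lemma damped_deriv_chain:
  assumes "\<And>l r. 0 < r \<Longrightarrow> (a l has_real_derivative a (Suc l) r) (at r)" "0 < r"
  shows "((damped_deriv \<kappa> ^^ i) a l has_real_derivative (damped_deriv \<kappa> ^^ i) a (Suc l) r) (at r)"
  using assms(2)
proof (induction i arbitrary: l)
  case 0 then show ?case using assms by simp
next
  case (Suc i)
  show ?case unfolding damped_deriv_iter_Suc[abs_def]
    by (intro DERIV_diff DERIV_cmult Suc)
qed

lemma damped_has_derivative:
  assumes "\<And>l r. 0 < r \<Longrightarrow> (a l has_real_derivative a (Suc l) r) (at r)" "0 < r"
  shows "((\<lambda>r. exp (-\<kappa> * r) * (damped_deriv \<kappa> ^^ i) a 0 r) has_real_derivative
           exp (-\<kappa> * r) * (damped_deriv \<kappa> ^^ Suc i) a 0 r) (at r)"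
proof -
  note * = damped_deriv_chain[where a = a and \<kappa> = \<kappa> and i = i and l = 0, OF assms(1) assms(2)]
  show ?thesis
    by (auto intro!: derivative_eq_intros * simp: algebra_simps damped_deriv_iter_Suc simp del: funpow.simps(2))
qed

lemma damped_deriv_bound:
  assumes "\<And>l. l \<le> k \<Longrightarrow> \<bar>a l r\<bar> \<le> B" "0 \<le> \<kappa>" "l + i \<le> k"
  shows "\<bar>(damped_deriv \<kappa> ^^ i) a l r\<bar> \<le> (1 + \<kappa>) ^ i * B"
  using assms(3)
proof (induction i arbitrary: l)
  case 0 then show ?case using assms by simp
next
  case (Suc i)
  have 1: "\<bar>(damped_deriv \<kappa> ^^ i) a (Suc l) r\<bar> \<le> (1 + \<kappa>) ^ i * B" using Suc by auto
  have "\<bar>(damped_deriv \<kappa> ^^ i) a l r\<bar> \<le> (1 + \<kappa>) ^ i * B" using Suc by auto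
  then have 2: "\<kappa> * \<bar>(damped_deriv \<kappa> ^^ i) a l r\<bar> \<le> \<kappa> * ((1 + \<kappa>) ^ i * B)" using assms(2) by (rule mult_left_mono)
  have "\<bar>(damped_deriv \<kappa> ^^ Suc i) a l r\<bar> \<le> \<bar>(damped_deriv \<kappa> ^^ i) a (Suc l) r\<bar> + \<kappa> * \<bar>(damped_deriv \<kappa> ^^ i) a l r\<bar>"
    using assms(2) abs_triangle_ineq4[of "(damped_deriv \<kappa> ^^ i) a (Suc l) r" "\<kappa> * (damped_deriv \<kappa> ^^ i) a l r"]
    unfolding damped_deriv_iter_Suc by (simp add: abs_mult)
  also have "\<dots> \<le> (1 + \<kappa>) ^ i * B + \<kappa> * ((1 + \<kappa>) ^ i * B)" using 1 2 by linarith
  finally show ?case by (simp add: algebra_simps)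
qed

lemma damped_deriv_zero: "(damped_deriv 0 ^^ i) a l r = a (l + i) r"
  by (induction i arbitrary: l) (auto simp: damped_deriv_iter_Suc simp del: funpow.simps(2))

lemma powr_mult_exp_bounded:
  fixes b :: real
  assumes "0 \<le> b"
  shows "\<exists>E>0. \<forall>r\<ge>1. exp (- r) \<le> E * r powr (-b)"
proof -
  have "((\<lambda>r::real. r powr b * exp (-r)) \<longlongrightarrow> 0) at_top" by real_asymp
  then have "\<forall>\<^sub>F r in at_top. r powr b * exp (-r) < 1" by (rule order_tendstoD) simp
  then obtain R where R: "\<And>r. R \<le> r \<Longrightarrow> r powr b * exp (-r) < 1" by (auto simp: eventually_at_top_linorder)
  define E where "E = max 1 (\<bar>R\<bar> powr b)"
  have "exp (-r) \<le> E * r powr (-b)" if r: "1 \<le> r" for r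
  proof -
    have "r powr b * exp (-r) \<le> E"
    proof (cases "R \<le> r")
      case True then show ?thesis using R[OF True] by (auto simp: E_def)
    next
      case False
      have "r powr b * exp (-r) \<le> r powr b * 1" using r by (intro mult_left_mono) auto
      also have "\<dots> \<le> \<bar>R\<bar> powr b" using False r assms by (simp, intro powr_mono2) auto
      finally show ?thesis by (auto simp: E_def)
    qed
    then show ?thesis using r by (simp add: powr_minus field_simps)
  qed
  moreover have "0 < E" by (auto simp: E_def)
  ultimately show ?thesis by blast
qed

text \<open>For \<open>r \<le> 1\<close> this is the bound near \<open>0\<close>.  For \<open>r \<ge> 1\<close> the two values of \<open>\<kappa>\<close> need different reasons: without
  damping only the derivative of order \<open>m + k\<close> occurs, and it decays like \<open>r\<^bsup>-(m+k)\<^esup>\<close>; with damping the lower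
  derivatives occur, which decay too slowly, but the factor \<open>e\<^bsup>-r\<^esup>\<close> beats every power.\<close>
lemma lip_profile_damped_bound:
  fixes b \<kappa> :: real
  assumes n: "\<alpha> < real n" and c: "\<And>j. 0 \<le> c j" and \<kappa>: "\<kappa> = 0 \<or> \<kappa> = 1"
    and b: "0 \<le> b" "b \<le> real (m + k)" 
      "real (m + k) - \<alpha> < b \<or> (n \<le> m + k \<and> real (m + k) - \<alpha> \<le> b)"
  shows "\<exists>C\<ge>0. \<forall>L u r. lip_profile \<alpha> n c L u \<longrightarrow> 0 < r \<longrightarrow>
            \<bar>exp (-\<kappa> * r) * (damped_deriv \<kappa> ^^ k) (\<lambda>l. u (m + l)) 0 r\<bar> \<le> C * L * r powr (-b)"
proof -
  have "\<exists>C\<ge>0. \<forall>L u r. lip_profile \<alpha> n c L u \<longrightarrow> 0 < r \<longrightarrow> r \<le> 1 \<longrightarrow> \<bar>u (m + l) r\<bar> \<le> C * L * r powr (-b)"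
    if "l \<le> k" for l
  proof (rule lip_profile_near_zero[OF n c])
    show "0 \<le> b" by fact
    show "real (m + l) - \<alpha> < b \<or> n \<le> m + l \<and> real (m + l) - \<alpha> \<le> b"
      using b that by (cases "l = k") auto
  qed
  then obtain C1 where C1: "\<And>l. l \<le> k \<Longrightarrow> 0 \<le> C1 l"
     "\<And>l L u r. l \<le> k \<Longrightarrow> lip_profile \<alpha> n c L u \<Longrightarrow> 0 < r \<Longrightarrow> r \<le> 1 \<Longrightarrow> \<bar>u (m + l) r\<bar> \<le> C1 l * L * r powr (-b)"
    by metis
  define C2 where "C2 = (\<Sum>l\<le>k. C1 l) + (\<Sum>l\<le>k. c (m + l))"
  have C12: "C1 l \<le> C2" if "l \<le> k" for l
    unfolding C2_def using that C1 c by (intro add_increasing2 sum_nonneg member_le_sum) auto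
  have cC2: "c (m + l) \<le> C2" if "l \<le> k" for l
    unfolding C2_def using that C1 c by (intro add_increasing sum_nonneg member_le_sum[of l "{..k}" "\<lambda>l. c (m+l)"]) auto
  have C2: "0 \<le> C2" using c[of m] cC2[of 0] by simp
  obtain E where E: "0 < E" "\<And>r::real. 1 \<le> r \<Longrightarrow> exp (- r) \<le> E * r powr (-b)"
    using powr_mult_exp_bounded[OF b(1)] by auto
  show ?thesis
  proof (intro exI[of _ "2 ^ k * C2 * (1 + E)"] conjI allI impI)
    show "0 \<le> 2 ^ k * C2 * (1 + E)" using C2 E by auto
    fix L u and r :: real assume *: "lip_profile \<alpha> n c L u" "0 < r"
    then have L: "0 \<le> L" by (auto simp: lip_profile_def)
    have \<kappa>1: "(1 + \<kappa>) ^ k \<le> 2 ^ k" and \<kappa>0: "0 \<le> \<kappa>" using \<kappa> by auto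
    have e1: "exp (-\<kappa> * r) \<le> 1" using \<kappa>0 * by simp
    consider "r \<le> 1" | "1 \<le> r" "\<kappa> = 0" | "1 \<le> r" "\<kappa> = 1" using \<kappa> by linarith
    then show "\<bar>exp (-\<kappa> * r) * (damped_deriv \<kappa> ^^ k) (\<lambda>l. u (m + l)) 0 r\<bar> \<le> 2 ^ k * C2 * (1 + E) * L * r powr (-b)"
    proof cases
      case 1
      have "\<bar>(damped_deriv \<kappa> ^^ k) (\<lambda>l. u (m + l)) 0 r\<bar> \<le> (1 + \<kappa>) ^ k * (C2 * L * r powr (-b))"
      proof (rule damped_deriv_bound[OF _ \<kappa>0])
        fix l assume l: "l \<le> k"
        have "\<bar>u (m + l) r\<bar> \<le> C1 l * L * r powr (-b)" using C1 l * 1 by auto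
        also have "\<dots> \<le> C2 * L * r powr (-b)" using C12[OF l] L by (intro mult_right_mono) auto
        finally show "\<bar>u (m + l) r\<bar> \<le> C2 * L * r powr (-b)" .
      qed simp
      also have "\<dots> \<le> 2 ^ k * (C2 * L * r powr (-b))" using \<kappa>1 C2 L by (intro mult_right_mono) auto
      finally have 1: "\<bar>(damped_deriv \<kappa> ^^ k) (\<lambda>l. u (m + l)) 0 r\<bar> \<le> 2 ^ k * (C2 * L * r powr (-b))" .
      have "\<bar>exp (-\<kappa> * r) * (damped_deriv \<kappa> ^^ k) (\<lambda>l. u (m + l)) 0 r\<bar> \<le> 1 * (2 ^ k * (C2 * L * r powr (-b)))"
        unfolding abs_mult using e1 by (intro mult_mono 1) auto
      also have "\<dots> = 2 ^ k * C2 * 1 * L * r powr (-b)" by simp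
      also have "\<dots> \<le> 2 ^ k * C2 * (1 + E) * L * r powr (-b)"
        using C2 L E by (intro mult_right_mono mult_left_mono) auto
      finally show ?thesis .
    next
      case 2
      have "\<bar>u (m + k) r\<bar> \<le> c (m + k) * L * r powr (- real (m + k))" using * unfolding lip_profile_def by blast
      also have "\<dots> \<le> C2 * L * r powr (- b)"
        using cC2[of k] L 2 b c C2 by (intro mult_mono powr_mono) auto
      also have "\<dots> = 1 * C2 * 1 * L * r powr (-b)" by simp
      also have "\<dots> \<le> 2 ^ k * C2 * (1 + E) * L * r powr (-b)"
        using C2 L E by (intro mult_right_mono mult_mono) auto
      finally show ?thesis using 2 by (simp add: damped_deriv_zero)
    next
      case 3
      have 1: "\<bar>(damped_deriv \<kappa> ^^ k) (\<lambda>l. u (m + l)) 0 r\<bar> \<le> (1 + \<kappa>) ^ k * (C2 * L)"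
      proof (rule damped_deriv_bound[OF _ \<kappa>0])
        fix l assume l: "l \<le> k"
        have "\<bar>u (m + l) r\<bar> \<le> c (m + l) * L * r powr (- real (m + l))" using * unfolding lip_profile_def by blast
        also have "\<dots> \<le> C2 * L * r powr 0" using cC2[OF l] L C2 c 3 by (intro mult_mono powr_mono) auto
        finally show "\<bar>u (m + l) r\<bar> \<le> C2 * L" using * by simp
      qed simp
      have "\<bar>exp (-\<kappa> * r) * (damped_deriv \<kappa> ^^ k) (\<lambda>l. u (m + l)) 0 r\<bar> \<le> (E * r powr (-b)) * ((1 + \<kappa>) ^ k * (C2 * L))"
        unfolding abs_mult using E(2)[OF 3(1)] 3 E by (intro mult_mono 1) auto
      also have "\<dots> = 2 ^ k * C2 * E * L * r powr (-b)" using 3 by simp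
      also have "\<dots> \<le> 2 ^ k * C2 * (1 + E) * L * r powr (-b)"
        using C2 L E by (intro mult_right_mono mult_left_mono) auto
      finally show ?thesis .
    qed
  qed
qed

lemma lip_profile_fwd_diff_bound:
  fixes b \<kappa> :: real
  assumes n: "\<alpha> < real n" and c: "\<And>j. 0 \<le> c j" and \<kappa>: "\<kappa> = 0 \<or> \<kappa> = 1"
    and b: "0 \<le> b" "b \<le> real (m + k)" 
      "real (m + k) - \<alpha> < b \<or> (n \<le> m + k \<and> real (m + k) - \<alpha> \<le> b)"
    and \<eta>: "0 \<le> \<eta>" "\<eta> < 1" "real k * \<eta> \<le> b"
  shows "\<exists>C\<ge>0. \<forall>L u s r. lip_profile \<alpha> n c L u \<longrightarrow> 0 < s \<longrightarrow> 0 < r \<longrightarrow>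
            \<bar>(fwd_diff s ^^ k) (\<lambda>r. exp (-\<kappa> * r) * u m r) r\<bar>
               \<le> C * L * s powr (real k * (1 - \<eta>)) * r powr (-(b - real k * \<eta>))"
proof -
  obtain C where C: "0 \<le> C" "\<And>L u r. lip_profile \<alpha> n c L u \<Longrightarrow> 0 < r \<Longrightarrow>
            \<bar>exp (-\<kappa> * r) * (damped_deriv \<kappa> ^^ k) (\<lambda>l. u (m + l)) 0 r\<bar> \<le> C * L * r powr (-b)"
    using lip_profile_damped_bound[where c = c, OF n c \<kappa> b] by blast
  show ?thesis
  proof (intro exI[of _ "C * (1 / (1 - \<eta>)) ^ k"] conjI allI impI)
    show "0 \<le> C * (1 / (1 - \<eta>)) ^ k" using C \<eta> by auto
    fix L u and s r :: real assume *: "lip_profile \<alpha> n c L u" "0 < s" "0 < r"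
    have "\<bar>(fwd_diff s ^^ k) ((\<lambda>i r. exp (-\<kappa> * r) * (damped_deriv \<kappa> ^^ i) (\<lambda>l. u (m + l)) 0 r) 0) r\<bar>
       \<le> (C * L) * (1 / (1 - \<eta>)) ^ k * s powr (real k * (1 - \<eta>)) * r powr (-(b - real k * \<eta>))"
    proof (rule fwd_diff_iter_bound[where F = "\<lambda>i r. exp (-\<kappa> * r) * (damped_deriv \<kappa> ^^ i) (\<lambda>l. u (m + l)) 0 r" and \<gamma> = b])
      show "((\<lambda>r. exp (-\<kappa> * r) * (damped_deriv \<kappa> ^^ i) (\<lambda>l. u (m + l)) 0 r) has_real_derivative
           exp (-\<kappa> * r) * (damped_deriv \<kappa> ^^ Suc i) (\<lambda>l. u (m + l)) 0 r) (at r)" if "0 < r" for i and r :: real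
        using * that by (intro damped_has_derivative) (auto simp: lip_profile_def)
    next
      show "\<bar>exp (-\<kappa> * r) * (damped_deriv \<kappa> ^^ k) (\<lambda>l. u (m + l)) 0 r\<bar> \<le> C * L * r powr - b" if "0 < r" for r
        by (rule C(2)[OF *(1) that])
    qed (use * \<eta> in auto)
    then show "\<bar>(fwd_diff s ^^ k) (\<lambda>r. exp (-\<kappa> * r) * u m r) r\<bar>
               \<le> C * (1 / (1 - \<eta>)) ^ k * L * s powr (real k * (1 - \<eta>)) * r powr (-(b - real k * \<eta>))"
      by (simp add: mult_ac)
  qed
qed

section \<open>Parametric integrals\<close>

text \<open>The hypothesis holds only almost everywhere because the functions in the applications are
  only essentially bounded.\<close>
lemma swap_integrals:
  fixes H :: "'a::euclidean_space \<Rightarrow> 'b::euclidean_space \<Rightarrow> real"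
  assumes meas: "(\<lambda>(x, y). H x y) \<in> borel_measurable (borel \<Otimes>\<^sub>M borel)"
    and a: "integrable lborel a"
    and bound: "AE x in lborel. integrable lborel (H x) \<and> (LINT y|lborel. \<bar>H x y\<bar>) \<le> a x"
  shows "integrable lborel (\<lambda>y. LINT x|lborel. H x y)" (is ?B)
    and "(LINT x|lborel. LINT y|lborel. H x y) = (LINT y|lborel. LINT x|lborel. H x y)" (is ?C)
proof -
  have m: "(\<lambda>(x, y). H x y) \<in> borel_measurable (lborel \<Otimes>\<^sub>M lborel)"
    using meas by (simp add: lborel_prod borel_prod)
  note [measurable] = m
  have int: "integrable (lborel \<Otimes>\<^sub>M lborel) (\<lambda>(x, y). H x y)"
  proof (rule lborel_pair.Fubini_integrable[OF m])
    show "integrable lborel (\<lambda>x. LINT y|lborel. norm (case (x, y) of (x, y) \<Rightarrow> H x y))"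
    proof (rule Bochner_Integration.integrable_bound[OF a])
      show "(\<lambda>x. LINT y|lborel. norm (case (x, y) of (x, y) \<Rightarrow> H x y)) \<in> borel_measurable lborel"
        by measurable
      show "AE x in lborel. norm (LINT y|lborel. norm (case (x, y) of (x, y) \<Rightarrow> H x y)) \<le> norm (a x)"
        using bound by eventually_elim (auto simp: integral_nonneg_AE)
    qed
    show "AE x in lborel. integrable lborel (\<lambda>y. case (x, y) of (x, y) \<Rightarrow> H x y)"
      using bound by eventually_elim auto
  qed
  show ?B using lborel_pair.integrable_snd[OF int] by simp
  show ?C using lborel_pair.Fubini_integral[OF int] by simp
qed

lemma borel_measurable_parametric_integral:
  fixes f :: "'a \<Rightarrow> 'b::euclidean_space \<Rightarrow> real"
  assumes "(\<lambda>(x, y). f x y) \<in> borel_measurable (N \<Otimes>\<^sub>M borel)"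
  shows "(\<lambda>x. LINT y|lborel. f x y) \<in> borel_measurable N"
proof (rule lborel.borel_measurable_lebesgue_integral)
  have "sets (N \<Otimes>\<^sub>M (lborel :: 'b measure)) = sets (N \<Otimes>\<^sub>M borel)"
    by (rule sets_pair_measure_cong) auto
  from measurable_cong_sets[OF this refl] assms
  show "(\<lambda>(x, y). f x y) \<in> borel_measurable (N \<Otimes>\<^sub>M lborel)" by auto
qed

section \<open>The Mehler kernel\<close>

lemma nn_integral_gaussian_real:
  fixes c :: real
  assumes "0 < c"
  shows "(\<integral>\<^sup>+ x. ennreal (exp (- (c * x\<^sup>2))) \<partial>lborel) = ennreal (sqrt (pi / c))"
proof -
  define \<sigma> where "\<sigma> = sqrt (1 / (2 * c))"
  have \<sigma>: "0 < \<sigma>" "\<sigma>\<^sup>2 = 1 / (2 * c)" using assms by (auto simp: \<sigma>_def)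
  have eq: "exp (- (c * x\<^sup>2)) = sqrt (pi / c) * normal_density 0 \<sigma> x" for x
    using assms unfolding normal_density_def \<sigma>(2) by (simp add: real_sqrt_divide field_simps)
  have "(\<integral>\<^sup>+ x. ennreal (exp (- (c * x\<^sup>2))) \<partial>lborel) = ennreal (LINT x|lborel. exp (- (c * x\<^sup>2)))"
    unfolding eq using \<sigma> by (intro nn_integral_eq_integral) (auto intro!: integrable_mult_right integrable_normal_density simp: assms less_imp_le)
  also have "(LINT x|lborel. exp (- (c * x\<^sup>2))) = sqrt (pi / c)"
    unfolding eq using \<sigma> by (simp add: integral_normal_density)
  finally show ?thesis .
qed

lemma nn_integral_gaussian_vec:
  fixes c :: real
  assumes c: "0 < c"
  shows "(\<integral>\<^sup>+ x. ennreal (exp (- (c * (norm x)\<^sup>2))) \<partial>(lborel :: (real^'d::finite) measure)) = ennreal ((pi / c) powr (real CARD('d) / 2))"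
proof -
  have eq: "ennreal (exp (- (c * (norm x)\<^sup>2))) = (\<Prod>b\<in>Basis. ennreal (exp (- (c * (x \<bullet> b)\<^sup>2))))" for x :: "real^'d"
  proof -
    have "(norm x)\<^sup>2 = (\<Sum>b\<in>Basis. (x \<bullet> b)\<^sup>2)"
      unfolding power2_norm_eq_inner by (subst euclidean_inner) (simp add: power2_eq_square)
    then have "exp (- (c * (norm x)\<^sup>2)) = (\<Prod>b\<in>Basis. exp (- (c * (x \<bullet> b)\<^sup>2)))"
      by (simp add: sum_distrib_left exp_sum[symmetric] sum_negf)
    then show ?thesis by (simp add: prod_ennreal)
  qed
  have "(\<integral>\<^sup>+ x. ennreal (exp (- (c * (norm x)\<^sup>2))) \<partial>(lborel :: (real^'d) measure)) = (\<Prod>b\<in>(Basis::(real^'d) set). \<integral>\<^sup>+ x. ennreal (exp (- (c * x\<^sup>2))) \<partial>lborel)"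
    unfolding eq by (rule nn_integral_lborel_prod) auto
  also have "\<dots> = ennreal (sqrt (pi / c)) ^ CARD('d)"
    by (simp add: nn_integral_gaussian_real[OF c])
  also have "\<dots> = ennreal ((pi / c) powr (real CARD('d) / 2))"
    using c by (simp add: ennreal_power powr_half_sqrt[symmetric] powr_power)
  finally show ?thesis .
qed

lemma has_bochner_integral_gaussian_vec:
  fixes c :: real and p :: "real^'d::finite"
  assumes c: "0 < c"
  shows "has_bochner_integral lborel (\<lambda>x. exp (- (c * (norm (x - p))\<^sup>2))) ((pi / c) powr (real CARD('d) / 2))"
proof (rule has_bochner_integral_nn_integral)
  have "(\<integral>\<^sup>+ x. ennreal (exp (- (c * (norm (x - p))\<^sup>2))) \<partial>lborel)
      = (\<integral>\<^sup>+ x. ennreal (exp (- (c * (norm (x - p))\<^sup>2))) \<partial>(distr lborel borel ((+) p)))"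
    by (simp add: lborel_distr_plus)
  also have "\<dots> = (\<integral>\<^sup>+ x. ennreal (exp (- (c * (norm x)\<^sup>2))) \<partial>(lborel :: (real^'d) measure))"
    by (subst nn_integral_distr) auto
  finally show "(\<integral>\<^sup>+ x. ennreal (exp (- (c * (norm (x - p))\<^sup>2))) \<partial>lborel) = ennreal ((pi / c) powr (real CARD('d) / 2))"
    using nn_integral_gaussian_vec[OF c] by simp
qed auto

definition mehler :: "real \<Rightarrow> real^'d::finite \<Rightarrow> real^'d \<Rightarrow> real" where
  "mehler t x y = 1 / (pi powr (real CARD('d) / 2) * (1 - exp (- 2 * t)) powr (real CARD('d) / 2)) *
       exp (- (norm (y - exp (- t) *\<^sub>R x))\<^sup>2 / (1 - exp (- 2 * t)))"

lemma mehler_nonneg: "0 \<le> mehler t x y"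
  by (simp add: mehler_def)

lemma measurable_mehler [measurable (raw)]:
  assumes [measurable]: "g \<in> borel_measurable N" "a \<in> borel_measurable N" "b \<in> borel_measurable N"
  shows "(\<lambda>z. mehler (g z) (a z) (b z)) \<in> borel_measurable N"
  unfolding mehler_def by measurable

lemma has_bochner_integral_mehler:
  fixes x :: "real^'d::finite"
  assumes "0 < t"
  shows "has_bochner_integral lborel (mehler t x) 1"
proof -
  define A where "A = 1 - exp (- 2 * t)"
  have A: "0 < A" using assms by (simp add: A_def)
  have "has_bochner_integral lborel (\<lambda>y. 1 / (pi powr (real CARD('d) / 2) * A powr (real CARD('d) / 2)) *
        exp (- (1 / A * (norm (y - exp (- t) *\<^sub>R x))\<^sup>2)))
      (1 / (pi powr (real CARD('d) / 2) * A powr (real CARD('d) / 2)) * (pi / (1 / A)) powr (real CARD('d) / 2))"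
    using A by (intro has_bochner_integral_mult_right has_bochner_integral_gaussian_vec) auto
  then show ?thesis using A unfolding mehler_def[abs_def] A_def[symmetric] by (simp add: powr_mult)
qed

text \<open>Here \<open>v\<close> and \<open>q\<close> are the displacements of the intermediate and of the final point from their means,
  \<open>A\<close> and \<open>B\<close> the variances of the two steps, and \<open>D\<close> is the variance of the composed step.\<close>
lemma complete_square_mehler:
  fixes v q :: "'a::real_inner"
  assumes "0 < A" "0 < B" "D = B + b\<^sup>2 * A"
  shows "(norm v)\<^sup>2 / A + (norm (q - b *\<^sub>R v))\<^sup>2 / B
       = D / (A * B) * (norm (v - (b * A / D) *\<^sub>R q))\<^sup>2 + (norm q)\<^sup>2 / D"
proof -
  have D: "0 < D" using assms by (auto intro: add_pos_nonneg)
  define V W Q where "V = v \<bullet> v" and "W = v \<bullet> q" and "Q = q \<bullet> q"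
  have 1: "(norm (q - b *\<^sub>R v))\<^sup>2 = Q - 2 * b * W + b\<^sup>2 * V"
    unfolding power2_norm_eq_inner
    by (simp add: inner_diff_left inner_diff_right V_def W_def Q_def inner_commute power2_eq_square algebra_simps)
  have 2: "(norm (v - (b * A / D) *\<^sub>R q))\<^sup>2 = V - 2 * (b * A / D) * W + (b * A / D)\<^sup>2 * Q"
    unfolding power2_norm_eq_inner
    by (simp add: inner_diff_left inner_diff_right V_def W_def Q_def inner_commute power2_eq_square algebra_simps)
  have "D / (A * B) * (V - 2 * (b * A / D) * W + (b * A / D)\<^sup>2 * Q) + Q / D
     = D / (A * B) * V - 2 * b / B * W + (b\<^sup>2 * A + B) / (B * D) * Q"
    using assms(1,2) D by (simp add: field_simps power2_eq_square)
  also have "\<dots> = V / A + (Q - 2 * b * W + b\<^sup>2 * V) / B"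
    using assms D by (simp add: add.commute) (simp add: field_simps power2_eq_square)
  finally show ?thesis unfolding 1 2 by (simp add: power2_norm_eq_inner V_def Q_def)
qed

lemma mehler_chapman_kolmogorov:
  fixes x z :: "real^'d::finite"
  assumes s: "0 < s" and t: "0 < t"
  shows "has_bochner_integral lborel (\<lambda>y. mehler s x y * mehler t y z) (mehler (s + t) x z)"
proof -
  define d where "d = real CARD('d) / 2"
  define A B D b where "A = 1 - exp (- 2 * s)" and "B = 1 - exp (- 2 * t)" and "D = 1 - exp (- 2 * (s + t))"
    and "b = exp (- t)"
  have A: "0 < A" and B: "0 < B" and D: "0 < D" using s t by (auto simp: A_def B_def D_def)
  have Deq: "D = B + b\<^sup>2 * A"
    by (simp add: A_def B_def D_def b_def power2_eq_square algebra_simps exp_add[symmetric])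
  define p where "p = exp (- s) *\<^sub>R x"
  define q where "q = z - b *\<^sub>R p"
  define C where "C = D / (A * B)"
  have C: "0 < C" using A B D by (simp add: C_def)
  have q: "q = z - exp (- (s + t)) *\<^sub>R x" by (simp add: q_def p_def b_def exp_add[symmetric])
  have eq: "mehler s x y * mehler t y z = 1 / ((pi powr d * A powr d) * (pi powr d * B powr d)) * exp (- (norm q)\<^sup>2 / D)
       * exp (- (C * (norm (y - (p + (b * A / D) *\<^sub>R q)))\<^sup>2))" for y
  proof -
    have *: "(norm (y - p))\<^sup>2 / A + (norm (z - b *\<^sub>R y))\<^sup>2 / B = C * (norm (y - (p + (b * A / D) *\<^sub>R q)))\<^sup>2 + (norm q)\<^sup>2 / D"
      using complete_square_mehler[OF A B Deq, of "y - p" q] by (simp add: C_def q_def algebra_simps)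
    have "exp (- (norm (y - p))\<^sup>2 / A) * exp (- (norm (z - b *\<^sub>R y))\<^sup>2 / B)
       = exp (- ((norm (y - p))\<^sup>2 / A + (norm (z - b *\<^sub>R y))\<^sup>2 / B))" by (simp add: exp_add[symmetric])
    also have "\<dots> = exp (- (norm q)\<^sup>2 / D) * exp (- (C * (norm (y - (p + (b * A / D) *\<^sub>R q)))\<^sup>2))"
      unfolding * by (simp add: exp_add[symmetric])
    finally show ?thesis
      unfolding mehler_def d_def[symmetric] A_def[symmetric] B_def[symmetric] b_def[symmetric] p_def[symmetric]
      by simp
  qed
  have "(pi / C) powr d = (pi powr d) * (A powr d) * (B powr d) / D powr d"
    using A B D unfolding C_def by (simp add: powr_mult powr_divide)
  then have val: "1 / ((pi powr d * A powr d) * (pi powr d * B powr d)) * exp (- (norm q)\<^sup>2 / D) * (pi / C) powr d = mehler (s + t) x z"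
    using A B D unfolding mehler_def d_def[symmetric] D_def[symmetric] q[symmetric] by (simp add: field_simps)
  show ?thesis unfolding eq val[symmetric] d_def
    by (intro has_bochner_integral_mult_right has_bochner_integral_gaussian_vec C)
qed

text \<open>The exponent of the left side is \<open>-(|x|\<^sup>2 + |y|\<^sup>2 - 2 e\<^bsup>-t\<^esup> x \<bullet> y) / (1 - e\<^bsup>-2t\<^esup>)\<close>.  Hence the semigroup is
  symmetric with respect to the Gaussian measure.\<close>
lemma mehler_symmetric:
  fixes x y :: "real^'d::finite"
  assumes "0 < t"
  shows "exp (- (norm x)\<^sup>2) * mehler t x y = exp (- (norm y)\<^sup>2) * mehler t y x"
proof -
  define a A where "a = exp (- t)" and "A = 1 - exp (- 2 * t)"
  have A: "0 < A" "A = 1 - a\<^sup>2" using assms by (auto simp: a_def A_def power2_eq_square exp_add[symmetric])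
  define X Y W where "X = x \<bullet> x" and "Y = y \<bullet> y" and "W = x \<bullet> y"
  have "(norm (y - a *\<^sub>R x))\<^sup>2 = Y - 2 * a * W + a\<^sup>2 * X" "(norm (x - a *\<^sub>R y))\<^sup>2 = X - 2 * a * W + a\<^sup>2 * Y"
    unfolding power2_norm_eq_inner
    by (simp_all add: inner_diff_left inner_diff_right X_def Y_def W_def inner_commute power2_eq_square algebra_simps)
  moreover have "X + (Y - 2 * a * W + a\<^sup>2 * X) / A = Y + (X - 2 * a * W + a\<^sup>2 * Y) / A"
  proof -
    have "X * A + (Y - 2 * a * W + a\<^sup>2 * X) = Y * A + (X - 2 * a * W + a\<^sup>2 * Y)"
      unfolding A(2) by (simp add: algebra_simps)
    then show ?thesis using A(1) by (simp add: field_simps)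
  qed
  ultimately have "(norm x)\<^sup>2 + (norm (y - a *\<^sub>R x))\<^sup>2 / A = (norm y)\<^sup>2 + (norm (x - a *\<^sub>R y))\<^sup>2 / A"
    by (simp add: power2_norm_eq_inner X_def Y_def)
  then have "exp (- (norm x)\<^sup>2) * exp (- (norm (y - a *\<^sub>R x))\<^sup>2 / A) = exp (- (norm y)\<^sup>2) * exp (- (norm (x - a *\<^sub>R y))\<^sup>2 / A)"
    unfolding exp_add[symmetric] by simp
  then show ?thesis unfolding mehler_def a_def A_def by simp
qed

section \<open>The Ornstein-Uhlenbeck semigroup on essentially bounded functions\<close>

text \<open>The Gaussian and the Lebesgue measure have the same null sets, so this is membership in \<open>L\<^sup>\<infinity>(\<gamma>)\<close> with norm
  at most \<open>M\<close>.\<close>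
definition ess_bounded :: "real \<Rightarrow> (real^'d::finite \<Rightarrow> real) \<Rightarrow> bool" where
  "ess_bounded M f \<longleftrightarrow> f \<in> borel_measurable borel \<and> (AE x in lborel. \<bar>f x\<bar> \<le> M)"

lemma ess_bounded_measurable: "ess_bounded M f \<Longrightarrow> f \<in> borel_measurable borel"
  by (simp add: ess_bounded_def)

lemma ess_bounded_nonneg: 
  fixes f :: "real^'d::finite \<Rightarrow> real"
  assumes "ess_bounded M f" shows "0 \<le> M"
proof (rule ccontr)
  assume M: "\<not> 0 \<le> M"
  have "AE x in (lborel :: (real^'d) measure). \<bar>f x\<bar> \<le> M" using assms by (simp add: ess_bounded_def)
  then have "AE x in (lborel :: (real^'d) measure). False" by eventually_elim (use M in auto)
  then show False using AE_iff_measurable[of UNIV lborel "\<lambda>x::real^'d. False"] by (simp add: emeasure_lborel_UNIV)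
qed

definition ou :: "real \<Rightarrow> (real^'d::finite \<Rightarrow> real) \<Rightarrow> real^'d \<Rightarrow> real" where
  "ou t f x = (LINT y|lborel. mehler t x y * f y)"

lemma OU_eq_ou: "t \<noteq> 0 \<Longrightarrow> OU t f x = ou t f x"
  by (simp add: OU_def ou_def mehler_def mult.assoc flip: integral_mult_right_zero)

lemma integrable_mehler_mult:
  assumes "0 < t" "ess_bounded M f"
  shows "integrable lborel (\<lambda>y. mehler t x y * f y)"
proof (rule Bochner_Integration.integrable_bound[of lborel "\<lambda>y. mehler t x y * M"])
  show "integrable lborel (\<lambda>y. mehler t x y * M)"
    using has_bochner_integral_mehler[OF assms(1)] by (auto simp: has_bochner_integral_iff)
  have [measurable]: "f \<in> borel_measurable borel" using assms by (rule_tac ess_bounded_measurable)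
  show "(\<lambda>y. mehler t x y * f y) \<in> borel_measurable lborel" by measurable
  have "AE y in lborel. \<bar>f y\<bar> \<le> M" using assms by (simp add: ess_bounded_def)
  then show "AE y in lborel. norm (mehler t x y * f y) \<le> norm (mehler t x y * M)"
    by eventually_elim (auto simp: abs_mult mehler_nonneg intro!: mult_left_mono)
qed

lemma abs_ou_le:
  assumes "0 < t" "ess_bounded M f"
  shows "\<bar>ou t f x\<bar> \<le> M" "(LINT y|lborel. \<bar>mehler t x y * f y\<bar>) \<le> M"
proof -
  have *: "has_bochner_integral lborel (\<lambda>y. mehler t x y * M) (1 * M)"
    by (intro has_bochner_integral_mult_left has_bochner_integral_mehler assms)
  have "AE y in lborel. \<bar>f y\<bar> \<le> M" using assms by (simp add: ess_bounded_def)
  then have "AE y in lborel. \<bar>mehler t x y * f y\<bar> \<le> mehler t x y * M"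
    by eventually_elim (auto simp: abs_mult mehler_nonneg intro!: mult_left_mono)
  then have "(LINT y|lborel. \<bar>mehler t x y * f y\<bar>) \<le> (LINT y|lborel. mehler t x y * M)"
    using * by (intro integral_mono_AE integrable_abs integrable_mehler_mult[OF assms]) (auto simp: has_bochner_integral_iff)
  then show 2: "(LINT y|lborel. \<bar>mehler t x y * f y\<bar>) \<le> M" using * by (auto simp: has_bochner_integral_iff)
  show "\<bar>ou t f x\<bar> \<le> M" unfolding ou_def
    using integral_abs_bound[of lborel "\<lambda>y. mehler t x y * f y"] 2 by linarith
qed

lemma measurable_ou [measurable (raw)]:
  assumes [measurable]: "f \<in> borel_measurable borel" "g \<in> borel_measurable N" "a \<in> borel_measurable N"
  shows "(\<lambda>z. ou (g z) f (a z)) \<in> borel_measurable N"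
  unfolding ou_def by (rule borel_measurable_parametric_integral) measurable

lemma measurable_ou_family:
  assumes F: "(\<lambda>(w, y). F w y) \<in> borel_measurable (N \<Otimes>\<^sub>M borel)"
    and [measurable]: "g \<in> borel_measurable N" "a \<in> borel_measurable N"
  shows "(\<lambda>w. ou (g w) (F w) (a w)) \<in> borel_measurable N"
proof -
  note [measurable] = F
  show ?thesis unfolding ou_def by (rule borel_measurable_parametric_integral) measurable
qed

lemma ess_bounded_ou: "0 < t \<Longrightarrow> ess_bounded M f \<Longrightarrow> ess_bounded M (ou t f)"
  unfolding ess_bounded_def[of M "ou t f"]
  using abs_ou_le[of t M f] measurable_ou[of f "\<lambda>_. t" borel "\<lambda>x. x"] ess_bounded_measurable[of M f] by auto

lemma ou_linear:
  assumes "0 < t" "ess_bounded M f" "ess_bounded M' g"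
  shows "ou t (\<lambda>y. a * f y - g y) x = a * ou t f x - ou t g x"
proof -
  have "(LINT y|lborel. a * (mehler t x y * f y) - mehler t x y * g y) = a * ou t f x - ou t g x"
    unfolding ou_def using integrable_mehler_mult[OF assms(1,2)] integrable_mehler_mult[OF assms(1,3)]
    by (subst Bochner_Integration.integral_diff) auto
  then show ?thesis by (simp add: ou_def algebra_simps)
qed

lemma ou_semigroup:
  assumes s: "0 < s" and t: "0 < t" and f: "ess_bounded M f"
  shows "ou s (ou t f) x = ou (s + t) f x"
proof -
  have [measurable]: "f \<in> borel_measurable borel" using f by (rule ess_bounded_measurable)
  have "(LINT y|lborel. LINT z|lborel. mehler s x y * (mehler t y z * f z)) = (LINT z|lborel. LINT y|lborel. mehler s x y * (mehler t y z * f z))"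
  proof (rule swap_integrals(2))
    show "(\<lambda>(y, z). mehler s x y * (mehler t y z * f z)) \<in> borel_measurable (borel \<Otimes>\<^sub>M borel)" by measurable
    show "integrable lborel (\<lambda>y. mehler s x y * M)"
      using has_bochner_integral_mehler[OF s] by (auto simp: has_bochner_integral_iff)
    show "AE y in lborel. integrable lborel (\<lambda>z. mehler s x y * (mehler t y z * f z)) \<and>
          (LINT z|lborel. \<bar>mehler s x y * (mehler t y z * f z)\<bar>) \<le> mehler s x y * M"
    proof (rule AE_I2, rule conjI)
      fix y
      show "integrable lborel (\<lambda>z. mehler s x y * (mehler t y z * f z))"
        by (intro integrable_mult_right integrable_mehler_mult[OF t f])
      have "(LINT z|lborel. \<bar>mehler s x y * (mehler t y z * f z)\<bar>) = mehler s x y * (LINT z|lborel. \<bar>mehler t y z * f z\<bar>)"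
        by (simp add: abs_mult mehler_nonneg)
      then show "(LINT z|lborel. \<bar>mehler s x y * (mehler t y z * f z)\<bar>) \<le> mehler s x y * M"
        using abs_ou_le(2)[OF t f, of y] by (simp add: mult_left_mono mehler_nonneg)
    qed
  qed
  moreover have "(LINT y|lborel. mehler s x y * (mehler t y z * f z)) = mehler (s + t) x z * f z" for z
    using mehler_chapman_kolmogorov[OF s t, of x z] by (simp add: has_bochner_integral_iff mult.assoc[symmetric])
  ultimately show ?thesis unfolding ou_def by simp
qed

lemma ou_integral_commute:
  fixes F :: "real \<Rightarrow> real^'d::finite \<Rightarrow> real"
  assumes t: "0 < t" and F: "(\<lambda>(s, y). F s y) \<in> borel_measurable (borel \<Otimes>\<^sub>M borel)"
    and B: "integrable lborel B" and bound: "AE y in lborel. \<forall>s. \<bar>F s y\<bar> \<le> B s"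
  shows "ou t (\<lambda>y. LINT s|lborel. F s y) x = (LINT s|lborel. ou t (F s) x)"
    and "integrable lborel (\<lambda>s. ou t (F s) x)"
proof -
  note [measurable] = F
  have m: "(\<lambda>(y, s). mehler t x y * F s y) \<in> borel_measurable (borel \<Otimes>\<^sub>M borel)" by measurable
  have a: "integrable lborel (\<lambda>y. mehler t x y * (LINT s|lborel. B s))"
      using has_bochner_integral_mehler[OF t] by (auto simp: has_bochner_integral_iff)
  have b: "AE y in lborel. integrable lborel (\<lambda>s. mehler t x y * F s y) \<and>
          (LINT s|lborel. \<bar>mehler t x y * F s y\<bar>) \<le> mehler t x y * (LINT s|lborel. B s)"
    using bound
  proof eventually_elim
    fix y assume y: "\<forall>s. \<bar>F s y\<bar> \<le> B s"
    have i: "integrable lborel (\<lambda>s. F s y)"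
    proof (rule Bochner_Integration.integrable_bound[OF B])
      show "(\<lambda>s. F s y) \<in> borel_measurable lborel" by measurable
      have "norm (F s y) \<le> norm (B s)" for s using y[rule_format, of s] by auto
      then show "AE s in lborel. norm (F s y) \<le> norm (B s)" by auto
    qed
    have "(LINT s|lborel. \<bar>F s y\<bar>) \<le> (LINT s|lborel. B s)" using i B y by (intro integral_mono) auto
    then show "integrable lborel (\<lambda>s. mehler t x y * F s y) \<and>
          (LINT s|lborel. \<bar>mehler t x y * F s y\<bar>) \<le> mehler t x y * (LINT s|lborel. B s)"
      using i by (auto simp: abs_mult mehler_nonneg intro!: mult_left_mono)
  qed
  show "ou t (\<lambda>y. LINT s|lborel. F s y) x = (LINT s|lborel. ou t (F s) x)"
    using swap_integrals(2)[OF m a b] unfolding ou_def by simp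
  show "integrable lborel (\<lambda>s. ou t (F s) x)"
    using swap_integrals(1)[OF m a b] unfolding ou_def by simp
qed

text \<open>After the substitution \<open>y = e\<^bsup>-t\<^esup> x + (1 - e\<^bsup>-2t\<^esup>)\<^bsup>1/2\<^esup> z\<close> the weight does not depend on \<open>t\<close>, which
  makes dominated convergence applicable as \<open>t \<rightarrow> 0\<close>.\<close>
lemma ou_eq_mehler_formula:
  fixes f :: "real^'d::finite \<Rightarrow> real"
  assumes t: "0 < t" and f[measurable]: "f \<in> borel_measurable borel"
  shows "ou t f x = (LINT z|lborel. pi powr (- (real CARD('d) / 2)) * exp (- (norm z)\<^sup>2) * f (exp (- t) *\<^sub>R x + sqrt (1 - exp (- 2 * t)) *\<^sub>R z))"
proof -
  define A where "A = 1 - exp (- 2 * t)"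
  define c where "c = sqrt A"
  have A: "0 < A" using t by (simp add: A_def)
  then have c: "0 < c" "c\<^sup>2 = A" by (auto simp: c_def)
  define p where "p = exp (- t) *\<^sub>R x"
  have pw: "c ^ CARD('d) = A powr (real CARD('d) / 2)"
    using A unfolding c_def by (simp add: powr_half_sqrt[symmetric] powr_power)
  have "ou t f x = (LINT y|density (distr lborel borel (\<lambda>z. p + c *\<^sub>R z)) (\<lambda>_. ennreal (\<bar>c\<bar> ^ DIM(real^'d))). mehler t x y * f y)"
    unfolding ou_def using lborel_affine[of c p] c by simp
  also have "\<dots> = (LINT y|distr lborel borel (\<lambda>z. p + c *\<^sub>R z). \<bar>c\<bar> ^ DIM(real^'d) *\<^sub>R (mehler t x y * f y))"
    by (intro integral_density) auto
  also have "\<dots> = (LINT z|lborel. \<bar>c\<bar> ^ DIM(real^'d) *\<^sub>R (mehler t x (p + c *\<^sub>R z) * f (p + c *\<^sub>R z)))"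
    by (intro integral_distr) auto
  also have "\<dots> = (LINT z|lborel. pi powr (- (real CARD('d) / 2)) * exp (- (norm z)\<^sup>2) * f (p + c *\<^sub>R z))"
  proof (rule Bochner_Integration.integral_cong[OF refl])
    fix z
    show "\<bar>c\<bar> ^ DIM(real^'d) *\<^sub>R (mehler t x (p + c *\<^sub>R z) * f (p + c *\<^sub>R z)) = pi powr (- (real CARD('d) / 2)) * exp (- (norm z)\<^sup>2) * f (p + c *\<^sub>R z)"
      unfolding mehler_def p_def[symmetric] A_def[symmetric] using c A
      by (simp add: pw power_mult_distrib powr_minus field_simps)
  qed
  finally show ?thesis unfolding p_def c_def A_def .
qed

lemma ou_tendsto_at_0:
  fixes \<phi> :: "real^'d::finite \<Rightarrow> real"
  assumes T: "T \<longlonglongrightarrow> 0" "\<And>i. 0 < T i" and cont: "continuous_on UNIV \<phi>" and bdd: "\<And>y. \<bar>\<phi> y\<bar> \<le> M"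
  shows "(\<lambda>i. ou (T i) \<phi> x) \<longlonglongrightarrow> \<phi> x"
proof -
  have [measurable]: "\<phi> \<in> borel_measurable borel" using cont by (rule borel_measurable_continuous_onI)
  let ?w = "\<lambda>z::real^'d. pi powr (- (real CARD('d) / 2)) * exp (- (norm z)\<^sup>2)"
  have w: "has_bochner_integral lborel ?w 1"
    using has_bochner_integral_mult_right[OF has_bochner_integral_gaussian_vec[of 1 "0::real^'d"], of "pi powr (- (real CARD('d) / 2))"]
    by (simp add: powr_add[symmetric])
  have lim: "(\<lambda>i. exp (- T i) *\<^sub>R x + sqrt (1 - exp (- 2 * T i)) *\<^sub>R z) \<longlonglongrightarrow> exp (- 0) *\<^sub>R x + sqrt (1 - exp (- 2 * 0)) *\<^sub>R z" for z
    by (intro tendsto_intros T)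
  have "(\<lambda>i. LINT z|lborel. ?w z * \<phi> (exp (- T i) *\<^sub>R x + sqrt (1 - exp (- 2 * T i)) *\<^sub>R z)) \<longlonglongrightarrow> (LINT z|lborel. ?w z * \<phi> x)"
  proof (rule integral_dominated_convergence[where w = "\<lambda>z. ?w z * M"])
    show "integrable lborel (\<lambda>z. ?w z * M)" using w by (auto simp: has_bochner_integral_iff)
    show "AE z in lborel. (\<lambda>i. ?w z * \<phi> (exp (- T i) *\<^sub>R x + sqrt (1 - exp (- 2 * T i)) *\<^sub>R z)) \<longlonglongrightarrow> ?w z * \<phi> x"
    proof (rule AE_I2, rule tendsto_mult_left)
      fix z
      have "isCont \<phi> x" using cont by (simp add: continuous_on_eq_continuous_at)
      from isCont_tendsto_compose[OF this, of "\<lambda>i. exp (- T i) *\<^sub>R x + sqrt (1 - exp (- 2 * T i)) *\<^sub>R z"] lim[of z]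
      show "(\<lambda>i. \<phi> (exp (- T i) *\<^sub>R x + sqrt (1 - exp (- 2 * T i)) *\<^sub>R z)) \<longlonglongrightarrow> \<phi> x" by simp
    qed
    show "AE z in lborel. norm (?w z * \<phi> (exp (- T i) *\<^sub>R x + sqrt (1 - exp (- 2 * T i)) *\<^sub>R z)) \<le> ?w z * M" for i
      using bdd by (auto simp: abs_mult intro!: mult_left_mono)
  qed measurable
  moreover have "(LINT z|lborel. ?w z * \<phi> x) = \<phi> x"
    using has_bochner_integral_mult_left[OF w, of "\<phi> x"] unfolding has_bochner_integral_iff by simp
  ultimately have "(\<lambda>i. LINT z|lborel. ?w z * \<phi> (exp (- T i) *\<^sub>R x + sqrt (1 - exp (- 2 * T i)) *\<^sub>R z)) \<longlonglongrightarrow> \<phi> x"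
    by (simp only:)
  then show ?thesis unfolding ou_eq_mehler_formula[OF T(2) \<open>\<phi> \<in> borel_measurable borel\<close>] .
qed

lemma integrable_gauss_weight: "integrable lborel (\<lambda>x::real^'d::finite. exp (- (norm x)\<^sup>2))"
  using has_bochner_integral_gaussian_vec[of 1 "0::real^'d"] by (simp add: has_bochner_integral_iff)

lemma integrable_gauss_weight_mult:
  assumes "ess_bounded M f"
  shows "integrable lborel (\<lambda>x::real^'d::finite. exp (- (norm x)\<^sup>2) * f x)"
proof (rule Bochner_Integration.integrable_bound[of lborel "\<lambda>x. exp (- (norm x)\<^sup>2) * M"])
  have [measurable]: "f \<in> borel_measurable borel" using assms by (rule ess_bounded_measurable)
  show "(\<lambda>x. exp (- (norm x)\<^sup>2) * f x) \<in> borel_measurable lborel" by measurable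
  have "AE y in lborel. \<bar>f y\<bar> \<le> M" using assms by (simp add: ess_bounded_def)
  then show "AE x in lborel. norm (exp (- (norm x)\<^sup>2) * f x) \<le> norm (exp (- (norm x)\<^sup>2) * M)"
    by eventually_elim (auto simp: abs_mult intro!: mult_left_mono)
qed (auto intro!: integrable_gauss_weight)

lemma ess_bounded_mult:
  assumes "ess_bounded M f" "ess_bounded M' g"
  shows "ess_bounded (M * M') (\<lambda>x. f x * g x)"
proof -
  have [measurable]: "f \<in> borel_measurable borel" "g \<in> borel_measurable borel" using assms by (auto simp: ess_bounded_def)
  have "AE x in lborel. \<bar>f x\<bar> \<le> M" "AE x in lborel. \<bar>g x\<bar> \<le> M'" using assms by (auto simp: ess_bounded_def)
  then have "AE x in lborel. \<bar>f x * g x\<bar> \<le> M * M'"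
    by eventually_elim (auto simp: abs_mult intro!: mult_mono')
  then show ?thesis by (simp add: ess_bounded_def)
qed

lemma ou_symmetric:
  fixes f \<phi> :: "real^'d::finite \<Rightarrow> real"
  assumes t: "0 < t" and f: "ess_bounded M f" and \<phi>: "ess_bounded M' \<phi>"
  shows "(LINT x|lborel. exp (- (norm x)\<^sup>2) * (ou t f x * \<phi> x)) = (LINT x|lborel. exp (- (norm x)\<^sup>2) * (f x * ou t \<phi> x))"
proof -
  have [measurable]: "f \<in> borel_measurable borel" "\<phi> \<in> borel_measurable borel" using f \<phi> by (auto simp: ess_bounded_def)
  have swap: "(LINT x|lborel. LINT y|lborel. exp (- (norm x)\<^sup>2) * \<phi> x * (mehler t x y * f y))
     = (LINT y|lborel. LINT x|lborel. exp (- (norm x)\<^sup>2) * \<phi> x * (mehler t x y * f y))"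
  proof (rule swap_integrals(2))
    show "(\<lambda>(x, y). exp (- (norm x)\<^sup>2) * \<phi> x * (mehler t x y * f y)) \<in> borel_measurable (borel \<Otimes>\<^sub>M borel)" by measurable
    show "integrable lborel (\<lambda>x. \<bar>exp (- (norm x)\<^sup>2) * \<phi> x\<bar> * M)"
      using integrable_gauss_weight_mult[OF \<phi>] by (intro integrable_mult_left integrable_abs)
    show "AE x in lborel. integrable lborel (\<lambda>y. exp (- (norm x)\<^sup>2) * \<phi> x * (mehler t x y * f y)) \<and>
          (LINT y|lborel. \<bar>exp (- (norm x)\<^sup>2) * \<phi> x * (mehler t x y * f y)\<bar>) \<le> \<bar>exp (- (norm x)\<^sup>2) * \<phi> x\<bar> * M"
    proof (rule AE_I2, rule conjI)
      fix x
      show "integrable lborel (\<lambda>y. exp (- (norm x)\<^sup>2) * \<phi> x * (mehler t x y * f y))"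
        by (intro integrable_mult_right integrable_mehler_mult[OF t f])
      show "(LINT y|lborel. \<bar>exp (- (norm x)\<^sup>2) * \<phi> x * (mehler t x y * f y)\<bar>) \<le> \<bar>exp (- (norm x)\<^sup>2) * \<phi> x\<bar> * M"
        unfolding abs_mult[of "exp (- (norm x)\<^sup>2) * \<phi> x"] integral_mult_right_zero
        by (intro mult_left_mono abs_ou_le(2)[OF t f]) auto
    qed
  qed
  have in1: "(LINT x|lborel. exp (- (norm x)\<^sup>2) * \<phi> x * (mehler t x y * f y)) = exp (- (norm y)\<^sup>2) * (f y * ou t \<phi> y)" for y
  proof -
    have "(LINT x|lborel. exp (- (norm x)\<^sup>2) * \<phi> x * (mehler t x y * f y)) = (LINT x|lborel. exp (- (norm y)\<^sup>2) * f y * (mehler t y x * \<phi> x))"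
    proof (rule Bochner_Integration.integral_cong[OF refl])
      fix x
      have "exp (- (norm x)\<^sup>2) * \<phi> x * (mehler t x y * f y) = (exp (- (norm x)\<^sup>2) * mehler t x y) * (\<phi> x * f y)" by simp
      then show "exp (- (norm x)\<^sup>2) * \<phi> x * (mehler t x y * f y) = exp (- (norm y)\<^sup>2) * f y * (mehler t y x * \<phi> x)"
        unfolding mehler_symmetric[OF t, of x y] by simp
    qed
    then show ?thesis by (simp add: ou_def)
  qed
  have in2: "(LINT y|lborel. exp (- (norm x)\<^sup>2) * \<phi> x * (mehler t x y * f y)) = exp (- (norm x)\<^sup>2) * (ou t f x * \<phi> x)" for x
    by (simp add: ou_def)
  show ?thesis using swap unfolding in1 in2 .
qed

section \<open>The one-sided stable law of index one half\<close>

lemma gaussian_primitive_exists: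
  "\<exists>G::real \<Rightarrow> real. (\<forall>w. (G has_real_derivative exp (- w\<^sup>2 / 4)) (at w)) \<and> G 0 = 0 \<and>
      (G \<longlongrightarrow> sqrt pi) at_top \<and> (G \<longlongrightarrow> - sqrt pi) at_bot"
proof -
  let ?e = "\<lambda>w::real. exp (- w\<^sup>2 / 4)"
  define G where "G w = (LBINT x=ereal 0..ereal w. ?e x)" for w :: real
  have D: "(G has_real_derivative ?e w) (at w)" for w
  proof -
    let ?b = "\<bar>w\<bar> + 1"
    have "(G has_vector_derivative ?e w) (at w within {-?b..?b})"
      unfolding G_def by (rule interval_integral_FTC2) (auto intro!: continuous_intros)
    then have "(G has_vector_derivative ?e w) (at w)"
      by (subst (asm) at_within_Icc_at) auto
    then show ?thesis by (simp add: has_real_derivative_iff_has_vector_derivative)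
  qed
  have G0: "G 0 = 0" by (simp add: G_def)
  have half: "has_bochner_integral lborel (\<lambda>x. indicator {0..} x *\<^sub>R ?e x) (sqrt pi)"
  proof -
    have "has_bochner_integral lborel (\<lambda>x::real. indicator {0..} x *\<^sub>R exp (- x\<^sup>2)) (sqrt pi / 2)"
      using gaussian_moment_even_pos[of 0] by simp
    from lborel_has_bochner_integral_real_affine_iff[THEN iffD1, of "1/2", OF _ this, of 0]
    have "has_bochner_integral lborel (\<lambda>x::real. indicator {0..} (x / 2) *\<^sub>R exp (- (x / 2)\<^sup>2)) (sqrt pi)"
      by simp
    moreover have "indicator {0..} (x / 2) *\<^sub>R exp (- (x / 2)\<^sup>2) = indicator {0..} x *\<^sub>R ?e x" for x :: real
      by (auto simp: indicator_def power_divide)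
    ultimately show ?thesis by simp
  qed
  have "((\<lambda>y. LINT x|lborel. indicator {..y} x *\<^sub>R (indicator {0..} x *\<^sub>R ?e x)) \<longlongrightarrow> sqrt pi) at_top"
    using tendsto_integral_at_top[OF sets_lborel, of "\<lambda>x. indicator {0..} x *\<^sub>R ?e x"] half
    by (simp add: has_bochner_integral_iff)
  moreover have "\<forall>\<^sub>F y in at_top. (LINT x|lborel. indicator {..y} x *\<^sub>R (indicator {0..} x *\<^sub>R ?e x)) = G y"
    using eventually_ge_at_top[of 0]
  proof eventually_elim
    fix y :: real assume y: "0 \<le> y"
    have "G y = (LINT x:{0..y}|lborel. ?e x)"
      unfolding G_def using y by (simp add: interval_integral_Icc)
    then show "(LINT x|lborel. indicator {..y} x *\<^sub>R (indicator {0..} x *\<^sub>R ?e x)) = G y"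
      unfolding set_lebesgue_integral_def by (auto intro!: Bochner_Integration.integral_cong simp: indicator_def)
  qed
  ultimately have top: "(G \<longlongrightarrow> sqrt pi) at_top" by (rule Lim_transform_eventually)
  have odd: "G w + G (- w) = 0" for w
  proof -
    have "((\<lambda>w. G w + G (- w)) has_real_derivative 0) (at w)" for w
    proof -
      have "((\<lambda>w. G (- w)) has_real_derivative ?e (- w) * (- 1)) (at w)"
        by (rule DERIV_chain2[OF D]) (auto intro!: derivative_eq_intros)
      from DERIV_add[OF D[of w] this] show ?thesis by simp
    qed
    then have "G w + G (- w) = G 0 + G (- 0)" by (rule DERIV_isconst_all[rule_format])
    then show ?thesis by (simp add: G0)
  qed
  have "((\<lambda>w. - G (- w)) \<longlongrightarrow> - sqrt pi) at_bot"
    by (intro tendsto_minus filterlim_compose[OF top] filterlim_uminus_at_top_at_bot)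
  moreover have "- G (- w) = G w" for w using odd[of w] by simp
  ultimately have "(G \<longlongrightarrow> - sqrt pi) at_bot" by simp
  with D G0 top show ?thesis by blast
qed

text \<open>An error function, normalised to the weight that occurs in \<open>subord\<close>.\<close>
definition gauss_prim :: "real \<Rightarrow> real" where
  "gauss_prim = (SOME G. (\<forall>w. (G has_real_derivative exp (- w\<^sup>2 / 4)) (at w)) \<and> G 0 = 0 \<and>
      (G \<longlongrightarrow> sqrt pi) at_top \<and> (G \<longlongrightarrow> - sqrt pi) at_bot)"

lemma gauss_prim:
  shows gauss_prim_deriv: "(gauss_prim has_real_derivative exp (- w\<^sup>2 / 4)) (at w)"
    and gauss_prim_0: "gauss_prim 0 = 0"
    and gauss_prim_at_top: "(gauss_prim \<longlongrightarrow> sqrt pi) at_top"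
    and gauss_prim_at_bot: "(gauss_prim \<longlongrightarrow> - sqrt pi) at_bot"
  using someI_ex[OF gaussian_primitive_exists] unfolding gauss_prim_def[symmetric] by auto

lemma isCont_gauss_prim: "isCont gauss_prim w"
  using gauss_prim_deriv by (rule DERIV_isCont)

text \<open>The density of the one-sided stable law of index \<open>1/2\<close>, with Laplace transform \<open>e\<^bsup>-t\<surd>\<lambda>\<^esup>\<close>.  Mixing the
  Ornstein-Uhlenbeck semigroup with it replaces the generator \<open>L\<close> by \<open>-(-L)\<^bsup>1/2\<^esup>\<close>.\<close>
definition subord :: "real \<Rightarrow> real \<Rightarrow> real" where
  "subord t s = (if 0 < s then t / (2 * sqrt pi) * s powr (- 3 / 2) * exp (- t\<^sup>2 / (4 * s)) else 0)"

lemma subord_nonneg: "0 \<le> t \<Longrightarrow> 0 \<le> subord t s"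
  by (simp add: subord_def)

lemma measurable_subord [measurable (raw)]:
  assumes [measurable]: "g \<in> borel_measurable N" "a \<in> borel_measurable N"
  shows "(\<lambda>z. subord (g z) (a z)) \<in> borel_measurable N"
  unfolding subord_def by measurable

text \<open>The substitution \<open>w = t / \<surd>s\<close> turns the density into a Gaussian one.\<close>
lemma has_bochner_integral_subord:
  assumes t: "0 < t"
  shows "has_bochner_integral lborel (subord t) 1"
proof -
  let ?F = "\<lambda>s. - (1 / sqrt pi) * gauss_prim (t * s powr (- 1 / 2))"
  have pre: "(0::ereal) < \<infinity>"
    "\<And>x. 0 < ereal x \<Longrightarrow> ereal x < \<infinity> \<Longrightarrow> (?F has_real_derivative subord t x) (at x)"
    "\<And>x. 0 < ereal x \<Longrightarrow> ereal x < \<infinity> \<Longrightarrow> isCont (subord t) x"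
    "AE x in lborel. 0 < ereal x \<longrightarrow> ereal x < \<infinity> \<longrightarrow> 0 \<le> subord t x"
    "((?F \<circ> real_of_ereal) \<longlongrightarrow> - 1) (at_right 0)"
    "((?F \<circ> real_of_ereal) \<longlongrightarrow> 0) (at_left \<infinity>)"
  proof -
    show "(0::ereal) < \<infinity>" by simp
    show "(?F has_real_derivative subord t x) (at x)" if "0 < ereal x" for x
    proof -
      have x: "0 < x" using that by simp
      have d: "((\<lambda>s. t * s powr (- 1 / 2)) has_real_derivative t * (- 1 / 2 * x powr (- 1 / 2 - 1))) (at x)"
        using x by (intro DERIV_cmult has_real_derivative_powr)
      have e: "(t * x powr (- 1 / 2))\<^sup>2 / 4 = t\<^sup>2 / (4 * x)"
        using x by (simp add: power_mult_distrib powr_power powr_minus field_simps)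
      have "(?F has_real_derivative - (1 / sqrt pi) * (exp (- (t * x powr (- 1 / 2))\<^sup>2 / 4) * (t * (- 1 / 2 * x powr (- 1 / 2 - 1))))) (at x)"
        by (intro DERIV_cmult DERIV_chain2[OF gauss_prim_deriv d])
      also have "- (1 / sqrt pi) * (exp (- (t * x powr (- 1 / 2))\<^sup>2 / 4) * (t * (- 1 / 2 * x powr (- 1 / 2 - 1)))) = subord t x"
        using x e by (simp add: subord_def mult_ac)
      finally show ?thesis .
    qed
    show "isCont (subord t) x" if "0 < ereal x" for x
    proof -
      have x: "0 < x" using that by simp
      have "isCont (\<lambda>s. t / (2 * sqrt pi) * s powr (- 3 / 2) * exp (- t\<^sup>2 / (4 * s))) x"
        using x by (intro continuous_intros) auto
      moreover have "\<forall>\<^sub>F s in nhds x. subord t s = t / (2 * sqrt pi) * s powr (- 3 / 2) * exp (- t\<^sup>2 / (4 * s))"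
        using eventually_nhds_in_open[OF open_greaterThan, of x 0] x by (auto elim!: eventually_mono simp: subord_def)
      ultimately show ?thesis by (simp add: isCont_cong)
    qed
    show "AE x in lborel. 0 < ereal x \<longrightarrow> ereal x < \<infinity> \<longrightarrow> 0 \<le> subord t x"
      using t by (auto simp: subord_nonneg)
    have "filterlim (\<lambda>s. t * s powr (- 1 / 2)) at_top (at_right 0)" using t by real_asymp
    then have "(?F \<longlongrightarrow> - (1 / sqrt pi) * sqrt pi) (at_right 0)"
      by (intro tendsto_mult_left filterlim_compose[OF gauss_prim_at_top])
    then show "((?F \<circ> real_of_ereal) \<longlongrightarrow> - 1) (at_right 0)"
      unfolding zero_ereal_def by (intro ereal_tendsto_simps1(2)[THEN iffD2]) auto
    have "((\<lambda>s. t * s powr (- 1 / 2)) \<longlongrightarrow> 0) at_top" using t by real_asymp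
    then have "(?F \<longlongrightarrow> - (1 / sqrt pi) * gauss_prim 0) at_top"
      by (intro tendsto_mult_left isCont_tendsto_compose[OF isCont_gauss_prim])
    then show "((?F \<circ> real_of_ereal) \<longlongrightarrow> 0) (at_left \<infinity>)"
      by (simp add: ereal_tendsto_simps gauss_prim_0)
  qed
  have ind: "indicator (einterval 0 \<infinity>) s * subord t s = subord t s" for s
    by (auto simp: einterval_def indicator_def subord_def)
  have "set_integrable lborel (einterval 0 \<infinity>) (subord t)" "(LBINT x=0..\<infinity>. subord t x) = 0 - (- 1)"
    using interval_integral_FTC_nonneg[OF pre] by auto
  then show ?thesis
    by (simp add: set_integrable_def interval_lebesgue_integral_def set_lebesgue_integral_def ind has_bochner_integral_iff)
qed

text \<open>The integrand has an explicit primitive.  With \<open>b = S - a\<close> one has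
  \<open>t\<^sup>2 / a + r\<^sup>2 / b = (t + r)\<^sup>2 / S + wm\<^sup>2\<close> and \<open>wp\<^sup>2 = wm\<^sup>2 + 4 t r / S\<close>, while the derivatives of \<open>wm\<close> and \<open>wp\<close> are
  \<open>t b + r a\<close> and \<open>t b - r a\<close>, up to the same factor \<open>-\<surd>S / 2 * (a b)\<^bsup>-3/2\<^esup>\<close>.  The constants \<open>c1\<close> and \<open>c2\<close> combine
  these two linear functions into \<open>1\<close>.  At the two ends \<open>wm\<close> tends to \<open>\<infinity>\<close> and \<open>-\<infinity>\<close>, but \<open>wp\<close> tends to \<open>\<infinity>\<close> at both, so
  that only the first term contributes.\<close>
lemma subord_convolution:
  assumes t: "0 < t" and r: "0 < r" and S: "0 < S"
  shows "(LINT a|lborel. subord t a * subord r (S - a)) = subord (t + r) S"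
proof -
  define wm wp where "wm a = (t * (S - a) - r * a) / sqrt (S * a * (S - a))"
    and "wp a = (t * (S - a) + r * a) / sqrt (S * a * (S - a))" for a :: real
  define c1 c2 where "c1 = (1 / t + 1 / r) / (2 * S)" and "c2 = (1 / t - 1 / r) / (2 * S)"
  define cst where "cst = t * r / (4 * pi)"
  define e0 where "e0 = exp (- (t + r)\<^sup>2 / (4 * S))"
  let ?F = "\<lambda>a. - cst * e0 * (2 / sqrt S) * (c1 * gauss_prim (wm a) + c2 * exp (t * r / S) * gauss_prim (wp a))"
  let ?f = "\<lambda>a. subord t a * subord r (S - a)"
  have pre: "(0::ereal) < ereal S"
    "\<And>x. 0 < ereal x \<Longrightarrow> ereal x < ereal S \<Longrightarrow> (?F has_real_derivative ?f x) (at x)"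
    "\<And>x. 0 < ereal x \<Longrightarrow> ereal x < ereal S \<Longrightarrow> isCont ?f x"
    "AE x in lborel. 0 < ereal x \<longrightarrow> ereal x < ereal S \<longrightarrow> 0 \<le> ?f x"
    "((?F \<circ> real_of_ereal) \<longlongrightarrow> - cst * e0 * (2 / sqrt S) * (c1 * sqrt pi + c2 * exp (t * r / S) * sqrt pi)) (at_right 0)"
    "((?F \<circ> real_of_ereal) \<longlongrightarrow> - cst * e0 * (2 / sqrt S) * (c1 * (- sqrt pi) + c2 * exp (t * r / S) * sqrt pi)) (at_left (ereal S))"
  proof -
    show "(0::ereal) < ereal S" using S by simp
    show "(?F has_real_derivative ?f x) (at x)" if x: "0 < ereal x" "ereal x < ereal S" for x
    proof -
      have x: "0 < x" "x < S" using that by auto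
      define y where "y = S - x"
      have y: "0 < y" using x by (simp add: y_def)
      have Sxy: "S = x + y" by (simp add: y_def)
      define R where "R = sqrt (S * x * y)"
      have R: "0 < R" "R\<^sup>2 = S * x * y" using S x y by (auto simp: R_def)
      have dR: "((\<lambda>a. sqrt (S * a * (S - a))) has_real_derivative (S * (y - x) / (2 * R))) (at x)"
        using S x y R unfolding R_def y_def by (auto intro!: derivative_eq_intros simp: field_simps)
      have nz: "sqrt (S * x * (S - x)) \<noteq> 0" using S x by simp
      have dm: "(wm has_real_derivative ((- t - r) * R - (t * y - r * x) * (S * (y - x) / (2 * R))) / (R * R)) (at x)"
      proof -
        have "((\<lambda>a. t * (S - a) - r * a) has_real_derivative (- t - r)) (at x)"
          by (auto intro!: derivative_eq_intros)
        from DERIV_divide[OF this dR nz] show ?thesis unfolding wm_def[abs_def] R_def y_def .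
      qed
      have dp: "(wp has_real_derivative ((- t + r) * R - (t * y + r * x) * (S * (y - x) / (2 * R))) / (R * R)) (at x)"
      proof -
        have "((\<lambda>a. t * (S - a) + r * a) has_real_derivative (- t + r)) (at x)"
          by (auto intro!: derivative_eq_intros)
        from DERIV_divide[OF this dR nz] show ?thesis unfolding wp_def[abs_def] R_def y_def .
      qed
      have em: "((- t - r) * R - (t * y - r * x) * (S * (y - x) / (2 * R))) / (R * R) = - S\<^sup>2 * (t * y + r * x) / (2 * R ^ 3)"
      proof -
        have "((- t - r) * R - (t * y - r * x) * (S * (y - x) / (2 * R))) / (R * R)
            = ((- t - r) * 2 * R\<^sup>2 - (t * y - r * x) * (S * (y - x))) / (2 * R ^ 3)"
          using R(1) by (simp add: field_simps power2_eq_square power3_eq_cube)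
        also have "(- t - r) * 2 * R\<^sup>2 - (t * y - r * x) * (S * (y - x)) = - S\<^sup>2 * (t * y + r * x)"
          unfolding R(2) Sxy by (simp add: algebra_simps power2_eq_square)
        finally show ?thesis .
      qed
      have ep: "((- t + r) * R - (t * y + r * x) * (S * (y - x) / (2 * R))) / (R * R) = - S\<^sup>2 * (t * y - r * x) / (2 * R ^ 3)"
      proof -
        have "((- t + r) * R - (t * y + r * x) * (S * (y - x) / (2 * R))) / (R * R)
            = ((- t + r) * 2 * R\<^sup>2 - (t * y + r * x) * (S * (y - x))) / (2 * R ^ 3)"
          using R(1) by (simp add: field_simps power2_eq_square power3_eq_cube)
        also have "(- t + r) * 2 * R\<^sup>2 - (t * y + r * x) * (S * (y - x)) = - S\<^sup>2 * (t * y - r * x)"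
          unfolding R(2) Sxy by (simp add: algebra_simps power2_eq_square)
        finally show ?thesis .
      qed
      have wm2: "(wm x)\<^sup>2 = t\<^sup>2 / x + r\<^sup>2 / y - (t + r)\<^sup>2 / S"
      proof -
        have "(wm x)\<^sup>2 = (t * y - r * x)\<^sup>2 / (S * x * y)"
          using R unfolding wm_def R_def y_def by (simp add: power_divide)
        also have "\<dots> = t\<^sup>2 / x + r\<^sup>2 / y - (t + r)\<^sup>2 / S"
        proof -
          have "(t\<^sup>2 / x + r\<^sup>2 / y - (t + r)\<^sup>2 / S) * (S * x * y) = t\<^sup>2 * (S * y) + r\<^sup>2 * (S * x) - (t + r)\<^sup>2 * (x * y)"
            using S x y by (simp add: field_simps)
          also have "\<dots> = (t * y - r * x)\<^sup>2" unfolding Sxy by (simp add: algebra_simps power2_eq_square)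
          finally have "(t * y - r * x)\<^sup>2 = (t\<^sup>2 / x + r\<^sup>2 / y - (t + r)\<^sup>2 / S) * (S * x * y)" by (rule sym)
          then show ?thesis using S x y by (intro nonzero_divide_eq_eq[THEN iffD2]) auto
        qed
        finally show ?thesis .
      qed
      have wp2: "(wp x)\<^sup>2 = (wm x)\<^sup>2 + 4 * (t * r / S)"
      proof -
        have "(wp x)\<^sup>2 = (t * y + r * x)\<^sup>2 / (S * x * y)" "(wm x)\<^sup>2 = (t * y - r * x)\<^sup>2 / (S * x * y)"
          using R unfolding wm_def wp_def R_def y_def by (simp_all add: power_divide)
        moreover have "(t * y + r * x)\<^sup>2 = (t * y - r * x)\<^sup>2 + 4 * (t * r * x * y)"
          by (simp add: power2_eq_square algebra_simps)
        ultimately show ?thesis using S x y by (simp add: add_divide_distrib)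
      qed
      define E where "E = exp (- (wm x)\<^sup>2 / 4)"
      have Ep: "exp (t * r / S) * exp (- (wp x)\<^sup>2 / 4) = E"
        unfolding E_def wp2 exp_add[symmetric] by (simp add: field_simps)
      have "(?F has_real_derivative - cst * e0 * (2 / sqrt S) *
               (c1 * (exp (- (wm x)\<^sup>2 / 4) * (- S\<^sup>2 * (t * y + r * x) / (2 * R ^ 3)))
              + c2 * exp (t * r / S) * (exp (- (wp x)\<^sup>2 / 4) * (- S\<^sup>2 * (t * y - r * x) / (2 * R ^ 3))))) (at x)"
        by (intro DERIV_cmult DERIV_add DERIV_chain2[OF gauss_prim_deriv] dm[unfolded em] dp[unfolded ep])
      also have "- cst * e0 * (2 / sqrt S) *
               (c1 * (exp (- (wm x)\<^sup>2 / 4) * (- S\<^sup>2 * (t * y + r * x) / (2 * R ^ 3)))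
              + c2 * exp (t * r / S) * (exp (- (wp x)\<^sup>2 / 4) * (- S\<^sup>2 * (t * y - r * x) / (2 * R ^ 3))))
          = cst * e0 * E * (S\<^sup>2 / (sqrt S * R ^ 3)) * (c1 * (t * y + r * x) + c2 * (t * y - r * x))"
      proof -
        have wpE: "c2 * exp (t * r / S) * (exp (- (wp x)\<^sup>2 / 4) * (- S\<^sup>2 * (t * y - r * x) / (2 * R ^ 3)))
           = c2 * E * (- S\<^sup>2 * (t * y - r * x) / (2 * R ^ 3))" unfolding Ep[symmetric] by simp
        show ?thesis unfolding wpE unfolding E_def[symmetric] using R(1) S by (simp add: field_simps)
      qed
      also have "c1 * (t * y + r * x) + c2 * (t * y - r * x) = 1"
      proof -
        have "c1 * (t * y + r * x) + c2 * (t * y - r * x) = (x + y) / S"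
          unfolding c1_def c2_def using t r S by (simp add: field_simps)
        then show ?thesis using S by (simp add: Sxy[symmetric])
      qed
      also have "S\<^sup>2 / (sqrt S * R ^ 3) = x powr (- 3 / 2) * y powr (- 3 / 2)"
      proof -
        have "R = S powr (1/2) * x powr (1/2) * y powr (1/2)"
          unfolding R_def using S x y by (simp add: powr_half_sqrt real_sqrt_mult)
        then have "R ^ 3 = S powr (3/2) * x powr (3/2) * y powr (3/2)"
          using S x y by (simp add: power_mult_distrib powr_power)
        moreover have "sqrt S * S powr (3 / 2) = S\<^sup>2"
          using S by (simp add: powr_half_sqrt[symmetric] powr_add[symmetric] powr_numeral)
        ultimately have "S\<^sup>2 / (sqrt S * R ^ 3) = S\<^sup>2 / (S\<^sup>2 * (x powr (3/2) * y powr (3/2)))"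
          by (simp add: mult.assoc[symmetric])
        then show ?thesis using S by (simp add: powr_minus_divide)
      qed
      also have "cst * e0 * E * (x powr (- 3 / 2) * y powr (- 3 / 2)) * 1 = ?f x"
      proof -
        have "e0 * E = exp (- t\<^sup>2 / (4 * x)) * exp (- r\<^sup>2 / (4 * y))"
          unfolding e0_def E_def wm2 exp_add[symmetric] by (simp add: field_simps diff_divide_distrib add_divide_distrib)
        then have "cst * (e0 * E) * (x powr (- 3 / 2) * y powr (- 3 / 2)) = ?f x"
          using x y by (simp add: subord_def cst_def y_def[symmetric])
        then show ?thesis by (simp add: mult.assoc)
      qed
      finally show ?thesis .
    qed
    show "isCont ?f x" if "0 < ereal x" "ereal x < ereal S" for x
    proof -
      have x: "0 < x" "x < S" using that by auto
      have "isCont (\<lambda>s. (t / (2 * sqrt pi) * s powr (- 3 / 2) * exp (- t\<^sup>2 / (4 * s))) * (r / (2 * sqrt pi) * (S - s) powr (- 3 / 2) * exp (- r\<^sup>2 / (4 * (S - s))))) x"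
        using x by (intro continuous_intros) auto
      moreover have "\<forall>\<^sub>F s in nhds x. ?f s = (t / (2 * sqrt pi) * s powr (- 3 / 2) * exp (- t\<^sup>2 / (4 * s))) * (r / (2 * sqrt pi) * (S - s) powr (- 3 / 2) * exp (- r\<^sup>2 / (4 * (S - s))))"
        using eventually_nhds_in_open[OF open_greaterThanLessThan, of x 0 S] x by (auto elim!: eventually_mono simp: subord_def)
      ultimately show ?thesis by (simp add: isCont_cong)
    qed
    show "AE x in lborel. 0 < ereal x \<longrightarrow> ereal x < ereal S \<longrightarrow> 0 \<le> ?f x"
      using t r by (auto simp: subord_nonneg)
    have l1: "filterlim wm at_top (at_right 0)" "filterlim wp at_top (at_right 0)"
      unfolding wm_def wp_def using t r S by real_asymp+
    show "((?F \<circ> real_of_ereal) \<longlongrightarrow> - cst * e0 * (2 / sqrt S) * (c1 * sqrt pi + c2 * exp (t * r / S) * sqrt pi)) (at_right 0)"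
      unfolding zero_ereal_def
      by (intro ereal_tendsto_simps1(2)[THEN iffD2] tendsto_mult_left tendsto_add filterlim_compose[OF gauss_prim_at_top] l1)
    have l2: "filterlim wm at_bot (at_left S)" "filterlim wp at_top (at_left S)"
      unfolding wm_def wp_def using t r S by real_asymp+
    show "((?F \<circ> real_of_ereal) \<longlongrightarrow> - cst * e0 * (2 / sqrt S) * (c1 * (- sqrt pi) + c2 * exp (t * r / S) * sqrt pi)) (at_left (ereal S))"
      by (intro ereal_tendsto_simps1(1)[THEN iffD2] tendsto_mult_left tendsto_add filterlim_compose[OF gauss_prim_at_top]
         filterlim_compose[OF gauss_prim_at_bot] l2)
  qed
  have ind: "indicator (einterval 0 (ereal S)) a * ?f a = ?f a" for a
    by (auto simp: einterval_def indicator_def subord_def)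
  have total: "(LBINT x=0..ereal S. ?f x) = - cst * e0 * (2 / sqrt S) * (c1 * (- sqrt pi) + c2 * exp (t * r / S) * sqrt pi)
          - - cst * e0 * (2 / sqrt S) * (c1 * sqrt pi + c2 * exp (t * r / S) * sqrt pi)"
    by (rule interval_integral_FTC_nonneg(2)[OF pre])
  have "(LINT a|lborel. ?f a) = (LBINT x=0..ereal S. ?f x)"
    using S by (simp add: interval_lebesgue_integral_def set_lebesgue_integral_def ind)
  also have "\<dots> = cst * e0 * (2 / sqrt S) * (2 * c1 * sqrt pi)"
    unfolding total by (simp add: algebra_simps)
  also have "\<dots> = subord (t + r) S"
  proof -
    have pw: "S powr (- 3 / 2) = 1 / (S * sqrt S)"
      using S powr_add[of S 1 "1/2"] by (simp add: powr_minus_divide powr_half_sqrt)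
    have "2 * c1 = (t + r) / (t * r * S)" unfolding c1_def using t r S by (simp add: field_simps)
    then have "cst * (2 / sqrt S) * (2 * c1 * sqrt pi) = (t * r / (4 * pi)) * (2 / sqrt S) * ((t + r) / (t * r * S) * sqrt pi)"
      unfolding cst_def by simp
    also have "\<dots> = (t + r) / (2 * sqrt pi) * (1 / (S * sqrt S))"
    proof -
      define p where "p = sqrt pi"
      have p: "0 < p" "pi = p * p" by (auto simp: p_def)
      show ?thesis unfolding p_def[symmetric] unfolding p(2) using p(1) t r S by (simp add: field_simps)
    qed
    finally have "cst * (2 / sqrt S) * (2 * c1 * sqrt pi) = (t + r) / (2 * sqrt pi) * S powr (- 3 / 2)" unfolding pw .
    then have "cst * (2 / sqrt S) * (2 * c1 * sqrt pi) * e0 = subord (t + r) S"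
      using S by (simp add: subord_def e0_def)
    then show ?thesis by (simp add: mult_ac)
  qed
  finally show "(LINT a|lborel. ?f a) = subord (t + r) S" .
qed

section \<open>Time derivatives of the stable density\<close>

text \<open>By the mean value theorem \<open>w\<close> dominates the difference quotients.\<close>
lemma has_real_derivative_integral:
  fixes f f' :: "real \<Rightarrow> 'a \<Rightarrow> real"
  assumes \<delta>: "0 < \<delta>" and int: "\<And>r. \<bar>r - t\<bar> < \<delta> \<Longrightarrow> integrable M (f r)"
    and w: "integrable M w" and meas: "f' t \<in> borel_measurable M"
    and deriv: "AE s in M. \<forall>r. \<bar>r - t\<bar> < \<delta> \<longrightarrow> ((\<lambda>r. f r s) has_real_derivative f' r s) (at r) \<and> \<bar>f' r s\<bar> \<le> w s"
  shows "((\<lambda>r. LINT s|M. f r s) has_real_derivative (LINT s|M. f' t s)) (at t)"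
  unfolding has_field_derivative_iff tendsto_at_iff_sequentially o_def
proof (intro allI impI)
  fix X :: "nat \<Rightarrow> real"
  assume X: "\<forall>i. X i \<in> UNIV - {t}" "X \<longlonglongrightarrow> t"
  then obtain N where N: "\<And>i. N \<le> i \<Longrightarrow> \<bar>X i - t\<bar> < \<delta>"
    using \<delta> unfolding LIMSEQ_iff real_norm_def by blast
  define Y where "Y i = X (i + N)" for i
  have Y: "Y i \<noteq> t" "\<bar>Y i - t\<bar> < \<delta>" for i using X N[of "i + N"] by (auto simp: Y_def)
  have Yt: "Y \<longlonglongrightarrow> t" unfolding Y_def using X(2) by (rule LIMSEQ_ignore_initial_segment)
  have meq: "((LINT s|M. f (Y i) s) - (LINT s|M. f t s)) / (Y i - t) = (LINT s|M. (f (Y i) s - f t s) / (Y i - t))" for i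
    using int[OF Y(2), of i] int[of t] \<delta> by simp
  have "(\<lambda>i. LINT s|M. (f (Y i) s - f t s) / (Y i - t)) \<longlonglongrightarrow> (LINT s|M. f' t s)"
  proof (rule integral_dominated_convergence[OF meas _ w])
    show "(\<lambda>s. (f (Y i) s - f t s) / (Y i - t)) \<in> borel_measurable M" for i
      using int[OF Y(2), of i] int[of t] \<delta> by (intro borel_measurable_divide borel_measurable_diff) auto
    show "AE s in M. (\<lambda>i. (f (Y i) s - f t s) / (Y i - t)) \<longlonglongrightarrow> f' t s"
      using deriv
    proof eventually_elim
      fix s assume *: "\<forall>r. \<bar>r - t\<bar> < \<delta> \<longrightarrow> ((\<lambda>r. f r s) has_real_derivative f' r s) (at r) \<and> \<bar>f' r s\<bar> \<le> w s"
      then have "((\<lambda>r. f r s) has_real_derivative f' t s) (at t)" using \<delta> by auto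
      then show "(\<lambda>i. (f (Y i) s - f t s) / (Y i - t)) \<longlonglongrightarrow> f' t s"
        unfolding has_field_derivative_iff tendsto_at_iff_sequentially o_def using Y Yt by auto
    qed
    show "AE s in M. norm ((f (Y i) s - f t s) / (Y i - t)) \<le> w s" for i
      using deriv
    proof eventually_elim
      fix s assume *: "\<forall>r. \<bar>r - t\<bar> < \<delta> \<longrightarrow> ((\<lambda>r. f r s) has_real_derivative f' r s) (at r) \<and> \<bar>f' r s\<bar> \<le> w s"
      have "norm (f (Y i) s - f t s) \<le> w s * norm (Y i - t)"
      proof (rule field_differentiable_bound[where S = "ball t \<delta>" and f = "\<lambda>r. f r s" and f' = "\<lambda>r. f' r s"])
        show "((\<lambda>r. f r s) has_real_derivative f' z s) (at z within ball t \<delta>)" if "z \<in> ball t \<delta>" for z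
          using *[rule_format, of z] that by (auto simp: dist_real_def abs_minus_commute intro: has_field_derivative_at_within)
        show "norm (f' z s) \<le> w s" if "z \<in> ball t \<delta>" for z
          using *[rule_format, of z] that by (auto simp: dist_real_def abs_minus_commute)
      qed (use Y[of i] \<delta> in \<open>auto simp: dist_real_def abs_minus_commute\<close>)
      then show "norm ((f (Y i) s - f t s) / (Y i - t)) \<le> w s"
        using Y(1)[of i] by (simp add: divide_le_eq)
    qed
  qed
  then have "(\<lambda>i. ((LINT s|M. f (Y i) s) - (LINT s|M. f t s)) / (Y i - t)) \<longlonglongrightarrow> (LINT s|M. f' t s)"
    unfolding meq .
  then show "(\<lambda>i. ((LINT s|M. f (X i) s) - (LINT s|M. f t s)) / (X i - t)) \<longlonglongrightarrow> (LINT s|M. f' t s)"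
    unfolding Y_def by (rule LIMSEQ_offset)
qed

lemma poly_le_exp:
  fixes p :: "real poly"
  assumes "0 < \<epsilon>"
  shows "\<exists>C\<ge>0. \<forall>q\<ge>0. \<bar>poly p q\<bar> \<le> C * exp (\<epsilon> * q)"
  using assms
proof (induction p arbitrary: \<epsilon>)
  case 0 show ?case by (intro exI[of _ 0]) simp
next
  case (pCons a p)
  from pCons.IH[of "\<epsilon> / 2"] pCons.prems obtain C where C: "0 \<le> C" "\<And>q. 0 \<le> q \<Longrightarrow> \<bar>poly p q\<bar> \<le> C * exp (\<epsilon> / 2 * q)"
    by auto
  show ?case
  proof (intro exI[of _ "\<bar>a\<bar> + 2 / \<epsilon> * C"] conjI allI impI)
    show "0 \<le> \<bar>a\<bar> + 2 / \<epsilon> * C" using C pCons.prems by auto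
    fix q :: real assume q: "0 \<le> q"
    have "q \<le> 2 / \<epsilon> * exp (\<epsilon> / 2 * q)"
      using exp_ge_add_one_self[of "\<epsilon> / 2 * q"] pCons.prems by (simp add: field_simps)
    then have "q * \<bar>poly p q\<bar> \<le> (2 / \<epsilon> * exp (\<epsilon> / 2 * q)) * (C * exp (\<epsilon> / 2 * q))"
      using C q pCons.prems by (intro mult_mono) auto
    also have "\<dots> = 2 / \<epsilon> * C * exp (\<epsilon> * q)" by (simp add: exp_add[symmetric] field_simps)
    finally have 1: "q * \<bar>poly p q\<bar> \<le> 2 / \<epsilon> * C * exp (\<epsilon> * q)" .
    have "\<bar>a\<bar> * 1 \<le> \<bar>a\<bar> * exp (\<epsilon> * q)" using q pCons.prems by (intro mult_left_mono) auto
    moreover have "\<bar>poly (pCons a p) q\<bar> \<le> \<bar>a\<bar> + q * \<bar>poly p q\<bar>"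
      using q abs_triangle_ineq[of a "q * poly p q"] by (simp add: abs_mult)
    ultimately show "\<bar>poly (pCons a p) q\<bar> \<le> (\<bar>a\<bar> + 2 / \<epsilon> * C) * exp (\<epsilon> * q)"
      using 1 by (simp add: algebra_simps)
  qed
qed

text \<open>These polynomials are determined by
  \<open>\<partial>\<^sup>m subord t s / \<partial>t\<^sup>m = t\<^bsup>1-m\<^esup> s\<^bsup>-3/2\<^esup> G\<^sub>m(t\<^sup>2 / s) e\<^bsup>-t\<^sup>2/(4s)\<^esup>\<close>.\<close>
primrec subord_poly :: "nat \<Rightarrow> real poly" where
  "subord_poly 0 = [: 1 / (2 * sqrt pi) :]"
| "subord_poly (Suc m) = smult (1 - real m) (subord_poly m) + pCons 0 (smult 2 (pderiv (subord_poly m))) - pCons 0 (smult (1 / 2) (subord_poly m))"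

definition subord_deriv :: "nat \<Rightarrow> real \<Rightarrow> real \<Rightarrow> real" where
  "subord_deriv m t s = (if 0 < s then t powr (1 - real m) * s powr (- 3 / 2) * (poly (subord_poly m) (t\<^sup>2 / s) * exp (- (t\<^sup>2 / s) / 4)) else 0)"

lemma subord_deriv_0: "0 < t \<Longrightarrow> subord_deriv 0 t s = subord t s"
  by (simp add: subord_deriv_def subord_def field_simps)

lemma subord_deriv_nonpos: "s \<le> 0 \<Longrightarrow> subord_deriv m t s = 0"
  by (simp add: subord_deriv_def)

lemma measurable_subord_deriv [measurable (raw)]:
  assumes [measurable]: "g \<in> borel_measurable N" "a \<in> borel_measurable N"
  shows "(\<lambda>z. subord_deriv m (g z) (a z)) \<in> borel_measurable N"
proof -
  have [measurable]: "poly (subord_poly m) \<in> borel_measurable borel"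
    by (intro borel_measurable_continuous_onI continuous_intros)
  show ?thesis unfolding subord_deriv_def by measurable
qed

lemma subord_deriv_has_derivative:
  assumes t: "0 < t"
  shows "((\<lambda>t. subord_deriv m t s) has_real_derivative subord_deriv (Suc m) t s) (at t)"
proof (cases "0 < s")
  case False then show ?thesis by (simp add: subord_deriv_def)
next
  case s: True
  let ?G = "poly (subord_poly m)" and ?G' = "poly (pderiv (subord_poly m))"
  define P where "P = t powr (- real m)"
  have P: "t powr (1 - real m) = t * P" using t powr_add[of t 1 "- real m"] by (simp add: P_def)
  have dq: "((\<lambda>t. t\<^sup>2 / s) has_real_derivative 2 * t / s) (at t)"
    using s by (auto intro!: derivative_eq_intros)
  have d1: "((\<lambda>t. t powr (1 - real m)) has_real_derivative (1 - real m) * P) (at t)"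
    using has_real_derivative_powr[OF t, of "1 - real m"] by (simp add: P_def)
  have d2: "((\<lambda>t. ?G (t\<^sup>2 / s)) has_real_derivative ?G' (t\<^sup>2 / s) * (2 * t / s)) (at t)"
    by (rule DERIV_chain2[OF poly_DERIV dq])
  have d3: "((\<lambda>t. exp (- (t\<^sup>2 / s) / 4)) has_real_derivative exp (- (t\<^sup>2 / s) / 4) * (- (2 * t / s) / 4)) (at t)"
    by (rule DERIV_chain2[OF DERIV_exp]) (intro DERIV_cdivide DERIV_minus dq)
  have "((\<lambda>t. t powr (1 - real m) * s powr (- 3 / 2) * (?G (t\<^sup>2 / s) * exp (- (t\<^sup>2 / s) / 4))) has_real_derivative
      ((1 - real m) * P) * s powr (- 3 / 2) * (?G (t\<^sup>2 / s) * exp (- (t\<^sup>2 / s) / 4))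
      + (t powr (1 - real m) * s powr (- 3 / 2)) * 
         (?G (t\<^sup>2 / s) * (exp (- (t\<^sup>2 / s) / 4) * (- (2 * t / s) / 4)) + ?G' (t\<^sup>2 / s) * (2 * t / s) * exp (- (t\<^sup>2 / s) / 4))) (at t)"
    by (rule DERIV_cong[OF DERIV_mult[OF DERIV_cmult_right[OF d1] DERIV_mult[OF d2 d3]]]) (simp add: algebra_simps)
  also have "((1 - real m) * P) * s powr (- 3 / 2) * (?G (t\<^sup>2 / s) * exp (- (t\<^sup>2 / s) / 4))
      + (t powr (1 - real m) * s powr (- 3 / 2)) * 
         (?G (t\<^sup>2 / s) * (exp (- (t\<^sup>2 / s) / 4) * (- (2 * t / s) / 4)) + ?G' (t\<^sup>2 / s) * (2 * t / s) * exp (- (t\<^sup>2 / s) / 4)) = P * s powr (- 3 / 2) * exp (- (t\<^sup>2 / s) / 4) *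
       ((1 - real m) * ?G (t\<^sup>2 / s) + (t\<^sup>2 / s) * 2 * ?G' (t\<^sup>2 / s) - (t\<^sup>2 / s) / 2 * ?G (t\<^sup>2 / s))"
    unfolding P using s by (simp add: field_simps power2_eq_square)
  also have "\<dots> = subord_deriv (Suc m) t s"
    using s by (simp add: subord_deriv_def P_def algebra_simps)
  finally show ?thesis using s by (simp add: subord_deriv_def)
qed

text \<open>The polynomial in \<open>q = t\<^sup>2 / s\<close> is absorbed by three quarters of the exponent \<open>q / 4\<close>; what is left of the
  exponential is that of \<open>subord (t / 2)\<close>.  In particular the \<open>m\<close>-th derivative has \<open>L\<^sup>1\<close> norm \<open>O(t\<^bsup>-m\<^esup>)\<close>.\<close>
lemma subord_deriv_bound_exists:
  "\<exists>C\<ge>0. \<forall>t>0. \<forall>s. \<bar>subord_deriv m t s\<bar> \<le> C * t powr (- real m) * subord (t / 2) s"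
proof -
  obtain C where C: "0 \<le> C" "\<And>q. 0 \<le> q \<Longrightarrow> \<bar>poly (subord_poly m) q\<bar> \<le> C * exp (3 / 16 * q)"
    using poly_le_exp[of "3/16" "subord_poly m"] by auto
  show ?thesis
  proof (intro exI[of _ "4 * sqrt pi * C"] conjI allI impI)
    show "0 \<le> 4 * sqrt pi * C" using C by simp
    fix t s :: real assume t: "0 < t"
    show "\<bar>subord_deriv m t s\<bar> \<le> 4 * sqrt pi * C * t powr (- real m) * subord (t / 2) s"
    proof (cases "0 < s")
      case False then show ?thesis by (simp add: subord_deriv_def subord_def)
    next
      case s: True
      define q where "q = t\<^sup>2 / s"
      have q: "0 \<le> q" using s by (simp add: q_def)
      have P: "t powr (1 - real m) = t * t powr (- real m)" using t powr_add[of t 1 "- real m"] by simp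
      have "\<bar>poly (subord_poly m) q\<bar> * exp (- q / 4) \<le> C * exp (3 / 16 * q) * exp (- q / 4)"
        using C q by (intro mult_right_mono) auto
      also have "\<dots> = C * exp (- q / 16)" by (simp add: exp_add[symmetric] mult.assoc)
      finally have 1: "\<bar>poly (subord_poly m) q\<bar> * exp (- q / 4) \<le> C * exp (- q / 16)" .
      have "\<bar>subord_deriv m t s\<bar> = t powr (1 - real m) * s powr (- 3 / 2) * (\<bar>poly (subord_poly m) q\<bar> * exp (- q / 4))"
        using s by (simp add: subord_deriv_def q_def abs_mult)
      also have "\<dots> \<le> t powr (1 - real m) * s powr (- 3 / 2) * (C * exp (- q / 16))"
        using 1 by (intro mult_left_mono) auto
      also have "\<dots> = 4 * sqrt pi * C * t powr (- real m) * subord (t / 2) s"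
        using s unfolding P q_def by (simp add: subord_def field_simps power_divide)
      finally show ?thesis .
    qed
  qed
qed

definition subord_const :: "nat \<Rightarrow> real" where
  "subord_const m = (SOME C. 0 \<le> C \<and> (\<forall>t>0. \<forall>s. \<bar>subord_deriv m t s\<bar> \<le> C * t powr (- real m) * subord (t / 2) s))"

lemma subord_const_nonneg: "0 \<le> subord_const m"
  and subord_deriv_bound: "0 < t \<Longrightarrow> \<bar>subord_deriv m t s\<bar> \<le> subord_const m * t powr (- real m) * subord (t / 2) s"
  using someI_ex[OF subord_deriv_bound_exists[of m]] unfolding subord_const_def[of m, symmetric] by auto

text \<open>Provides one integrable majorant for all times near \<open>t\<close>.\<close>
lemma subord_scale_le:
  assumes "0 < t" "t / 2 \<le> r" "r \<le> 2 * t"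
  shows "subord (r / 2) s \<le> 4 * subord (t / 4) s"
proof (cases "0 < s")
  case True
  have "(t / 4)\<^sup>2 \<le> (r / 2)\<^sup>2" using assms by (intro power_mono) auto
  then have "exp (- (r / 2)\<^sup>2 / (4 * s)) \<le> exp (- (t / 4)\<^sup>2 / (4 * s))"
    using True by (simp add: divide_right_mono)
  then have "r / 2 / (2 * sqrt pi) * s powr (- 3 / 2) * exp (- (r / 2)\<^sup>2 / (4 * s)) \<le> t / (2 * sqrt pi) * s powr (- 3 / 2) * exp (- (t / 4)\<^sup>2 / (4 * s))"
    using assms by (intro mult_mono divide_right_mono mult_right_mono) auto
  then show ?thesis using True by (simp add: subord_def)
qed (simp add: subord_def)

section \<open>Subordination of bounded functions of time\<close>

definition time_bounded :: "real \<Rightarrow> (real \<Rightarrow> real) \<Rightarrow> bool" where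
  "time_bounded M g \<longleftrightarrow> g \<in> borel_measurable borel \<and> (\<forall>s>0. \<bar>g s\<bar> \<le> M)"

lemma time_bounded_nonneg: "time_bounded M g \<Longrightarrow> 0 \<le> M"
  unfolding time_bounded_def using abs_ge_zero[of "g 1"] by (metis order_trans zero_less_one)

text \<open>The derivatives fall on the density, hence subordination smooths in \<open>t\<close> whatever the bounded function \<open>g\<close> is.
  Applied to \<open>g s = T\<^sub>s f(x)\<close>, this reduces the study of \<open>\<partial>\<^sup>m P\<^sub>t f(x) / \<partial>t\<^sup>m\<close> to functions of one variable.\<close>
definition subordinate :: "nat \<Rightarrow> real \<Rightarrow> (real \<Rightarrow> real) \<Rightarrow> real" where
  "subordinate m t g = (LINT s|lborel. subord_deriv m t s * g s)"

lemma integrable_subord: "0 < t \<Longrightarrow> integrable lborel (subord t)"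
  using has_bochner_integral_subord by (simp add: has_bochner_integral_iff)

lemma integral_subord: "0 < t \<Longrightarrow> (LINT s|lborel. subord t s) = 1"
  using has_bochner_integral_subord by (simp add: has_bochner_integral_iff)

lemma abs_subord_deriv_mult_le:
  assumes t: "0 < t" and g: "time_bounded M g"
  shows "\<bar>subord_deriv m t s * g s\<bar> \<le> subord_const m * t powr (- real m) * subord (t / 2) s * M"
proof (cases "0 < s")
  case True
  then have "\<bar>g s\<bar> \<le> M" using g by (simp add: time_bounded_def)
  then show ?thesis unfolding abs_mult
    using subord_deriv_bound[OF t, of m s] time_bounded_nonneg[OF g] by (intro mult_mono) (auto intro: order_trans[OF abs_ge_zero])
qed (simp add: subord_deriv_def subord_def)

lemma integrable_subord_deriv_mult:
  assumes t: "0 < t" and g: "time_bounded M g"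
  shows "integrable lborel (\<lambda>s. subord_deriv m t s * g s)"
proof (rule Bochner_Integration.integrable_bound)
  show "integrable lborel (\<lambda>s. subord_const m * t powr (- real m) * subord (t / 2) s * M)"
    using integrable_subord[of "t / 2"] t by (intro integrable_mult_left integrable_mult_right) auto
  have [measurable]: "g \<in> borel_measurable borel" using g by (simp add: time_bounded_def)
  show "(\<lambda>s. subord_deriv m t s * g s) \<in> borel_measurable lborel" by measurable
  show "AE s in lborel. norm (subord_deriv m t s * g s) \<le> norm (subord_const m * t powr (- real m) * subord (t / 2) s * M)"
    using abs_subord_deriv_mult_le[OF t g, of m] by (auto intro!: AE_I2 intro: order_trans[OF _ abs_ge_self])
qed

lemma integral_abs_subord_deriv_mult_le:
  assumes t: "0 < t" and g: "time_bounded M g"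
  shows "(LINT s|lborel. \<bar>subord_deriv m t s * g s\<bar>) \<le> subord_const m * t powr (- real m) * M"
proof -
  have "(LINT s|lborel. \<bar>subord_deriv m t s * g s\<bar>) \<le> (LINT s|lborel. subord_const m * t powr (- real m) * subord (t / 2) s * M)"
    using integrable_subord[of "t / 2"] t abs_subord_deriv_mult_le[OF t g, of m]
    by (intro integral_mono integrable_abs integrable_subord_deriv_mult[OF t g] integrable_mult_left integrable_mult_right) auto
  also have "\<dots> = subord_const m * t powr (- real m) * M" using t by (simp add: integral_subord)
  finally show ?thesis .
qed

lemma abs_subordinate_le:
  assumes t: "0 < t" and g: "time_bounded M g"
  shows "\<bar>subordinate m t g\<bar> \<le> subord_const m * t powr (- real m) * M"
  unfolding subordinate_def
  using integral_abs_bound[of lborel "\<lambda>s. subord_deriv m t s * g s"] integral_abs_subord_deriv_mult_le[OF t g, of m] by linarith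

lemma time_bounded_one: "time_bounded 1 (\<lambda>_. 1)"
  by (simp add: time_bounded_def)

lemma subordinate_cong: "(\<And>s. 0 < s \<Longrightarrow> g s = g' s) \<Longrightarrow> subordinate m t g = subordinate m t g'"
  unfolding subordinate_def by (rule Bochner_Integration.integral_cong) (auto simp: subord_deriv_def)

lemma subordinate_has_derivative:
  assumes t: "0 < t" and g: "time_bounded M g"
  shows "((\<lambda>t. subordinate m t g) has_real_derivative subordinate (Suc m) t g) (at t)"
  unfolding subordinate_def
proof (rule has_real_derivative_integral[where \<delta> = "t / 2" and f = "\<lambda>t s. subord_deriv m t s * g s" and f' = "\<lambda>t s. subord_deriv (Suc m) t s * g s"
    and w = "\<lambda>s. subord_const (Suc m) * (t / 2) powr (- real (Suc m)) * (4 * subord (t / 4) s) * M"])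
  have [measurable]: "g \<in> borel_measurable borel" using g by (simp add: time_bounded_def)
  have M: "0 \<le> M" using g by (rule time_bounded_nonneg)
  show "0 < t / 2" using t by simp
  show "integrable lborel (\<lambda>s. subord_deriv m r s * g s)" if "\<bar>r - t\<bar> < t / 2" for r
    using that t by (intro integrable_subord_deriv_mult[OF _ g]) (auto simp: abs_if split: if_splits)
  show "integrable lborel (\<lambda>s. subord_const (Suc m) * (t / 2) powr (- real (Suc m)) * (4 * subord (t / 4) s) * M)"
    using integrable_subord[of "t / 4"] t by (intro integrable_mult_left integrable_mult_right) auto
  show "(\<lambda>s. subord_deriv (Suc m) t s * g s) \<in> borel_measurable lborel" by measurable
  show "AE s in lborel. \<forall>r. \<bar>r - t\<bar> < t / 2 \<longrightarrow>
        ((\<lambda>r. subord_deriv m r s * g s) has_real_derivative subord_deriv (Suc m) r s * g s) (at r) \<and>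
        \<bar>subord_deriv (Suc m) r s * g s\<bar> \<le> subord_const (Suc m) * (t / 2) powr (- real (Suc m)) * (4 * subord (t / 4) s) * M"
  proof (intro AE_I2 allI impI conjI)
    fix s r :: real assume "\<bar>r - t\<bar> < t / 2"
    then have r: "t / 2 \<le> r" "r \<le> 2 * t" "0 < r" using t by (auto simp: abs_if split: if_splits)
    show "((\<lambda>r. subord_deriv m r s * g s) has_real_derivative subord_deriv (Suc m) r s * g s) (at r)"
      by (intro DERIV_cmult_right subord_deriv_has_derivative r)
    have "\<bar>subord_deriv (Suc m) r s * g s\<bar> \<le> subord_const (Suc m) * r powr (- real (Suc m)) * subord (r / 2) s * M"
      by (rule abs_subord_deriv_mult_le[OF r(3) g])
    also have "\<dots> \<le> subord_const (Suc m) * (t / 2) powr (- real (Suc m)) * (4 * subord (t / 4) s) * M"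
      using t r M subord_const_nonneg subord_scale_le[OF t r(1,2), of s]
      by (intro mult_right_mono mult_mono mult_left_mono powr_mono2') (auto intro: subord_nonneg)
    finally show "\<bar>subord_deriv (Suc m) r s * g s\<bar> \<le> subord_const (Suc m) * (t / 2) powr (- real (Suc m)) * (4 * subord (t / 4) s) * M" .
  qed
qed

lemma measurable_subordinate:
  assumes "(\<lambda>(z, s). g z s) \<in> borel_measurable (N \<Otimes>\<^sub>M borel)" and [measurable]: "a \<in> borel_measurable N"
  shows "(\<lambda>z. subordinate m (a z) (g z)) \<in> borel_measurable N"
proof -
  note [measurable] = assms(1)
  show ?thesis unfolding subordinate_def by (rule borel_measurable_parametric_integral) measurable
qed

lemma time_bounded_shift: "time_bounded M g \<Longrightarrow> 0 \<le> s \<Longrightarrow> time_bounded M (\<lambda>\<sigma>. g (s + \<sigma>))"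
  unfolding time_bounded_def by auto

lemma subordinate_swap:
  assumes t: "0 < t" and r: "0 < r" and g: "time_bounded M g"
  shows "subordinate i t (\<lambda>s. subordinate j r (\<lambda>\<sigma>. g (s + \<sigma>))) = subordinate j r (\<lambda>\<sigma>. subordinate i t (\<lambda>s. g (s + \<sigma>)))"
proof -
  have [measurable]: "g \<in> borel_measurable borel" using g by (simp add: time_bounded_def)
  let ?H = "\<lambda>s \<sigma>. subord_deriv i t s * (subord_deriv j r \<sigma> * g (s + \<sigma>))"
  have "(LINT s|lborel. LINT \<sigma>|lborel. ?H s \<sigma>) = (LINT \<sigma>|lborel. LINT s|lborel. ?H s \<sigma>)"
  proof (rule swap_integrals(2))
    show "(\<lambda>(s, \<sigma>). ?H s \<sigma>) \<in> borel_measurable (borel \<Otimes>\<^sub>M borel)" by measurable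
    show "integrable lborel (\<lambda>s. \<bar>subord_deriv i t s * 1\<bar> * (subord_const j * r powr (- real j) * M))"
      by (intro integrable_mult_left integrable_abs integrable_subord_deriv_mult[OF t time_bounded_one])
    show "AE s in lborel. integrable lborel (?H s) \<and> (LINT \<sigma>|lborel. \<bar>?H s \<sigma>\<bar>) \<le> \<bar>subord_deriv i t s * 1\<bar> * (subord_const j * r powr (- real j) * M)"
    proof (intro AE_I2)
      fix s
      show "integrable lborel (?H s) \<and> (LINT \<sigma>|lborel. \<bar>?H s \<sigma>\<bar>) \<le> \<bar>subord_deriv i t s * 1\<bar> * (subord_const j * r powr (- real j) * M)"
      proof (cases "0 < s")
        case True
        then have gs: "time_bounded M (\<lambda>\<sigma>. g (s + \<sigma>))" by (intro time_bounded_shift[OF g]) auto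
        show ?thesis
          using integrable_subord_deriv_mult[OF r gs] integral_abs_subord_deriv_mult_le[OF r gs, of j]
          by (auto simp: abs_mult[of "subord_deriv i t s"] intro!: integrable_mult_right mult_left_mono)
      qed (simp add: subord_deriv_def)
    qed
  qed
  moreover have "(LINT s|lborel. ?H s \<sigma>) = subord_deriv j r \<sigma> * (LINT s|lborel. subord_deriv i t s * g (s + \<sigma>))" for \<sigma>
    by (simp add: mult.left_commute[of "subord_deriv i t _"])
  ultimately show ?thesis unfolding subordinate_def by simp
qed

text \<open>With \<open>v = s + \<sigma>\<close> the double integral becomes one against the convolution of the two densities.\<close>
lemma subordinate_semigroup:
  assumes t: "0 < t" and r: "0 < r" and g: "time_bounded M g"
  shows "subordinate 0 t (\<lambda>s. subordinate 0 r (\<lambda>\<sigma>. g (s + \<sigma>))) = subordinate 0 (t + r) g"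
proof -
  have [measurable]: "g \<in> borel_measurable borel" using g by (simp add: time_bounded_def)
  have M: "0 \<le> M" using g by (rule time_bounded_nonneg)
  let ?H = "\<lambda>s v. subord t s * (subord r (v - s) * g v)"
  have shift: "(LINT v|lborel. F (v - s)) = (LINT v|lborel. F v)" for F :: "real \<Rightarrow> real" and s
    using lborel_integral_real_affine[of 1 F "- s"] by simp
  have int: "integrable lborel (\<lambda>v. subord r (v - s))" for s
    using lborel_integrable_real_affine[OF integrable_subord[OF r], of 1 "- s"] by simp
  have swap: "(LINT s|lborel. LINT v|lborel. ?H s v) = (LINT v|lborel. LINT s|lborel. ?H s v)"
  proof (rule swap_integrals(2))
    show "(\<lambda>(s, v). ?H s v) \<in> borel_measurable (borel \<Otimes>\<^sub>M borel)" by measurable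
    show "integrable lborel (\<lambda>s. subord t s * M)"
      by (intro integrable_mult_left integrable_subord t)
    show "AE s in lborel. integrable lborel (?H s) \<and> (LINT v|lborel. \<bar>?H s v\<bar>) \<le> subord t s * M"
    proof (intro AE_I2)
      fix s
      have le: "\<bar>?H s v\<bar> \<le> subord t s * (subord r (v - s) * M)" for v
      proof (cases "0 < s \<and> s < v")
        case True
        then have "\<bar>g v\<bar> \<le> M" using g by (simp add: time_bounded_def)
        then show ?thesis using t r by (auto simp: abs_mult subord_nonneg intro!: mult_left_mono)
      next
        case False
        then have "subord t s = 0 \<or> subord r (v - s) = 0" by (auto simp: subord_def)
        then show ?thesis by auto
      qed
      have i1: "integrable lborel (\<lambda>v. subord t s * (subord r (v - s) * M))"
        by (intro integrable_mult_left integrable_mult_right int)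
      have i2: "integrable lborel (?H s)"
      proof (rule Bochner_Integration.integrable_bound[OF i1])
        show "(\<lambda>v. ?H s v) \<in> borel_measurable lborel" by measurable
        show "AE v in lborel. norm (?H s v) \<le> norm (subord t s * (subord r (v - s) * M))"
          using le by (auto intro!: AE_I2 intro: order_trans[OF _ abs_ge_self])
      qed
      have "(LINT v|lborel. \<bar>?H s v\<bar>) \<le> (LINT v|lborel. subord t s * (subord r (v - s) * M))"
        using le by (intro integral_mono integrable_abs i1 i2) auto
      also have "\<dots> = subord t s * M"
        using shift[of "subord r" s] integral_subord[OF r] by simp
      finally show "integrable lborel (?H s) \<and> (LINT v|lborel. \<bar>?H s v\<bar>) \<le> subord t s * M" using i2 by simp
    qed
  qed
  have in1: "(LINT s|lborel. ?H s v) = subord_deriv 0 (t + r) v * g v" for v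
  proof (cases "0 < v")
    case True
    have "(LINT s|lborel. ?H s v) = (LINT s|lborel. (subord t s * subord r (v - s)) * g v)"
      by (simp add: mult.assoc)
    also have "\<dots> = subord (t + r) v * g v" using subord_convolution[OF t r True] by simp
    finally show ?thesis using t r by (simp add: subord_deriv_0)
  next
    case False
    then have H0: "?H s v = 0" for s by (auto simp: subord_def)
    have "(LINT s|lborel. ?H s v) = 0" unfolding H0 by simp
    then show ?thesis using False by (simp add: subord_deriv_def)
  qed
  have in2: "(LINT v|lborel. ?H s v) = subord_deriv 0 t s * subordinate 0 r (\<lambda>\<sigma>. g (s + \<sigma>))" for s
    using shift[of "\<lambda>\<sigma>. subord r \<sigma> * g (s + \<sigma>)" s] t r by (simp add: subordinate_def subord_deriv_0)
  show ?thesis using swap unfolding in1 in2 by (simp add: subordinate_def)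
qed

text \<open>Carries an identity between functions of \<open>t\<close> over to all their derivatives.\<close>
lemma derivative_chain_unique:
  fixes a b :: "nat \<Rightarrow> real \<Rightarrow> real"
  assumes a: "\<And>l t. 0 < t \<Longrightarrow> (a l has_real_derivative a (Suc l) t) (at t)"
    and b: "\<And>l t. 0 < t \<Longrightarrow> (b l has_real_derivative b (Suc l) t) (at t)"
    and eq: "\<And>t. 0 < t \<Longrightarrow> a 0 t = b 0 t" and t: "0 < t"
  shows "a l t = b l t"
  using t
proof (induction l arbitrary: t)
  case 0 then show ?case by (rule eq)
next
  case (Suc l)
  have "\<forall>\<^sub>F r in nhds t. a l r = b l r"
    using eventually_nhds_in_open[OF open_greaterThan, of t 0] Suc by (auto elim!: eventually_mono)
  then have "(b l has_real_derivative a (Suc l) t) (at t)"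
    using a[OF Suc.prems, of l] by (simp cong: DERIV_cong_ev)
  then show ?case using b[OF Suc.prems, of l] by (rule DERIV_unique)
qed

section \<open>The Poisson-Hermite semigroup\<close>

text \<open>The derivative \<open>\<partial>\<^sup>m P\<^sub>t f / \<partial>t\<^sup>m\<close>, written as an integral operator.\<close>
definition poisson :: "nat \<Rightarrow> real \<Rightarrow> (real^'d::finite \<Rightarrow> real) \<Rightarrow> real^'d \<Rightarrow> real" where
  "poisson m t f x = subordinate m t (\<lambda>s. ou s f x)"

lemma time_bounded_ou:
  assumes "ess_bounded M f" shows "time_bounded M (\<lambda>s. ou s f x)"
proof -
  have [measurable]: "f \<in> borel_measurable borel" using assms by (rule ess_bounded_measurable)
  show ?thesis unfolding time_bounded_def using abs_ou_le(1)[OF _ assms] by auto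
qed

text \<open>The first factor is the Jacobian of \<open>u \<mapsto> t\<^sup>2 / (4 u)\<close>.\<close>
lemma subord_at_inverse:
  assumes t: "0 < t" and u: "0 < u"
  shows "t\<^sup>2 / (4 * u\<^sup>2) * subord t (t\<^sup>2 / (4 * u)) = 1 / sqrt pi * (exp (- u) / sqrt u)"
proof -
  define v where "v = sqrt u"
  have v: "0 < v" "u = v\<^sup>2" using u by (auto simp: v_def)
  define w where "w = t / (2 * v)"
  have w: "0 < w" "t\<^sup>2 / (4 * u) = w\<^sup>2" using t v by (auto simp: w_def power_divide power_mult_distrib)
  have "(w\<^sup>2) powr (- 3 / 2) = w powr (2 * (- 3 / 2))"
    using w(1) powr_powr[of w 2 "- 3 / 2"] by (simp add: powr_numeral)
  also have "\<dots> = inverse (w ^ 3)" using w(1) by (simp add: powr_minus powr_numeral)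
  finally have pw: "(w\<^sup>2) powr (- 3 / 2) = inverse (w ^ 3)" .
  have ex: "- t\<^sup>2 / (4 * w\<^sup>2) = - u" using t v unfolding w_def by (simp add: power_divide power_mult_distrib)
  have 1: "subord t (w\<^sup>2) = t / (2 * sqrt pi) * inverse (w ^ 3) * exp (- u)"
    using w(1) unfolding subord_def pw ex by simp
  have 2: "t\<^sup>2 / (4 * u\<^sup>2) * (t / (2 * sqrt pi) * inverse (w ^ 3)) = 1 / sqrt pi * (1 / v)"
    using t v(1) unfolding w_def v(2) by (simp add: field_simps power2_eq_square power3_eq_cube)
  show ?thesis unfolding w(2) v_def[symmetric] 1 mult.assoc[symmetric] 2[unfolded mult.assoc[symmetric]] by simp
qed

lemma henstock_integral_eq_lborel:
  fixes h :: "real \<Rightarrow> real"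
  assumes "h absolutely_integrable_on S" "h \<in> borel_measurable borel" "S \<in> sets borel"
  shows "integral S h = (LINT x:S|lborel. h x)"
proof -
  have "integral S h = (LINT x:S|lebesgue. h x)"
    using set_lebesgue_integral_eq_integral(2)[OF assms(1)] by simp
  also have "\<dots> = (LINT x:S|lborel. h x)"
    unfolding set_lebesgue_integral_def using assms(2,3)
    by (intro integral_completion borel_measurable_scaleR borel_measurable_indicator) auto
  finally show ?thesis .
qed

text \<open>The substitution \<open>s = t\<^sup>2 / (4 u)\<close> moves the parameter \<open>t\<close> from the semigroup into the density.\<close>
lemma PH_eq_poisson:
  fixes f :: "real^'d::finite \<Rightarrow> real"
  assumes t: "0 < t" and f: "ess_bounded M f"
  shows "PH t f x = poisson 0 t f x"
proof -
  have [measurable]: "f \<in> borel_measurable borel" using f by (rule ess_bounded_measurable)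
  define F where "F s = subord t s * ou s f x" for s
  have [measurable]: "F \<in> borel_measurable borel" unfolding F_def by measurable
  have Fint: "integrable lborel F"
    using integrable_subord_deriv_mult[OF t time_bounded_ou[OF f], of 0 x] t by (simp add: F_def[abs_def] subord_deriv_0)
  have F0: "indicator {0<..} s *\<^sub>R F s = F s" for s by (simp add: F_def subord_def indicator_def)
  have Fabs: "F absolutely_integrable_on {0<..}"
    unfolding set_integrable_def F0 using Fint by (subst integrable_completion) auto
  have "integral {0<..} F = (LINT s|lborel. F s)"
    using henstock_integral_eq_lborel[OF Fabs] unfolding set_lebesgue_integral_def F0 by simp
  let ?g = "\<lambda>u. t\<^sup>2 / (4 * u)" and ?g' = "\<lambda>u. - (t\<^sup>2 / (4 * u\<^sup>2))"
  have im: "?g ` {0<..} = {0<..}"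
  proof (intro equalityI subsetI)
    fix v assume "v \<in> ?g ` {0<..}" then show "v \<in> {0<..}" using t by auto
  next
    fix v :: real assume "v \<in> {0<..}"
    then show "v \<in> ?g ` {0<..}" using t by (intro image_eqI[of _ _ "t\<^sup>2 / (4 * v)"]) auto
  qed
  have cv: "(\<lambda>u. \<bar>?g' u\<bar> * F (?g u)) absolutely_integrable_on {0<..} \<and> integral {0<..} (\<lambda>u. \<bar>?g' u\<bar> * F (?g u)) = (LINT s|lborel. F s)"
  proof (rule has_absolute_integral_change_of_variables_1'[where S = "{0<..}" and g = ?g and g' = ?g' and f = F, THEN iffD2])
    show "({0<..} :: real set) \<in> sets lebesgue" by (rule sets_completionI_sets) simp
    show "(?g has_real_derivative ?g' u) (at u within {0<..})" if "u \<in> {0<..}" for u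
      using that by (auto intro!: derivative_eq_intros simp: field_simps power2_eq_square)
    show "inj_on ?g {0<..}" using t by (auto simp: inj_on_def)
    show "F absolutely_integrable_on ?g ` {0<..} \<and> integral (?g ` {0<..}) F = (LINT s|lborel. F s)"
      unfolding im using Fabs \<open>integral {0<..} F = _\<close> by simp
  qed
  have "PH t f x = 1 / sqrt pi * (LINT u:{0<..}|lborel. exp (- u) / sqrt u * OU (t\<^sup>2 / (4 * u)) f x)"
    using t by (simp add: PH_def)
  also have "\<dots> = (LINT u:{0<..}|lborel. 1 / sqrt pi * (exp (- u) / sqrt u * OU (t\<^sup>2 / (4 * u)) f x))"
    by (simp only: set_integral_mult_right)
  also have "\<dots> = (LINT u:{0<..}|lborel. \<bar>?g' u\<bar> * F (?g u))"
  proof (rule set_lebesgue_integral_cong)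
    show "\<forall>u. u \<in> {0<..} \<longrightarrow> 1 / sqrt pi * (exp (- u) / sqrt u * OU (t\<^sup>2 / (4 * u)) f x) = \<bar>?g' u\<bar> * F (?g u)"
    proof (intro allI impI)
      fix u :: real assume "u \<in> {0<..}" then have u: "0 < u" by simp
      have "\<bar>?g' u\<bar> * F (?g u) = (t\<^sup>2 / (4 * u\<^sup>2) * subord t (?g u)) * OU (?g u) f x"
        using t u by (simp add: F_def OU_eq_ou)
      then show "1 / sqrt pi * (exp (- u) / sqrt u * OU (t\<^sup>2 / (4 * u)) f x) = \<bar>?g' u\<bar> * F (?g u)"
        unfolding subord_at_inverse[OF t u] by simp
    qed
  qed simp
  also have "\<dots> = integral {0<..} (\<lambda>u. \<bar>?g' u\<bar> * F (?g u))"
    using cv by (intro henstock_integral_eq_lborel[symmetric]) auto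
  also have "\<dots> = (LINT s|lborel. F s)" using cv by simp
  finally show ?thesis using t by (simp add: poisson_def subordinate_def F_def subord_deriv_0)
qed

lemma abs_poisson_le:
  assumes "0 < t" "ess_bounded M f"
  shows "\<bar>poisson m t f x\<bar> \<le> subord_const m * t powr (- real m) * M"
  unfolding poisson_def by (rule abs_subordinate_le[OF assms(1) time_bounded_ou[OF assms(2)]])

lemma abs_poisson_0_le:
  assumes t: "0 < t" and f: "ess_bounded M f"
  shows "\<bar>poisson 0 t f x\<bar> \<le> M"
proof -
  note g = time_bounded_ou[OF f, of x]
  have i: "integrable lborel (\<lambda>s. subord t s * ou s f x)"
    using integrable_subord_deriv_mult[OF t g, of 0] t by (simp add: subord_deriv_0)
  have "\<bar>subord t s * ou s f x\<bar> \<le> subord t s * M" for s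
  proof (cases "0 < s")
    case True then show ?thesis using g t by (auto simp: abs_mult subord_nonneg time_bounded_def intro!: mult_left_mono)
  qed (simp add: subord_def)
  then have "(LINT s|lborel. \<bar>subord t s * ou s f x\<bar>) \<le> (LINT s|lborel. subord t s * M)"
    using i by (intro integral_mono integrable_abs integrable_mult_left integrable_subord t)
  also have "\<dots> = M" using t by (simp add: integral_subord)
  finally have "\<bar>LINT s|lborel. subord t s * ou s f x\<bar> \<le> M"
    by (rule order_trans[OF integral_abs_bound])
  then show ?thesis using t by (simp add: poisson_def subordinate_def subord_deriv_0)
qed

lemma poisson_has_derivative:
  assumes "0 < t" "ess_bounded M f"
  shows "((\<lambda>t. poisson m t f x) has_real_derivative poisson (Suc m) t f x) (at t)"
  unfolding poisson_def by (rule subordinate_has_derivative[OF assms(1) time_bounded_ou[OF assms(2)]])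

lemma PH_deriv_eq_poisson:
  assumes f: "ess_bounded M f" and t: "0 < t"
  shows "PH_deriv n t f x = poisson n t f x"
  unfolding PH_deriv_def using t
proof (induction n arbitrary: t)
  case 0 then show ?case by (simp add: PH_eq_poisson[OF _ f])
next
  case (Suc n)
  have "\<forall>\<^sub>F r in nhds t. (deriv ^^ n) (\<lambda>r. PH r f x) r = poisson n r f x"
    using eventually_nhds_in_open[OF open_greaterThan, of t 0] Suc by (auto elim!: eventually_mono)
  then have "deriv ((deriv ^^ n) (\<lambda>r. PH r f x)) t = deriv (\<lambda>r. poisson n r f x) t"
    by (rule deriv_cong_ev) simp
  also have "\<dots> = poisson (Suc n) t f x"
    by (rule DERIV_imp_deriv[OF poisson_has_derivative[OF Suc.prems f]])
  finally show ?case by simp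
qed

lemma measurable_poisson [measurable (raw)]:
  assumes [measurable]: "f \<in> borel_measurable borel" "g \<in> borel_measurable N" "a \<in> borel_measurable N"
  shows "(\<lambda>z. poisson m (g z) f (a z)) \<in> borel_measurable N"
  unfolding poisson_def by (rule measurable_subordinate) measurable

lemma ess_bounded_poisson:
  assumes "0 < t" "ess_bounded M f"
  shows "ess_bounded (subord_const m * t powr (- real m) * M) (poisson m t f)"
proof -
  have [measurable]: "f \<in> borel_measurable borel" using assms by (rule_tac ess_bounded_measurable)
  have "(\<lambda>x. poisson m t f x) \<in> borel_measurable borel" by measurable
  then show ?thesis using abs_poisson_le[OF assms] by (simp add: ess_bounded_def)
qed

lemma ess_bounded_poisson_0:
  assumes "0 < t" "ess_bounded M f"
  shows "ess_bounded M (poisson 0 t f)"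
  using ess_bounded_poisson[OF assms, of 0] abs_poisson_0_le[OF assms] by (simp add: ess_bounded_def)

lemma poisson_linear:
  assumes t: "0 < t" and f: "ess_bounded M f" and g: "ess_bounded M' g"
  shows "poisson m t (\<lambda>y. a * f y - g y) x = a * poisson m t f x - poisson m t g x"
proof -
  have "poisson m t (\<lambda>y. a * f y - g y) x = subordinate m t (\<lambda>s. a * ou s f x - ou s g x)"
    unfolding poisson_def by (intro subordinate_cong ou_linear[OF _ f g])
  also have "\<dots> = (LINT s|lborel. a * (subord_deriv m t s * ou s f x) - subord_deriv m t s * ou s g x)"
    unfolding subordinate_def by (simp add: algebra_simps)
  also have "\<dots> = a * poisson m t f x - poisson m t g x"
    unfolding poisson_def subordinate_def
    using integrable_subord_deriv_mult[OF t time_bounded_ou[OF f], of m x] integrable_subord_deriv_mult[OF t time_bounded_ou[OF g], of m x]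
    by (subst Bochner_Integration.integral_diff) auto
  finally show ?thesis .
qed

text \<open>The Ornstein-Uhlenbeck semigroup acts by a shift of the time that is averaged.\<close>
lemma ou_poisson:
  assumes s: "0 < s" and t: "0 < t" and f: "ess_bounded M f"
  shows "ou s (poisson m t f) x = subordinate m t (\<lambda>\<sigma>. ou (s + \<sigma>) f x)"
proof -
  have [measurable]: "f \<in> borel_measurable borel" using f by (rule ess_bounded_measurable)
  have "ou s (\<lambda>y. LINT \<sigma>|lborel. subord_deriv m t \<sigma> * ou \<sigma> f y) x = (LINT \<sigma>|lborel. ou s (\<lambda>y. subord_deriv m t \<sigma> * ou \<sigma> f y) x)"
  proof (rule ou_integral_commute(1)[OF s])
    show "(\<lambda>(\<sigma>, y). subord_deriv m t \<sigma> * ou \<sigma> f y) \<in> borel_measurable (borel \<Otimes>\<^sub>M borel)" by measurable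
    show "integrable lborel (\<lambda>\<sigma>. \<bar>subord_deriv m t \<sigma> * 1\<bar> * M)"
      by (intro integrable_mult_left integrable_abs integrable_subord_deriv_mult[OF t time_bounded_one])
    show "AE y in lborel. \<forall>\<sigma>. \<bar>subord_deriv m t \<sigma> * ou \<sigma> f y\<bar> \<le> \<bar>subord_deriv m t \<sigma> * 1\<bar> * M"
    proof (intro AE_I2 allI)
      fix y \<sigma>
      show "\<bar>subord_deriv m t \<sigma> * ou \<sigma> f y\<bar> \<le> \<bar>subord_deriv m t \<sigma> * 1\<bar> * M"
        by (cases "0 < \<sigma>") (auto simp: abs_mult subord_deriv_nonpos intro!: mult_left_mono abs_ou_le(1)[OF _ f])
    qed
  qed
  also have "\<dots> = (LINT \<sigma>|lborel. subord_deriv m t \<sigma> * ou (s + \<sigma>) f x)"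
  proof (rule Bochner_Integration.integral_cong[OF refl])
    fix \<sigma>
    show "ou s (\<lambda>y. subord_deriv m t \<sigma> * ou \<sigma> f y) x = subord_deriv m t \<sigma> * ou (s + \<sigma>) f x"
    proof (cases "0 < \<sigma>")
      case True
      have "ou s (\<lambda>y. subord_deriv m t \<sigma> * ou \<sigma> f y) x = subord_deriv m t \<sigma> * ou s (ou \<sigma> f) x"
        unfolding ou_def by (simp add: mult.left_commute[of _ "subord_deriv m t \<sigma>"])
      then show ?thesis by (simp add: ou_semigroup[OF s True f])
    next
      case False then show ?thesis by (simp add: subord_deriv_nonpos ou_def)
    qed
  qed
  finally show ?thesis by (simp add: poisson_def[abs_def] subordinate_def[abs_def])
qed

lemma poisson_commute:
  assumes t: "0 < t" and r: "0 < r" and f: "ess_bounded M f"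
  shows "poisson i t (poisson j r f) x = poisson j r (poisson i t f) x"
proof -
  have "poisson i t (poisson j r f) x = subordinate i t (\<lambda>s. subordinate j r (\<lambda>\<sigma>. ou (s + \<sigma>) f x))"
    unfolding poisson_def[of i] by (intro subordinate_cong ou_poisson[OF _ r f])
  also have "\<dots> = subordinate j r (\<lambda>\<sigma>. subordinate i t (\<lambda>s. ou (s + \<sigma>) f x))"
    by (rule subordinate_swap[OF t r time_bounded_ou[OF f]])
  also have "\<dots> = subordinate j r (\<lambda>\<sigma>. ou \<sigma> (poisson i t f) x)"
    by (rule subordinate_cong) (simp add: ou_poisson[OF _ t f] add.commute)
  finally show ?thesis by (simp add: poisson_def)
qed

lemma poisson_semigroup_0:
  assumes t: "0 < t" and r: "0 < r" and f: "ess_bounded M f"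
  shows "poisson 0 t (poisson 0 r f) x = poisson 0 (t + r) f x"
proof -
  have "poisson 0 t (poisson 0 r f) x = subordinate 0 t (\<lambda>s. subordinate 0 r (\<lambda>\<sigma>. ou (s + \<sigma>) f x))"
    unfolding poisson_def[of _ t] by (intro subordinate_cong ou_poisson[OF _ r f])
  also have "\<dots> = subordinate 0 (t + r) (\<lambda>s. ou s f x)"
    by (rule subordinate_semigroup[OF t r time_bounded_ou[OF f]])
  finally show ?thesis by (simp add: poisson_def)
qed

lemma poisson_shift_has_derivative:
  assumes f: "ess_bounded M f" and t: "0 < t" and r: "0 < r"
  shows "((\<lambda>t. poisson l (t + r) f x) has_real_derivative poisson (Suc l) (t + r) f x) (at t)"
  using poisson_has_derivative[OF _ f, of "t + r" l x] t r by (simp add: DERIV_shift)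

text \<open>Derivatives may fall on either factor.  From order \<open>0\<close> one first differentiates in the time of the outer
  factor, then exchanges the factors, and then differentiates in the time of the new outer factor.\<close>
lemma poisson_semigroup:
  assumes t: "0 < t" and r: "0 < r" and f: "ess_bounded M f"
  shows "poisson i t (poisson j r f) x = poisson (i + j) (t + r) f x"
proof -
  have 1: "poisson l r (poisson 0 t f) x = poisson l (r + t) f x" if t: "0 < t" and r: "0 < r" for l t r
    using r
  proof (rule derivative_chain_unique[where a = "\<lambda>l r. poisson l r (poisson 0 t f) x" and b = "\<lambda>l r. poisson l (r + t) f x", rotated 3])
    show "((\<lambda>r. poisson l r (poisson 0 t f) x) has_real_derivative poisson (Suc l) r (poisson 0 t f) x) (at r)" if "0 < r" for l r
      by (rule poisson_has_derivative[OF that ess_bounded_poisson_0[OF t f]])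
    show "((\<lambda>r. poisson l (r + t) f x) has_real_derivative poisson (Suc l) (r + t) f x) (at r)" if "0 < r" for l r
      by (rule poisson_shift_has_derivative[OF f that t])
    show "poisson 0 r (poisson 0 t f) x = poisson 0 (r + t) f x" if "0 < r" for r
      by (rule poisson_semigroup_0[OF that t f])
  qed
  have "poisson i t (poisson j r f) x = (\<lambda>l t. poisson (l + j) (t + r) f x) i t"
    using t
  proof (rule derivative_chain_unique[where a = "\<lambda>l t. poisson l t (poisson j r f) x" and b = "\<lambda>l t. poisson (l + j) (t + r) f x", rotated 3])
    show "((\<lambda>t. poisson l t (poisson j r f) x) has_real_derivative poisson (Suc l) t (poisson j r f) x) (at t)" if "0 < t" for l t
      by (rule poisson_has_derivative[OF that ess_bounded_poisson[OF r f]])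
    show "((\<lambda>t. poisson (l + j) (t + r) f x) has_real_derivative poisson (Suc l + j) (t + r) f x) (at t)" if "0 < t" for l t
      using poisson_shift_has_derivative[OF f that r, of "l + j"] by simp
    show "poisson 0 t (poisson j r f) x = poisson (0 + j) (t + r) f x" if "0 < t" for t
      using poisson_commute[OF that r f, of 0 j x] 1[OF that r, of j] by (simp add: add.commute)
  qed
  then show ?thesis by simp
qed

section \<open>The initial value of the Poisson-Hermite semigroup\<close>

text \<open>Symmetry moves the semigroup to the test function, and the scaling \<open>s = t\<^sup>2 v\<close> removes \<open>t\<close> from the
  density.\<close>
lemma poisson_pairing:
  fixes f \<phi> :: "real^'d::finite \<Rightarrow> real"
  assumes t: "0 < t" and f: "ess_bounded M f" and \<phi>: "ess_bounded M' \<phi>"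
  shows "(LINT x|lborel. exp (- (norm x)\<^sup>2) * (poisson 0 t f x * \<phi> x))
       = (LINT v|lborel. subord 1 v * (LINT x|lborel. exp (- (norm x)\<^sup>2) * (f x * ou (t\<^sup>2 * v) \<phi> x)))"
proof -
  have [measurable]: "f \<in> borel_measurable borel" "\<phi> \<in> borel_measurable borel" using f \<phi> by (auto simp: ess_bounded_def)
  let ?H = "\<lambda>x s. (exp (- (norm x)\<^sup>2) * \<phi> x) * (subord_deriv 0 t s * ou s f x)"
  define \<theta> where "\<theta> s = (LINT x|lborel. exp (- (norm x)\<^sup>2) * (f x * ou s \<phi> x))" for s
  have swap: "(LINT x|lborel. LINT s|lborel. ?H x s) = (LINT s|lborel. LINT x|lborel. ?H x s)"
  proof (rule swap_integrals(2))
    show "(\<lambda>(x, s). ?H x s) \<in> borel_measurable (borel \<Otimes>\<^sub>M borel)" by measurable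
    show "integrable lborel (\<lambda>x. \<bar>exp (- (norm x)\<^sup>2) * \<phi> x\<bar> * (subord_const 0 * t powr (- real 0) * M))"
      by (intro integrable_mult_left integrable_abs integrable_gauss_weight_mult[OF \<phi>])
    show "AE x in lborel. integrable lborel (?H x) \<and> (LINT s|lborel. \<bar>?H x s\<bar>) \<le> \<bar>exp (- (norm x)\<^sup>2) * \<phi> x\<bar> * (subord_const 0 * t powr (- real 0) * M)"
    proof (intro AE_I2 conjI)
      fix x
      show "integrable lborel (?H x)"
        by (intro integrable_mult_right integrable_subord_deriv_mult[OF t time_bounded_ou[OF f]])
      show "(LINT s|lborel. \<bar>?H x s\<bar>) \<le> \<bar>exp (- (norm x)\<^sup>2) * \<phi> x\<bar> * (subord_const 0 * t powr (- real 0) * M)"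
        unfolding abs_mult[of "exp (- (norm x)\<^sup>2) * \<phi> x"] integral_mult_right_zero
        by (intro mult_left_mono integral_abs_subord_deriv_mult_le[OF t time_bounded_ou[OF f]]) auto
    qed
  qed
  have in1: "(LINT s|lborel. ?H x s) = exp (- (norm x)\<^sup>2) * (poisson 0 t f x * \<phi> x)" for x
    unfolding poisson_def subordinate_def by simp
  have in2: "(LINT x|lborel. ?H x s) = subord t s * \<theta> s" for s
  proof (cases "0 < s")
    case True
    have "(LINT x|lborel. ?H x s) = (LINT x|lborel. subord t s * (exp (- (norm x)\<^sup>2) * (ou s f x * \<phi> x)))"
      using t by (simp add: subord_deriv_0 mult_ac)
    also have "\<dots> = subord t s * \<theta> s" unfolding \<theta>_def using ou_symmetric[OF True f \<phi>] by simp
    finally show ?thesis .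
  qed (simp add: subord_deriv_def subord_def)
  have "(LINT x|lborel. exp (- (norm x)\<^sup>2) * (poisson 0 t f x * \<phi> x)) = (LINT s|lborel. subord t s * \<theta> s)"
    using swap unfolding in1 in2 .
  also have "\<dots> = (LINT v|lborel. t\<^sup>2 * (subord t (t\<^sup>2 * v) * \<theta> (t\<^sup>2 * v)))"
    using t lborel_integral_real_affine[of "t\<^sup>2" "\<lambda>s. subord t s * \<theta> s" 0] by simp
  also have "\<dots> = (LINT v|lborel. subord 1 v * \<theta> (t\<^sup>2 * v))"
  proof (rule Bochner_Integration.integral_cong[OF refl])
    fix v
    have "t\<^sup>2 * subord t (t\<^sup>2 * v) = subord 1 v"
    proof (cases "0 < v")
      case True
      have "(t\<^sup>2) powr (- 3 / 2) = t powr (2 * (- 3 / 2))"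
        using t powr_powr[of t 2 "- 3 / 2"] by (simp add: powr_numeral)
      also have "\<dots> = inverse (t ^ 3)" using t by (simp add: powr_minus powr_numeral)
      finally have "(t\<^sup>2 * v) powr (- 3 / 2) = inverse (t ^ 3) * v powr (- 3 / 2)"
        using t True by (simp add: powr_mult)
      moreover have "- t\<^sup>2 / (4 * (t\<^sup>2 * v)) = - 1 / (4 * v)" using t by simp
      ultimately show ?thesis using t True by (simp add: subord_def power2_eq_square power3_eq_cube field_simps)
    next
      case False
      then have "\<not> 0 < t\<^sup>2 * v" using t by (simp add: zero_less_mult_iff)
      then show ?thesis using False by (simp add: subord_def)
    qed
    then show "t\<^sup>2 * (subord t (t\<^sup>2 * v) * \<theta> (t\<^sup>2 * v)) = subord 1 v * \<theta> (t\<^sup>2 * v)"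
      by (simp add: mult.assoc[symmetric])
  qed
  finally show ?thesis unfolding \<theta>_def .
qed

lemma poisson_tendsto_weakly:
  fixes f \<phi> :: "real^'d::finite \<Rightarrow> real"
  assumes T: "T \<longlonglongrightarrow> 0" "\<And>i. 0 < T i" and f: "ess_bounded M f"
    and cont: "continuous_on UNIV \<phi>" and bdd: "\<And>y. \<bar>\<phi> y\<bar> \<le> M'"
  shows "(\<lambda>i. LINT x|lborel. exp (- (norm x)\<^sup>2) * (poisson 0 (T i) f x * \<phi> x)) \<longlonglongrightarrow> (LINT x|lborel. exp (- (norm x)\<^sup>2) * (f x * \<phi> x))"
proof -
  have \<phi>m[measurable]: "\<phi> \<in> borel_measurable borel" using cont by (rule borel_measurable_continuous_onI)
  have \<phi>: "ess_bounded M' \<phi>" using bdd by (simp add: ess_bounded_def)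
  have [measurable]: "f \<in> borel_measurable borel" using f by (rule ess_bounded_measurable)
  have M: "0 \<le> M" using f by (rule ess_bounded_nonneg)
  have M': "0 \<le> M'" using \<phi> by (rule ess_bounded_nonneg)
  define \<theta> where "\<theta> s = (LINT x|lborel. exp (- (norm x)\<^sup>2) * (f x * ou s \<phi> x))" for s
  define \<theta>0 where "\<theta>0 = (LINT x|lborel. exp (- (norm x)\<^sup>2) * (f x * \<phi> x))"
  have AEf: "AE x in lborel. \<bar>f x\<bar> \<le> M" using f by (simp add: ess_bounded_def)
  have bd: "AE x in lborel. norm (exp (- (norm x)\<^sup>2) * (f x * ou s \<phi> x)) \<le> exp (- (norm x)\<^sup>2) * (M * M')" if s: "0 < s" for s
    using AEf
  proof eventually_elim
    fix x assume "\<bar>f x\<bar> \<le> M"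
    then show "norm (exp (- (norm x)\<^sup>2) * (f x * ou s \<phi> x)) \<le> exp (- (norm x)\<^sup>2) * (M * M')"
      using abs_ou_le(1)[OF s \<phi>, of x] M by (auto simp: abs_mult intro!: mult_left_mono mult_mono)
  qed
  define K where "K = (LINT x|lborel. exp (- (norm (x::real^'d))\<^sup>2) * (M * M'))"
  have \<theta>b: "\<bar>\<theta> s\<bar> \<le> K" if s: "0 < s" for s
  proof -
    have i: "integrable lborel (\<lambda>x. exp (- (norm x)\<^sup>2) * (f x * ou s \<phi> x))"
      by (rule integrable_gauss_weight_mult[OF ess_bounded_mult[OF f ess_bounded_ou[OF s \<phi>]]])
    have "\<bar>\<theta> s\<bar> \<le> (LINT x|lborel. \<bar>exp (- (norm x)\<^sup>2) * (f x * ou s \<phi> x)\<bar>)"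
      unfolding \<theta>_def by (rule integral_abs_bound)
    also have "\<dots> \<le> K" unfolding K_def
      using bd[OF s] by (intro integral_mono_AE integrable_abs i integrable_mult_left integrable_gauss_weight) auto
    finally show ?thesis .
  qed
  have \<theta>lim: "(\<lambda>i. \<theta> ((T i)\<^sup>2 * v)) \<longlonglongrightarrow> \<theta>0" if v: "0 < v" for v
    unfolding \<theta>_def \<theta>0_def
  proof (rule integral_dominated_convergence[where w = "\<lambda>x. exp (- (norm x)\<^sup>2) * (M * M')"])
    have Tv: "(\<lambda>i. (T i)\<^sup>2 * v) \<longlonglongrightarrow> 0"
      using tendsto_mult_right[OF tendsto_power[OF T(1), of 2], of v] by simp
    show "AE x in lborel. (\<lambda>i. exp (- (norm x)\<^sup>2) * (f x * ou ((T i)\<^sup>2 * v) \<phi> x)) \<longlonglongrightarrow> exp (- (norm x)\<^sup>2) * (f x * \<phi> x)"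
      using T(2) v by (intro AE_I2 tendsto_mult_left ou_tendsto_at_0[OF Tv _ cont bdd] mult_pos_pos zero_less_power) auto
    show "AE x in lborel. norm (exp (- (norm x)\<^sup>2) * (f x * ou ((T i)\<^sup>2 * v) \<phi> x)) \<le> exp (- (norm x)\<^sup>2) * (M * M')" for i
      using T(2)[of i] v by (intro bd) auto
    show "integrable lborel (\<lambda>x::real^'d. exp (- (norm x)\<^sup>2) * (M * M'))"
      by (intro integrable_mult_left integrable_gauss_weight)
  qed measurable
  have \<theta>m[measurable]: "\<theta> \<in> borel_measurable borel"
    unfolding \<theta>_def by (rule borel_measurable_parametric_integral) measurable
  have "(\<lambda>i. LINT v|lborel. subord 1 v * \<theta> ((T i)\<^sup>2 * v)) \<longlonglongrightarrow> (LINT v|lborel. subord 1 v * \<theta>0)"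
  proof (rule integral_dominated_convergence[where w = "\<lambda>v. subord 1 v * K"])
    show "integrable lborel (\<lambda>v. subord 1 v * K)" by (intro integrable_mult_left integrable_subord) simp
    show "AE v in lborel. (\<lambda>i. subord 1 v * \<theta> ((T i)\<^sup>2 * v)) \<longlonglongrightarrow> subord 1 v * \<theta>0"
    proof (intro AE_I2)
      fix v :: real
      show "(\<lambda>i. subord 1 v * \<theta> ((T i)\<^sup>2 * v)) \<longlonglongrightarrow> subord 1 v * \<theta>0"
      proof (cases "0 < v")
        case True show ?thesis by (intro tendsto_mult_left \<theta>lim True)
      qed (simp add: subord_def)
    qed
    show "AE v in lborel. norm (subord 1 v * \<theta> ((T i)\<^sup>2 * v)) \<le> subord 1 v * K" for i
    proof (intro AE_I2)
      fix v :: real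
      show "norm (subord 1 v * \<theta> ((T i)\<^sup>2 * v)) \<le> subord 1 v * K"
      proof (cases "0 < v")
        case True
        then have "0 < (T i)\<^sup>2 * v" using T(2)[of i] by simp
        from \<theta>b[OF this] show ?thesis by (auto simp: abs_mult subord_nonneg intro!: mult_left_mono)
      qed (simp add: subord_def)
    qed
  qed measurable
  then show ?thesis
    unfolding poisson_pairing[OF T(2) f \<phi>] \<theta>_def[symmetric] \<theta>0_def[symmetric]
    by (simp add: integral_subord)
qed

text \<open>Lusin's theorem in the form that the Lebesgue measurable functions are the almost everywhere limits of
  continuous ones.\<close>
lemma AE_tendsto_continuous_functions:
  fixes D :: "real^'d::finite \<Rightarrow> real"
  assumes D: "D \<in> borel_measurable borel"
  obtains \<psi> where "\<And>n::nat. continuous_on UNIV (\<psi> n)" "AE x in lborel. (\<lambda>n. \<psi> n x) \<longlonglongrightarrow> D x"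
proof -
  have "D \<in> borel_measurable lebesgue" using D by (simp add: measurable_completion)
  then have "D measurable_on UNIV" by (rule lebesgue_measurable_imp_measurable_on) simp
  then obtain N \<psi> where N: "negligible N" and \<psi>: "\<And>n::nat. continuous_on UNIV (\<psi> n)"
      and lim: "\<And>x. x \<notin> N \<Longrightarrow> (\<lambda>n. \<psi> n x) \<longlonglongrightarrow> D x"
    unfolding measurable_on_def by auto
  have "AE x in lebesgue. (\<lambda>n. \<psi> n x) \<longlonglongrightarrow> D x"
    using N lim by (intro AE_I'[of N]) (auto simp: negligible_iff_null_sets)
  then have "AE x in lborel. (\<lambda>n. \<psi> n x) \<longlonglongrightarrow> D x" by (simp add: AE_completion_iff)
  with \<psi> that show thesis by blast
qed

text \<open>Continuous functions that converge to \<open>D\<close>, cut off at the height \<open>K\<close>, are admissible test functions, so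
  \<open>D\<close> is orthogonal to itself.\<close>
lemma gauss_orthogonal_continuous_imp_AE_0:
  fixes D :: "real^'d::finite \<Rightarrow> real"
  assumes D: "ess_bounded K D"
    and orth: "\<And>\<phi>. continuous_on UNIV \<phi> \<Longrightarrow> (\<And>y. \<bar>\<phi> y\<bar> \<le> K) \<Longrightarrow> (LINT x|lborel. exp (- (norm x)\<^sup>2) * (D x * \<phi> x)) = 0"
  shows "AE x in lborel. D x = 0"
proof -
  have [measurable]: "D \<in> borel_measurable borel" using D by (rule ess_bounded_measurable)
  have K: "0 \<le> K" using D by (rule ess_bounded_nonneg)
  obtain \<psi> where \<psi>: "\<And>n::nat. continuous_on UNIV (\<psi> n)" "AE x in lborel. (\<lambda>n. \<psi> n x) \<longlonglongrightarrow> D x"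
    using AE_tendsto_continuous_functions[of D] by auto
  define \<zeta> where "\<zeta> n x = max (- K) (min K (\<psi> n x))" for n x
  have \<zeta>c: "continuous_on UNIV (\<zeta> n)" for n
    unfolding \<zeta>_def by (intro continuous_intros \<psi>)
  have \<zeta>b: "\<bar>\<zeta> n x\<bar> \<le> K" for n x using K by (auto simp: \<zeta>_def)
  have [measurable]: "\<zeta> n \<in> borel_measurable borel" for n using \<zeta>c by (rule borel_measurable_continuous_onI)
  have AED: "AE x in lborel. \<bar>D x\<bar> \<le> K" using D by (simp add: ess_bounded_def)
  have "(\<lambda>n. LINT x|lborel. exp (- (norm x)\<^sup>2) * (D x * \<zeta> n x)) \<longlonglongrightarrow> (LINT x|lborel. exp (- (norm x)\<^sup>2) * (D x * D x))"
  proof (rule integral_dominated_convergence[where w = "\<lambda>x. exp (- (norm x)\<^sup>2) * (K * K)"])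
    show "integrable lborel (\<lambda>x::real^'d. exp (- (norm x)\<^sup>2) * (K * K))"
      by (intro integrable_mult_left integrable_gauss_weight)
    show "AE x in lborel. (\<lambda>n. exp (- (norm x)\<^sup>2) * (D x * \<zeta> n x)) \<longlonglongrightarrow> exp (- (norm x)\<^sup>2) * (D x * D x)"
      using \<psi>(2) AED
    proof eventually_elim
      fix x assume x: "(\<lambda>n. \<psi> n x) \<longlonglongrightarrow> D x" "\<bar>D x\<bar> \<le> K"
      have "(\<lambda>n. \<zeta> n x) \<longlonglongrightarrow> max (- K) (min K (D x))"
        unfolding \<zeta>_def by (intro tendsto_intros x)
      also have "max (- K) (min K (D x)) = D x" using x(2) by auto
      finally show "(\<lambda>n. exp (- (norm x)\<^sup>2) * (D x * \<zeta> n x)) \<longlonglongrightarrow> exp (- (norm x)\<^sup>2) * (D x * D x)"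
        by (intro tendsto_mult_left)
    qed
    show "AE x in lborel. norm (exp (- (norm x)\<^sup>2) * (D x * \<zeta> n x)) \<le> exp (- (norm x)\<^sup>2) * (K * K)" for n
      using AED by eventually_elim (auto simp: abs_mult intro!: mult_left_mono mult_mono \<zeta>b K)
  qed measurable
  then have "(LINT x|lborel. exp (- (norm x)\<^sup>2) * (D x * D x)) = 0"
    using orth[OF \<zeta>c \<zeta>b] by (simp add: LIMSEQ_const_iff)
  moreover have "integrable lborel (\<lambda>x. exp (- (norm x)\<^sup>2) * (D x * D x))"
    by (rule integrable_gauss_weight_mult[OF ess_bounded_mult[OF D D]])
  ultimately have "AE x in lborel. exp (- (norm x)\<^sup>2) * (D x * D x) = 0"
    by (subst (asm) integral_nonneg_eq_0_iff_AE) auto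
  then show ?thesis by eventually_elim auto
qed

text \<open>A priori \<open>P\<^sub>t f\<close> tends to \<open>f\<close> only weakly.  If a pointwise limit exists almost everywhere, it is also the weak
  limit by dominated convergence, and so it is \<open>f\<close>.\<close>
lemma poisson_AE_tendsto:
  fixes f :: "real^'d::finite \<Rightarrow> real"
  assumes T: "T \<longlonglongrightarrow> 0" "\<And>i. 0 < T i" and f: "ess_bounded M f"
    and conv: "AE x in lborel. convergent (\<lambda>i. poisson 0 (T i) f x)"
  shows "AE x in lborel. (\<lambda>i. poisson 0 (T i) f x) \<longlonglongrightarrow> f x"
proof -
  have fm[measurable]: "f \<in> borel_measurable borel" using f by (rule ess_bounded_measurable)
  have M: "0 \<le> M" using f by (rule ess_bounded_nonneg)
  define g where "g x = lim (\<lambda>i. poisson 0 (T i) f x)" for x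
  have gm[measurable]: "g \<in> borel_measurable borel"
    unfolding g_def by (intro borel_measurable_lim_metric) measurable
  have glim: "AE x in lborel. (\<lambda>i. poisson 0 (T i) f x) \<longlonglongrightarrow> g x"
    using conv by eventually_elim (simp add: g_def convergent_LIMSEQ_iff)
  have gb: "AE x in lborel. \<bar>g x\<bar> \<le> M"
    using glim
  proof eventually_elim
    fix x assume "(\<lambda>i. poisson 0 (T i) f x) \<longlonglongrightarrow> g x"
    then have "(\<lambda>i. \<bar>poisson 0 (T i) f x\<bar>) \<longlonglongrightarrow> \<bar>g x\<bar>" by (rule tendsto_rabs)
    then show "\<bar>g x\<bar> \<le> M" using abs_poisson_0_le[OF T(2) f] by (intro LIMSEQ_le_const2) auto
  qed
  have g: "ess_bounded M g" using gb gm by (simp add: ess_bounded_def)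
  have AEf: "AE x in lborel. \<bar>f x\<bar> \<le> M" using f by (simp add: ess_bounded_def)
  have "AE x in lborel. f x - g x = 0"
  proof (rule gauss_orthogonal_continuous_imp_AE_0)
    have "AE x in lborel. \<bar>f x - g x\<bar> \<le> 2 * M" using gb AEf by eventually_elim auto
    then show "ess_bounded (2 * M) (\<lambda>x. f x - g x)" by (simp add: ess_bounded_def)
    fix \<phi> :: "real^'d \<Rightarrow> real" assume \<phi>: "continuous_on UNIV \<phi>" "\<And>y. \<bar>\<phi> y\<bar> \<le> 2 * M"
    have [measurable]: "\<phi> \<in> borel_measurable borel" using \<phi>(1) by (rule borel_measurable_continuous_onI)
    have \<phi>b: "ess_bounded (2 * M) \<phi>" using \<phi>(2) by (simp add: ess_bounded_def)
    have 1: "(\<lambda>i. LINT x|lborel. exp (- (norm x)\<^sup>2) * (poisson 0 (T i) f x * \<phi> x)) \<longlonglongrightarrow> (LINT x|lborel. exp (- (norm x)\<^sup>2) * (f x * \<phi> x))"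
      by (rule poisson_tendsto_weakly[OF T f \<phi>])
    have 2: "(\<lambda>i. LINT x|lborel. exp (- (norm x)\<^sup>2) * (poisson 0 (T i) f x * \<phi> x)) \<longlonglongrightarrow> (LINT x|lborel. exp (- (norm x)\<^sup>2) * (g x * \<phi> x))"
    proof (rule integral_dominated_convergence[where w = "\<lambda>x. exp (- (norm x)\<^sup>2) * (M * (2 * M))"])
      show "integrable lborel (\<lambda>x::real^'d. exp (- (norm x)\<^sup>2) * (M * (2 * M)))"
        by (intro integrable_mult_left integrable_gauss_weight)
      show "AE x in lborel. (\<lambda>i. exp (- (norm x)\<^sup>2) * (poisson 0 (T i) f x * \<phi> x)) \<longlonglongrightarrow> exp (- (norm x)\<^sup>2) * (g x * \<phi> x)"
        using glim by eventually_elim (intro tendsto_mult_left tendsto_mult_right)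
      show "AE x in lborel. norm (exp (- (norm x)\<^sup>2) * (poisson 0 (T i) f x * \<phi> x)) \<le> exp (- (norm x)\<^sup>2) * (M * (2 * M))" for i
        using abs_poisson_0_le[OF T(2) f, of i] \<phi>(2) M by (auto simp: abs_mult intro!: mult_left_mono mult_mono)
    qed measurable
    have "(LINT x|lborel. exp (- (norm x)\<^sup>2) * (f x * \<phi> x) - exp (- (norm x)\<^sup>2) * (g x * \<phi> x)) = 0"
      using LIMSEQ_unique[OF 1 2] integrable_gauss_weight_mult[OF ess_bounded_mult[OF f \<phi>b]] integrable_gauss_weight_mult[OF ess_bounded_mult[OF g \<phi>b]]
      by (subst Bochner_Integration.integral_diff) auto
    then show "(LINT x|lborel. exp (- (norm x)\<^sup>2) * ((f x - g x) * \<phi> x)) = 0"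
      by (simp add: algebra_simps)
  qed
  with glim show ?thesis by eventually_elim auto
qed

section \<open>Essential suprema and Lipschitz constants\<close>

lemma AE_gauss_iff: "(AE x in (gauss :: (real^'d::finite) measure). P x) \<longleftrightarrow> (AE x in lborel. P x)"
proof -
  have "0 < ennreal (pi powr (- real CARD('d) / 2) * exp (- (norm x)\<^sup>2))" for x :: "real^'d" by simp
  then show ?thesis unfolding gauss_def by (subst AE_density) auto
qed

lemma borel_measurable_gauss: "borel_measurable (gauss :: (real^'d::finite) measure) = borel_measurable borel"
  by (rule measurable_cong_sets) (auto simp: gauss_def)

lemma Linf_norm_le_iff:
  fixes f :: "real^'d::finite \<Rightarrow> real"
  assumes "f \<in> borel_measurable borel"
  shows "Linf_norm f \<le> ereal c \<longleftrightarrow> ess_bounded c f"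
proof -
  have [measurable]: "f \<in> borel_measurable gauss" using assms by (simp add: borel_measurable_gauss)
  have m: "(\<lambda>x. ereal \<bar>f x\<bar>) \<in> borel_measurable gauss" by measurable
  show ?thesis
  proof
    assume le: "Linf_norm f \<le> ereal c"
    have "AE x in gauss. ereal \<bar>f x\<bar> \<le> Linf_norm f" unfolding Linf_norm_def by (rule esssup_AE)
    then have "AE x in gauss. \<bar>f x\<bar> \<le> c"
      by eventually_elim (use le in \<open>meson ereal_less_eq(3) order_trans\<close>)
    then show "ess_bounded c f" using assms by (simp add: ess_bounded_def AE_gauss_iff)
  next
    assume "ess_bounded c f"
    then have "AE x in gauss. ereal \<bar>f x\<bar> \<le> ereal c" by (simp add: ess_bounded_def AE_gauss_iff)
    then show "Linf_norm f \<le> ereal c" unfolding Linf_norm_def by (rule esssup_I[OF m])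
  qed
qed

lemma Linf_norm_nonneg:
  fixes f :: "real^'d::finite \<Rightarrow> real"
  assumes "f \<in> borel_measurable borel"
  shows "0 \<le> Linf_norm f"
proof (rule ccontr)
  assume "\<not> 0 \<le> Linf_norm f"
  then obtain c where c: "Linf_norm f < ereal c" "ereal c < 0" using ereal_dense2[of "Linf_norm f" 0] by (auto simp: not_le)
  then have "ess_bounded c f" using Linf_norm_le_iff[OF assms, of c] by auto
  then show False using ess_bounded_nonneg[of c f] c by auto
qed

lemma Linf_imp_ess_bounded:
  fixes f :: "real^'d::finite \<Rightarrow> real"
  assumes "f \<in> Linf"
  shows "ess_bounded (real_of_ereal (Linf_norm f)) f"
proof -
  have m: "f \<in> borel_measurable borel" and fin: "Linf_norm f < \<infinity>"
    using assms by (auto simp: Linf_def borel_measurable_gauss)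
  have "Linf_norm f = ereal (real_of_ereal (Linf_norm f))"
    using Linf_norm_nonneg[OF m] fin by (auto intro!: ereal_real'[symmetric])
  then show ?thesis using Linf_norm_le_iff[OF m] by (metis order_refl)
qed

lemma ess_bounded_imp_Linf:
  fixes f :: "real^'d::finite \<Rightarrow> real"
  assumes "ess_bounded M f"
  shows "f \<in> Linf" "real_of_ereal (Linf_norm f) \<le> M"
proof -
  have m: "f \<in> borel_measurable borel" using assms by (rule ess_bounded_measurable)
  have le: "Linf_norm f \<le> ereal M" using assms by (simp add: Linf_norm_le_iff[OF m])
  then show "f \<in> Linf" using m by (auto simp: Linf_def borel_measurable_gauss intro: le_less_trans)
  show "real_of_ereal (Linf_norm f) \<le> M"
    using le Linf_norm_nonneg[OF m] by (cases "Linf_norm f") auto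
qed

lemma Lip_bound_iff:
  assumes f: "ess_bounded M f"
  shows "Lip_bound \<alpha> f A \<longleftrightarrow>
    (\<forall>t>0. ess_bounded (A * t powr (\<alpha> - real (least_above \<alpha>))) (poisson (least_above \<alpha>) t f))"
proof -
  have eq: "PH_deriv n t f = poisson n t f" if "0 < t" for n t
    using PH_deriv_eq_poisson[OF f that] by auto
  have m: "poisson n t f \<in> borel_measurable borel" if "0 < t" for n t
    using ess_bounded_poisson[OF that f] by (rule ess_bounded_measurable)
  show ?thesis unfolding Lip_bound_def by (auto simp: eq Linf_norm_le_iff[OF m])
qed

lemma Lip_bound_nonneg:
  assumes f: "ess_bounded M f" and A: "Lip_bound \<alpha> f A"
  shows "0 \<le> A"
proof -
  have "ess_bounded (A * 1 powr (\<alpha> - real (least_above \<alpha>))) (poisson (least_above \<alpha>) 1 f)"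
    using A zero_less_one unfolding Lip_bound_iff[OF f] by blast
  from ess_bounded_nonneg[OF this] show ?thesis by simp
qed

text \<open>The condition on \<open>A\<close> is closed and bounds \<open>A\<close> below by \<open>0\<close>, so the infimum of the admissible constants is
  itself admissible.\<close>
lemma Lip_const_props:
  fixes f :: "real^'d::finite \<Rightarrow> real"
  assumes f: "f \<in> Lip \<alpha>"
  shows "Lip_bound \<alpha> f (Lip_const \<alpha> f)" and "\<And>A. Lip_bound \<alpha> f A \<Longrightarrow> Lip_const \<alpha> f \<le> A"
proof -
  define M where "M = real_of_ereal (Linf_norm f)"
  have fb: "ess_bounded M f" using f unfolding M_def by (intro Linf_imp_ess_bounded) (simp add: Lip_def)
  define S where "S = {A. Lip_bound \<alpha> f A}"
  have ne: "S \<noteq> {}" using f by (auto simp: S_def Lip_def)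
  have bdd: "bdd_below S" by (rule bdd_belowI[of _ 0]) (auto simp: S_def Lip_bound_nonneg[OF fb])
  have inf: "Lip_bound \<alpha> f (Inf S)"
    unfolding Lip_bound_def
  proof (intro allI impI)
    fix t :: real assume t: "0 < t"
    define N p where "N = Linf_norm (PH_deriv (least_above \<alpha>) t f)" and "p = t powr (- real (least_above \<alpha>) + \<alpha>)"
    have p: "0 < p" using t by (simp add: p_def)
    have le: "N \<le> ereal (A * p)" if "A \<in> S" for A using that t by (auto simp: S_def Lip_bound_def N_def p_def)
    show "N \<le> ereal (Inf S * p)"
    proof (cases N)
      case (real v)
      have "v / p \<le> Inf S"
        using le p real by (intro cInf_greatest[OF ne]) (auto simp: divide_le_eq)
      then show ?thesis using p real by (simp add: divide_le_eq)
    qed (use le ne in auto)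
  qed
  have "Lip_const \<alpha> f = Inf S"
    unfolding Lip_const_def by (rule Least_equality) (use inf bdd in \<open>auto simp: S_def intro!: cInf_lower\<close>)
  then show "Lip_bound \<alpha> f (Lip_const \<alpha> f)" "\<And>A. Lip_bound \<alpha> f A \<Longrightarrow> Lip_const \<alpha> f \<le> A"
    using inf bdd by (auto simp: S_def intro!: cInf_lower)
qed

lemma less_least_above: "x < real (least_above x)"
  unfolding least_above_def by (rule LeastI_ex) (rule reals_Archimedean2)

lemma least_above_le: "x < real n \<Longrightarrow> least_above x \<le> n"
  unfolding least_above_def by (rule Least_le)

section \<open>Pointwise derivative bounds for Lipschitz functions\<close>

definition profile_const :: "real \<Rightarrow> nat \<Rightarrow> nat \<Rightarrow> real" where
  "profile_const \<alpha> n j = subord_const j + subord_const (j - n) * 2 powr (real j - \<alpha>)"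

lemma profile_const_nonneg: "0 \<le> profile_const \<alpha> n j"
  by (simp add: profile_const_def subord_const_nonneg)

text \<open>Write \<open>P\<^sub>r = P\<^bsub>r/2\<^esub> P\<^bsub>r/2\<^esub>\<close>, let \<open>n\<close> derivatives fall on the inner and \<open>j - n\<close> on the outer factor.  The
  Lipschitz condition bounds the inner function almost everywhere, and the outer integral operator turns this
  into a bound at every point \<open>x\<close> and for every order \<open>j \<ge> n\<close>.\<close>
lemma Lip_imp_lip_profile:
  assumes f: "ess_bounded M f" and A: "Lip_bound \<alpha> f A"
  shows "lip_profile \<alpha> (least_above \<alpha>) (profile_const \<alpha> (least_above \<alpha>)) (M + A) (\<lambda>j r. poisson j r f x)"
proof -
  define n where "n = least_above \<alpha>"
  have M: "0 \<le> M" using f by (rule ess_bounded_nonneg)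
  have A0: "0 \<le> A" by (rule Lip_bound_nonneg[OF f A])
  have 1: "\<bar>poisson j r f x\<bar> \<le> profile_const \<alpha> n j * (M + A) * r powr (- real j)" if r: "0 < r" for j r
  proof -
    have "\<bar>poisson j r f x\<bar> \<le> subord_const j * r powr (- real j) * M" by (rule abs_poisson_le[OF r f])
    also have "\<dots> = subord_const j * M * r powr (- real j)" by simp
    also have "\<dots> \<le> profile_const \<alpha> n j * (M + A) * r powr (- real j)"
      using M A0 by (intro mult_right_mono mult_mono) (auto simp: profile_const_def subord_const_nonneg)
    finally show ?thesis .
  qed
  have 2: "\<bar>poisson j r f x\<bar> \<le> profile_const \<alpha> n j * (M + A) * r powr (\<alpha> - real j)" if j: "n \<le> j" and r: "0 < r" for j r
  proof -
    have r2: "0 < r / 2" using r by simp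
    have eb: "ess_bounded (A * (r / 2) powr (\<alpha> - real n)) (poisson n (r / 2) f)"
      using A r2 unfolding Lip_bound_iff[OF f] n_def by blast
    have "poisson j r f x = poisson (j - n) (r / 2) (poisson n (r / 2) f) x"
      using poisson_semigroup[OF r2 r2 f, of "j - n" n x] j by simp
    also have "\<bar>\<dots>\<bar> \<le> subord_const (j - n) * (r / 2) powr (- real (j - n)) * (A * (r / 2) powr (\<alpha> - real n))"
      by (rule abs_poisson_le[OF r2 eb])
    also have "\<dots> = subord_const (j - n) * A * ((r / 2) powr (- real (j - n)) * (r / 2) powr (\<alpha> - real n))" by simp
    also have "(r / 2) powr (- real (j - n)) * (r / 2) powr (\<alpha> - real n) = (r / 2) powr (\<alpha> - real j)"
      unfolding powr_add[symmetric] using j by (simp add: of_nat_diff)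
    also have "\<dots> = 2 powr (real j - \<alpha>) * r powr (\<alpha> - real j)"
      using r by (simp add: powr_divide powr_diff field_simps)
    finally have "\<bar>poisson j r f x\<bar> \<le> (subord_const (j - n) * 2 powr (real j - \<alpha>)) * A * r powr (\<alpha> - real j)" by (simp add: mult_ac)
    also have "\<dots> \<le> profile_const \<alpha> n j * (M + A) * r powr (\<alpha> - real j)"
      using M A0 by (intro mult_right_mono mult_mono) (auto simp: profile_const_def subord_const_nonneg)
    finally show ?thesis .
  qed
  show ?thesis unfolding lip_profile_def n_def[symmetric]
    using M A0 1 2 poisson_has_derivative[OF _ f] by auto
qed

text \<open>Since \<open>\<alpha> > 1\<close>, the first derivative in time is bounded near \<open>0\<close>; so \<open>P\<^sub>t f(x)\<close> is Lipschitz continuous in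
  \<open>t\<close> and converges at every \<open>x\<close>.\<close>
lemma poisson_AE_initial_value:
  assumes \<alpha>: "1 < \<alpha>" and f: "ess_bounded M f" and A: "Lip_bound \<alpha> f A"
  shows "AE x in lborel. (\<lambda>i. poisson 0 (1 / real (Suc i)) f x) \<longlonglongrightarrow> f x"
proof (rule poisson_AE_tendsto[OF _ _ f])
  let ?T = "\<lambda>i. 1 / real (Suc i)"
  show T0: "?T \<longlonglongrightarrow> 0" using LIMSEQ_inverse_real_of_nat by (simp add: inverse_eq_divide)
  show "0 < ?T i" for i by simp
  define L where "L = M + A"
  obtain C where C: "0 \<le> C" "\<And>L u r. lip_profile \<alpha> (least_above \<alpha>) (profile_const \<alpha> (least_above \<alpha>)) L u \<Longrightarrow> 0 < r \<Longrightarrow> r \<le> 1 \<Longrightarrow> \<bar>u 1 r\<bar> \<le> C * L * r powr (- 0)"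
    using lip_profile_near_zero[where \<alpha> = \<alpha> and n = "least_above \<alpha>" and c = "profile_const \<alpha> (least_above \<alpha>)" and b = 0 and j = 1]
      less_least_above[of \<alpha>] \<alpha> profile_const_nonneg by auto
  show "AE x in lborel. convergent (\<lambda>i. poisson 0 (?T i) f x)"
  proof (rule AE_I2)
    fix x
    have prof: "lip_profile \<alpha> (least_above \<alpha>) (profile_const \<alpha> (least_above \<alpha>)) L (\<lambda>j r. poisson j r f x)"
      unfolding L_def by (rule Lip_imp_lip_profile[OF f A])
    then have L: "0 \<le> L" by (simp add: lip_profile_def)
    have lip: "norm (poisson 0 a f x - poisson 0 b f x) \<le> (C * L) * norm (a - b)" if "a \<in> {0<..1}" "b \<in> {0<..1}" for a b
    proof (rule field_differentiable_bound[where S = "{0<..1}" and f = "\<lambda>r. poisson 0 r f x" and f' = "\<lambda>r. poisson 1 r f x"])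
      show "((\<lambda>r. poisson 0 r f x) has_real_derivative poisson 1 z f x) (at z within {0<..1})" if "z \<in> {0<..1}" for z
        using poisson_has_derivative[OF _ f, of z 0 x] that by (auto intro: has_field_derivative_at_within)
      show "norm (poisson 1 z f x) \<le> C * L" if "z \<in> {0<..1}" for z
        using C(2)[OF prof, of z] that by auto
    qed (use that in auto)
    have "Cauchy (\<lambda>i. poisson 0 (?T i) f x)"
    proof (rule metric_CauchyI)
      fix e :: real assume e: "0 < e"
      have "Cauchy ?T" using T0 by (rule LIMSEQ_imp_Cauchy)
      moreover have "0 < e / (C * L + 1)" using e C L by (simp add: add_nonneg_pos)
      ultimately obtain N where N: "\<And>i j. N \<le> i \<Longrightarrow> N \<le> j \<Longrightarrow> dist (?T i) (?T j) < e / (C * L + 1)"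
        using metric_CauchyD[of ?T "e / (C * L + 1)"] by blast
      show "\<exists>N. \<forall>i\<ge>N. \<forall>j\<ge>N. dist (poisson 0 (?T i) f x) (poisson 0 (?T j) f x) < e"
      proof (intro exI[of _ N] allI impI)
        fix i j assume ij: "N \<le> i" "N \<le> j"
        have "dist (poisson 0 (?T i) f x) (poisson 0 (?T j) f x) \<le> (C * L) * dist (?T i) (?T j)"
          unfolding dist_norm by (rule lip) auto
        also have "\<dots> \<le> (C * L + 1) * dist (?T i) (?T j)" by (intro mult_right_mono) auto
        also have "\<dots> < (C * L + 1) * (e / (C * L + 1))"
          using N[OF ij] C L by (intro mult_strict_left_mono) (auto simp: add_nonneg_pos)
        also have "\<dots> = e" using C L by (simp add: add_nonneg_pos less_imp_neq[symmetric])
        finally show "dist (poisson 0 (?T i) f x) (poisson 0 (?T j) f x) < e" .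
      qed
    qed
    then show "convergent (\<lambda>i. poisson 0 (?T i) f x)" by (simp add: Cauchy_convergent_iff)
  qed
qed

section \<open>Powers of the difference operators\<close>

text \<open>\<open>e\<^bsup>-\<kappa>s\<^esup> P\<^sub>s - I\<close>: \<open>\<kappa> = 0\<close> gives the Riesz and \<open>\<kappa> = 1\<close> the Bessel case.\<close>
definition frac_op :: "real \<Rightarrow> real \<Rightarrow> (real^'d::finite \<Rightarrow> real) \<Rightarrow> real^'d \<Rightarrow> real" where
  "frac_op \<kappa> s g y = exp (- \<kappa> * s) * PH s g y - g y"

text \<open>The case distinction records that the integral operator \<open>poisson 0 r\<close> represents \<open>P\<^sub>r\<close> only for \<open>r > 0\<close>; at
  \<open>r = 0\<close> the flow starts in \<open>f\<close>.\<close>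
definition damped_flow :: "real \<Rightarrow> (real^'d::finite \<Rightarrow> real) \<Rightarrow> real \<Rightarrow> real^'d \<Rightarrow> real" where
  "damped_flow \<kappa> f r y = exp (- \<kappa> * r) * (if r = 0 then f y else poisson 0 r f y)"

lemma frac_op_eq:
  assumes "0 < s" "ess_bounded M f"
  shows "frac_op \<kappa> s f = (\<lambda>y. exp (- \<kappa> * s) * poisson 0 s f y - f y)"
  using PH_eq_poisson[OF assms] by (auto simp: frac_op_def)

lemma ess_bounded_frac_op:
  assumes s: "0 < s" and \<kappa>: "0 \<le> \<kappa>" and f: "ess_bounded M f"
  shows "ess_bounded (2 * M) (frac_op \<kappa> s f)"
proof -
  have [measurable]: "f \<in> borel_measurable borel" using f by (rule ess_bounded_measurable)
  have "AE y in lborel. \<bar>f y\<bar> \<le> M" using f by (simp add: ess_bounded_def)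
  then have "AE y in lborel. \<bar>exp (- \<kappa> * s) * poisson 0 s f y - f y\<bar> \<le> 2 * M"
  proof eventually_elim
    fix y assume y: "\<bar>f y\<bar> \<le> M"
    have "\<bar>exp (- \<kappa> * s) * poisson 0 s f y\<bar> \<le> 1 * M"
      unfolding abs_mult using s \<kappa> by (intro mult_mono abs_poisson_0_le[OF s f]) auto
    then show "\<bar>exp (- \<kappa> * s) * poisson 0 s f y - f y\<bar> \<le> 2 * M" using y by linarith
  qed
  then show ?thesis unfolding frac_op_eq[OF s f] ess_bounded_def by simp
qed

text \<open>By the semigroup law \<open>e\<^bsup>-\<kappa>s\<^esup> P\<^sub>s\<close> shifts the time of the damped flow by \<open>s\<close>, so that \<open>e\<^bsup>-\<kappa>s\<^esup> P\<^sub>s - I\<close> is the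
  forward difference in time.\<close>
lemma frac_op_iter_eq_fwd_diff:
  assumes s: "0 < s" and \<kappa>: "0 \<le> \<kappa>" and f: "ess_bounded M f"
  shows "(frac_op \<kappa> s ^^ k) f x = (fwd_diff s ^^ k) (\<lambda>r. damped_flow \<kappa> f r x) 0"
  using f
proof (induction k arbitrary: f M)
  case 0 then show ?case by (simp add: damped_flow_def)
next
  case (Suc k)
  note f = Suc.prems
  have Ff: "ess_bounded (2 * M) (frac_op \<kappa> s f)" by (rule ess_bounded_frac_op[OF s \<kappa> f])
  have "(frac_op \<kappa> s ^^ Suc k) f x = (frac_op \<kappa> s ^^ k) (frac_op \<kappa> s f) x" by (simp add: funpow_swap1)
  also have "\<dots> = (fwd_diff s ^^ k) (\<lambda>r. damped_flow \<kappa> (frac_op \<kappa> s f) r x) 0" by (rule Suc.IH[OF Ff])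
  also have "\<dots> = (fwd_diff s ^^ k) (fwd_diff s (\<lambda>r. damped_flow \<kappa> f r x)) 0"
  proof (rule fwd_diff_iter_cong)
    fix r :: real assume r: "0 \<le> r"
    show "damped_flow \<kappa> (frac_op \<kappa> s f) r x = fwd_diff s (\<lambda>r. damped_flow \<kappa> f r x) r"
    proof (cases "r = 0")
      case True then show ?thesis using s by (simp add: damped_flow_def fwd_diff_def frac_op_eq[OF s f])
    next
      case False
      then have r: "0 < r" using r by simp
      have eq: "poisson 0 r (frac_op \<kappa> s f) x = exp (- \<kappa> * s) * poisson 0 (r + s) f x - poisson 0 r f x"
        unfolding frac_op_eq[OF s f] poisson_linear[OF r ess_bounded_poisson_0[OF s f] f] poisson_semigroup[OF r s f] by simp
      show ?thesis using r s by (simp add: damped_flow_def fwd_diff_def eq ring_distribs mult.assoc[symmetric] exp_add[symmetric])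
    qed
  qed (use s in auto)
  finally show ?case by (simp add: funpow_swap1)
qed

text \<open>The operators commute with \<open>\<partial>\<^sup>m P\<^sub>t / \<partial>t\<^sup>m\<close>, which moves the differences from the time \<open>0\<close> to the time
  \<open>t\<close>; the factor in front undoes the damping up to time \<open>t\<close>.\<close>
lemma poisson_frac_op_iter:
  assumes s: "0 < s" and \<kappa>: "0 \<le> \<kappa>" and f: "ess_bounded M f" and t: "0 < t"
  shows "poisson m t ((frac_op \<kappa> s ^^ k) f) x = exp (\<kappa> * t) * (fwd_diff s ^^ k) (\<lambda>r. exp (- \<kappa> * r) * poisson m r f x) t"
  using f
proof (induction k arbitrary: f M)
  case 0 then show ?case by (simp add: mult.assoc[symmetric] exp_add[symmetric])
next
  case (Suc k)
  note f = Suc.prems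
  have Ff: "ess_bounded (2 * M) (frac_op \<kappa> s f)" by (rule ess_bounded_frac_op[OF s \<kappa> f])
  have "poisson m t ((frac_op \<kappa> s ^^ Suc k) f) x = poisson m t ((frac_op \<kappa> s ^^ k) (frac_op \<kappa> s f)) x" by (simp add: funpow_swap1)
  also have "\<dots> = exp (\<kappa> * t) * (fwd_diff s ^^ k) (\<lambda>r. exp (- \<kappa> * r) * poisson m r (frac_op \<kappa> s f) x) t" by (rule Suc.IH[OF Ff])
  also have "(fwd_diff s ^^ k) (\<lambda>r. exp (- \<kappa> * r) * poisson m r (frac_op \<kappa> s f) x) t = (fwd_diff s ^^ k) (fwd_diff s (\<lambda>r. exp (- \<kappa> * r) * poisson m r f x)) t"
  proof (rule fwd_diff_iter_cong_pos)
    fix r :: real assume r: "0 < r"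
    have eq: "poisson m r (frac_op \<kappa> s f) x = exp (- \<kappa> * s) * poisson m (r + s) f x - poisson m r f x"
      unfolding frac_op_eq[OF s f] poisson_linear[OF r ess_bounded_poisson_0[OF s f] f] poisson_semigroup[OF r s f] by simp
    show "exp (- \<kappa> * r) * poisson m r (frac_op \<kappa> s f) x = fwd_diff s (\<lambda>r. exp (- \<kappa> * r) * poisson m r f x) r"
      by (simp add: fwd_diff_def eq ring_distribs mult.assoc[symmetric] exp_add[symmetric])
  qed (use s t in auto)
  finally show ?case by (simp add: funpow_swap1)
qed

text \<open>The common form of the two integrands, extended by \<open>0\<close> to \<open>s \<le> 0\<close>.  In terms of differences its joint
  measurability in \<open>s\<close> and \<open>y\<close> is evident.\<close>
definition frac_integrand :: "real \<Rightarrow> real \<Rightarrow> (real^'d::finite \<Rightarrow> real) \<Rightarrow> real \<Rightarrow> real^'d \<Rightarrow> real" where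
  "frac_integrand \<kappa> \<beta> f s y = indicator {0<..} s * (s powr (- \<beta> - 1) * (fwd_diff s ^^ least_above \<beta>) (\<lambda>r. damped_flow \<kappa> f r y) 0)"

definition frac_deriv :: "real \<Rightarrow> real \<Rightarrow> (real^'d::finite \<Rightarrow> real) \<Rightarrow> real^'d \<Rightarrow> real" where
  "frac_deriv \<kappa> \<beta> f y = 1 / frac_const \<beta> * (LINT s|lborel. frac_integrand \<kappa> \<beta> f s y)"

lemma frac_integrand_eq:
  assumes \<kappa>: "0 \<le> \<kappa>" and f: "ess_bounded M f"
  shows "frac_integrand \<kappa> \<beta> f s y = indicator {0<..} s * (s powr (- \<beta> - 1) * (frac_op \<kappa> s ^^ least_above \<beta>) f y)"
  unfolding frac_integrand_def using frac_op_iter_eq_fwd_diff[OF _ \<kappa> f, of s] by (cases "0 < s") auto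

lemma riesz_integrand_eq:
  assumes f: "ess_bounded M f"
  shows "indicator {0<..} s *\<^sub>R riesz_integrand \<beta> f y s = frac_integrand 0 \<beta> f s y"
proof -
  have eq: "(\<lambda>g y. PH s g y - g y) = frac_op 0 s" by (auto simp: frac_op_def fun_eq_iff)
  show ?thesis unfolding frac_integrand_eq[OF order_refl f] riesz_integrand_def eq by simp
qed

lemma bessel_integrand_eq:
  assumes f: "ess_bounded M f"
  shows "indicator {0<..} s *\<^sub>R bessel_integrand \<beta> f y s = frac_integrand 1 \<beta> f s y"
proof -
  have eq: "(\<lambda>g y. exp (- s) * PH s g y - g y) = frac_op 1 s" by (auto simp: frac_op_def fun_eq_iff)
  show ?thesis unfolding frac_integrand_eq[OF zero_le_one f] bessel_integrand_def eq by simp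
qed

lemma measurable_frac_integrand:
  assumes [measurable]: "f \<in> borel_measurable borel" "g \<in> borel_measurable N" "a \<in> borel_measurable N"
  shows "(\<lambda>z. frac_integrand \<kappa> \<beta> f (g z) (a z)) \<in> borel_measurable N"
proof -
  have "(\<lambda>(r, y). damped_flow \<kappa> f r y) \<in> borel_measurable (borel \<Otimes>\<^sub>M borel)"
    unfolding damped_flow_def by measurable
  from measurable_fwd_diff_iter[OF this assms(2,3), of "\<lambda>_. 0" "least_above \<beta>"]
  have [measurable]: "(\<lambda>z. (fwd_diff (g z) ^^ least_above \<beta>) (\<lambda>r. damped_flow \<kappa> f r (a z)) 0) \<in> borel_measurable N" by simp
  show ?thesis unfolding frac_integrand_def by measurable
qed

section \<open>Boundedness of the fractional derivatives\<close>

text \<open>The shape of all majorants in \<open>s\<close>: one power for the small and one for the large differences.\<close>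
definition two_power :: "real \<Rightarrow> real \<Rightarrow> real \<Rightarrow> real" where
  "two_power p q s = (if s \<le> 0 then 0 else if s \<le> 1 then s powr p else s powr q)"

lemma two_power_nonneg: "0 \<le> two_power p q s"
  by (simp add: two_power_def)

lemma integrable_two_power:
  assumes "- 1 < p" "q < - 1"
  shows "integrable lborel (two_power p q)"
proof -
  have m[measurable]: "two_power p q \<in> borel_measurable borel" unfolding two_power_def by measurable
  have 1: "((\<lambda>s. s powr p) has_integral 1 powr (p + 1) / (p + 1)) {0..1}"
    using assms by (intro has_integral_powr_from_0) auto
  have 2: "((\<lambda>s. s powr q) has_integral - (1 powr (q + 1)) / (q + 1)) {1..}"
    using assms by (intro has_integral_powr_to_inf) auto
  have i1: "integrable lebesgue (\<lambda>s. indicator {0..1} s *\<^sub>R s powr p)"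
    using nonnegative_absolutely_integrable_1[of "\<lambda>s. s powr p" "{0..1}"] 1 unfolding set_integrable_def by auto
  have i2: "integrable lebesgue (\<lambda>s. indicator {1..} s *\<^sub>R s powr q)"
    using nonnegative_absolutely_integrable_1[of "\<lambda>s. s powr q" "{1..}"] 2 unfolding set_integrable_def by auto
  have "integrable lebesgue (two_power p q)"
  proof (rule Bochner_Integration.integrable_bound[OF Bochner_Integration.integrable_add[OF i1 i2]])
    show "two_power p q \<in> borel_measurable lebesgue" using m by (simp add: measurable_completion)
    show "AE s in lebesgue. norm (two_power p q s) \<le> norm (indicator {0..1} s *\<^sub>R s powr p + indicator {1..} s *\<^sub>R s powr q)"
      by (auto simp: two_power_def indicator_def intro!: AE_I2)
  qed
  then show ?thesis using m by (subst (asm) integrable_completion) auto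
qed

lemma poisson_cmult: "poisson m t (\<lambda>y. a * f y) x = a * poisson m t f x"
proof -
  have "ou s (\<lambda>y. a * f y) x = a * ou s f x" for s
    unfolding ou_def by (simp add: mult.left_commute[of _ a])
  then show ?thesis unfolding poisson_def subordinate_def by (simp add: mult.left_commute[of _ a])
qed

lemma poisson_integral_commute:
  fixes F :: "real \<Rightarrow> real^'d::finite \<Rightarrow> real"
  assumes t: "0 < t" and F: "(\<lambda>(s, y). F s y) \<in> borel_measurable (borel \<Otimes>\<^sub>M borel)"
    and B: "integrable lborel B" and bound: "AE y in lborel. \<forall>s. \<bar>F s y\<bar> \<le> B s"
  shows "poisson m t (\<lambda>y. LINT s|lborel. F s y) x = (LINT s|lborel. poisson m t (F s) x)"
proof -
  note [measurable] = F
  have Fs: "ess_bounded (B s) (F s)" for s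
  proof -
    have "F s \<in> borel_measurable borel" by measurable
    moreover have "AE y in lborel. \<bar>F s y\<bar> \<le> B s" using bound by eventually_elim auto
    ultimately show ?thesis by (simp add: ess_bounded_def)
  qed
  have m: "(\<lambda>w. ou (fst w) (F (snd w)) x) \<in> borel_measurable (borel \<Otimes>\<^sub>M borel)"
    by (rule measurable_ou_family) measurable
  have "poisson m t (\<lambda>y. LINT s|lborel. F s y) x = subordinate m t (\<lambda>\<sigma>. LINT s|lborel. ou \<sigma> (F s) x)"
    unfolding poisson_def by (intro subordinate_cong ou_integral_commute(1)[OF _ F B bound])
  also have "\<dots> = (LINT \<sigma>|lborel. LINT s|lborel. subord_deriv m t \<sigma> * ou \<sigma> (F s) x)"
    by (simp add: subordinate_def)
  also have "\<dots> = (LINT s|lborel. LINT \<sigma>|lborel. subord_deriv m t \<sigma> * ou \<sigma> (F s) x)"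
  proof (rule swap_integrals(2))
    note [measurable] = m
    have "(\<lambda>w. subord_deriv m t (fst w) * ou (fst w) (F (snd w)) x) \<in> borel_measurable (borel \<Otimes>\<^sub>M borel)" by measurable
    then show "(\<lambda>(\<sigma>, s). subord_deriv m t \<sigma> * ou \<sigma> (F s) x) \<in> borel_measurable (borel \<Otimes>\<^sub>M borel)"
      by (simp add: case_prod_beta)
    show "integrable lborel (\<lambda>\<sigma>. \<bar>subord_deriv m t \<sigma> * 1\<bar> * (LINT s|lborel. B s))"
      by (intro integrable_mult_left integrable_abs integrable_subord_deriv_mult[OF t time_bounded_one])
    show "AE \<sigma> in lborel. integrable lborel (\<lambda>s. subord_deriv m t \<sigma> * ou \<sigma> (F s) x) \<and>
         (LINT s|lborel. \<bar>subord_deriv m t \<sigma> * ou \<sigma> (F s) x\<bar>) \<le> \<bar>subord_deriv m t \<sigma> * 1\<bar> * (LINT s|lborel. B s)"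
    proof (rule AE_I2)
      fix \<sigma> :: real
      show "integrable lborel (\<lambda>s. subord_deriv m t \<sigma> * ou \<sigma> (F s) x) \<and>
         (LINT s|lborel. \<bar>subord_deriv m t \<sigma> * ou \<sigma> (F s) x\<bar>) \<le> \<bar>subord_deriv m t \<sigma> * 1\<bar> * (LINT s|lborel. B s)"
      proof (cases "0 < \<sigma>")
        case True
        have i: "integrable lborel (\<lambda>s. ou \<sigma> (F s) x)" by (rule ou_integral_commute(2)[OF True F B bound])
        have "(LINT s|lborel. \<bar>ou \<sigma> (F s) x\<bar>) \<le> (LINT s|lborel. B s)"
          by (intro integral_mono integrable_abs i B abs_ou_le(1)[OF True Fs])
        then show ?thesis using i by (auto simp: abs_mult intro!: mult_left_mono)
      qed (simp add: subord_deriv_nonpos)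
    qed
  qed
  also have "\<dots> = (LINT s|lborel. poisson m t (F s) x)" by (simp add: poisson_def subordinate_def)
  finally show ?thesis .
qed

text \<open>For \<open>s > 1\<close> the difference is bounded because \<open>f\<close> is.  For \<open>s \<le> 1\<close> the bound for differences at \<open>r > 0\<close> is
  applied with \<open>k \<eta> = b\<close>, so that no power of \<open>r\<close> is left and \<open>r \<rightarrow> 0\<close> is possible; there the initial value
  enters, and with it the exceptional null set.\<close>
lemma frac_integrand_bound:
  fixes \<alpha> \<beta> \<kappa> :: real
  assumes \<beta>: "1 \<le> \<beta>" and \<alpha>: "\<beta> < \<alpha>" and \<kappa>: "\<kappa> = 0 \<or> \<kappa> = 1"
  obtains C p where "0 \<le> C" "- 1 < p"
    "\<And>(f :: real^'d::finite \<Rightarrow> real) M A. ess_bounded M f \<Longrightarrow> Lip_bound \<alpha> f A \<Longrightarrow>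
       AE x in lborel. \<forall>s. \<bar>frac_integrand \<kappa> \<beta> f s x\<bar> \<le> C * (M + A) * two_power p (- \<beta> - 1) s"
proof -
  define k where "k = least_above \<beta>"
  define n where "n = least_above \<alpha>"
  define c where "c = profile_const \<alpha> n"
  have \<kappa>0: "0 \<le> \<kappa>" using \<kappa> by auto
  have k: "\<beta> < real k" unfolding k_def by (rule less_least_above)
  \<comment> \<open>The midpoint of \<open>k - \<alpha>\<close>, which the regularity of \<open>f\<close> requires, and of \<open>k - \<beta>\<close>, which the integrability at \<open>s = 0\<close> requires.\<close>
  define b where "b = max 0 (((real k - \<alpha>) + (real k - \<beta>)) / 2)"
  have b: "0 \<le> b" "b < real k - \<beta>" "real k - \<alpha> < b" using k \<alpha> by (auto simp: b_def max_def)
  define \<eta> where "\<eta> = b / real k"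
  have \<eta>: "0 \<le> \<eta>" "\<eta> < 1" "real k * \<eta> = b" using b k \<beta> by (auto simp: \<eta>_def)
  have "\<exists>C\<ge>0. \<forall>L u s r. lip_profile \<alpha> n c L u \<longrightarrow> 0 < s \<longrightarrow> 0 < r \<longrightarrow>
            \<bar>(fwd_diff s ^^ k) (\<lambda>r. exp (-\<kappa> * r) * u 0 r) r\<bar>
               \<le> C * L * s powr (real k * (1 - \<eta>)) * r powr (-(b - real k * \<eta>))"
    by (rule lip_profile_fwd_diff_bound)
      (use b k \<beta> \<eta> \<kappa> in \<open>auto simp: n_def c_def profile_const_nonneg less_least_above\<close>)
  then obtain C where C: "0 \<le> C" "\<And>L u s r. lip_profile \<alpha> n c L u \<Longrightarrow> 0 < s \<Longrightarrow> 0 < r \<Longrightarrow>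
            \<bar>(fwd_diff s ^^ k) (\<lambda>r. exp (-\<kappa> * r) * u 0 r) r\<bar>
               \<le> C * L * s powr (real k * (1 - \<eta>)) * r powr (-(b - real k * \<eta>))"
    by blast
  have exps: "real k * (1 - \<eta>) = real k - b" using \<eta>(3) by (simp add: algebra_simps)
  show thesis
  proof (rule that[of "C + 2 ^ k" "real k - b - \<beta> - 1"])
    show "0 \<le> C + 2 ^ k" using C by simp
    show "- 1 < real k - b - \<beta> - 1" using b by simp
    fix f :: "real^'d \<Rightarrow> real" and M A
    assume f: "ess_bounded M f" and A: "Lip_bound \<alpha> f A"
    define L where "L = M + A"
    have M: "0 \<le> M" "M \<le> L" "0 \<le> L" using ess_bounded_nonneg[OF f] Lip_bound_nonneg[OF f A] by (auto simp: L_def)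
    have AEf: "AE x in lborel. \<bar>f x\<bar> \<le> M" using f by (simp add: ess_bounded_def)
    have AEi: "AE x in lborel. (\<lambda>i. poisson 0 (1 / real (Suc i)) f x) \<longlonglongrightarrow> f x"
      using \<alpha> \<beta> by (intro poisson_AE_initial_value[OF _ f A]) auto
    show "AE x in lborel. \<forall>s. \<bar>frac_integrand \<kappa> \<beta> f s x\<bar> \<le> (C + 2 ^ k) * (M + A) * two_power (real k - b - \<beta> - 1) (- \<beta> - 1) s"
      using AEf AEi
    proof eventually_elim
      fix x assume fx: "\<bar>f x\<bar> \<le> M" and lim: "(\<lambda>i. poisson 0 (1 / real (Suc i)) f x) \<longlonglongrightarrow> f x"
      let ?w = "\<lambda>r. damped_flow \<kappa> f r x"
      have prof: "lip_profile \<alpha> n c L (\<lambda>j r. poisson j r f x)"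
        unfolding L_def n_def c_def by (rule Lip_imp_lip_profile[OF f A])
      have T0: "(\<lambda>i. 1 / real (Suc i)) \<longlonglongrightarrow> 0" using LIMSEQ_inverse_real_of_nat by (simp add: inverse_eq_divide)
      have wb: "\<bar>?w r\<bar> \<le> M" if r: "0 \<le> r" for r
      proof -
        have "\<bar>if r = 0 then f x else poisson 0 r f x\<bar> \<le> M" using fx r abs_poisson_0_le[OF _ f, of r x] by auto
        then have "\<bar>?w r\<bar> \<le> 1 * M" unfolding damped_flow_def abs_mult using r \<kappa>0 by (intro mult_mono) auto
        then show ?thesis by simp
      qed
      have wlim: "(\<lambda>i. ?w (r + 1 / real (Suc i))) \<longlonglongrightarrow> ?w r" if r: "0 \<le> r" for r
      proof (cases "r = 0")
        case True
        have "(\<lambda>i. exp (- \<kappa> * (1 / real (Suc i))) * poisson 0 (1 / real (Suc i)) f x) \<longlonglongrightarrow> exp (- \<kappa> * 0) * f x"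
          by (intro tendsto_intros T0 lim)
        then show ?thesis using True by (simp add: damped_flow_def)
      next
        case False
        then have r: "0 < r" using r by simp
        have "isCont (\<lambda>r. exp (- \<kappa> * r) * poisson 0 r f x) r"
          using DERIV_isCont[OF poisson_has_derivative[OF r f, of 0 x]] by (intro continuous_intros)
        moreover have "(\<lambda>i. r + 1 / real (Suc i)) \<longlonglongrightarrow> r + 0" by (intro tendsto_intros T0)
        ultimately have "(\<lambda>i. exp (- \<kappa> * (r + 1 / real (Suc i))) * poisson 0 (r + 1 / real (Suc i)) f x) \<longlonglongrightarrow> exp (- \<kappa> * r) * poisson 0 r f x"
          by (intro isCont_tendsto_compose[of r "\<lambda>r. exp (- \<kappa> * r) * poisson 0 r f x"]) auto
        moreover have "r + 1 / real (Suc i) \<noteq> 0" for i using r by (intro less_imp_neq[symmetric] add_pos_pos) auto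
        ultimately show ?thesis using r unfolding damped_flow_def by simp
      qed
      show "\<forall>s. \<bar>frac_integrand \<kappa> \<beta> f s x\<bar> \<le> (C + 2 ^ k) * (M + A) * two_power (real k - b - \<beta> - 1) (- \<beta> - 1) s"
      proof
        fix s :: real
        consider "s \<le> 0" | "0 < s" "s \<le> 1" | "1 < s" by linarith
        then show "\<bar>frac_integrand \<kappa> \<beta> f s x\<bar> \<le> (C + 2 ^ k) * (M + A) * two_power (real k - b - \<beta> - 1) (- \<beta> - 1) s"
        proof cases
          case 1 then show ?thesis by (simp add: frac_integrand_def two_power_def)
        next
          case 2
          have "(\<lambda>i. (fwd_diff s ^^ k) ?w (0 + 1 / real (Suc i))) \<longlonglongrightarrow> (fwd_diff s ^^ k) ?w 0"
            using 2 by (intro tendsto_fwd_diff_iter wlim) auto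
          then have "(\<lambda>i. \<bar>(fwd_diff s ^^ k) ?w (0 + 1 / real (Suc i))\<bar>) \<longlonglongrightarrow> \<bar>(fwd_diff s ^^ k) ?w 0\<bar>"
            by (rule tendsto_rabs)
          moreover have "\<bar>(fwd_diff s ^^ k) ?w (0 + 1 / real (Suc i))\<bar> \<le> C * L * s powr (real k - b)" for i
          proof -
            have "(fwd_diff s ^^ k) ?w (1 / real (Suc i)) = (fwd_diff s ^^ k) (\<lambda>r. exp (-\<kappa> * r) * poisson 0 r f x) (1 / real (Suc i))"
              using 2 by (intro fwd_diff_iter_cong_pos) (auto simp: damped_flow_def)
            then show ?thesis using C(2)[OF prof 2(1), of "1 / real (Suc i)"] \<eta>(3) by (simp add: exps)
          qed
          ultimately have fd: "\<bar>(fwd_diff s ^^ k) ?w 0\<bar> \<le> C * L * s powr (real k - b)"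
            by (intro LIMSEQ_le_const2) auto
          have "\<bar>frac_integrand \<kappa> \<beta> f s x\<bar> = s powr (- \<beta> - 1) * \<bar>(fwd_diff s ^^ k) ?w 0\<bar>"
            using 2 by (simp add: frac_integrand_def abs_mult k_def)
          also have "\<dots> \<le> s powr (- \<beta> - 1) * (C * L * s powr (real k - b))" using fd by (intro mult_left_mono) auto
          also have "\<dots> = C * L * (s powr (- \<beta> - 1) * s powr (real k - b))" by simp
          also have "s powr (- \<beta> - 1) * s powr (real k - b) = s powr (real k - b - \<beta> - 1)"
            unfolding powr_add[symmetric] by (simp add: algebra_simps)
          also have "C * L * s powr (real k - b - \<beta> - 1) \<le> (C + 2 ^ k) * L * s powr (real k - b - \<beta> - 1)"
            using M C by (intro mult_right_mono) auto
          finally show ?thesis using 2 by (simp add: two_power_def L_def)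
        next
          case 3
          have fd: "\<bar>(fwd_diff s ^^ k) ?w 0\<bar> \<le> 2 ^ k * M" using 3 by (intro fwd_diff_iter_le wb) auto
          have "\<bar>frac_integrand \<kappa> \<beta> f s x\<bar> = s powr (- \<beta> - 1) * \<bar>(fwd_diff s ^^ k) ?w 0\<bar>"
            using 3 by (simp add: frac_integrand_def abs_mult k_def)
          also have "\<dots> \<le> s powr (- \<beta> - 1) * (2 ^ k * M)" using fd by (intro mult_left_mono) auto
          also have "\<dots> = 2 ^ k * M * s powr (- \<beta> - 1)" by simp
          also have "\<dots> \<le> (C + 2 ^ k) * L * s powr (- \<beta> - 1)"
            using M C by (intro mult_right_mono mult_mono) auto
          finally show ?thesis using 3 by (simp add: two_power_def L_def)
        qed
      qed
    qed
  qed
qed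

text \<open>The differences are taken of a function whose \<open>k\<close>-th derivative is \<open>O(r\<^bsup>-\<gamma>\<^esup>)\<close> with \<open>\<gamma> = m + k - \<alpha>\<close>.  For
  \<open>s \<le> t\<close> the bound \<open>s\<^sup>k t\<^bsup>-\<gamma>\<^esup>\<close> is used, for \<open>s > t\<close> the bound \<open>s\<^bsup>k-g\<^esup> t\<^bsup>g-\<gamma>\<^esup>\<close>.  The two have the same degree of
  homogeneity in \<open>(s, t)\<close>, so the majorant depends on \<open>s / t\<close> only, up to a power of \<open>t\<close>.\<close>
lemma poisson_frac_integrand_bound:
  fixes \<alpha> \<beta> \<kappa> :: real
  assumes \<beta>: "1 \<le> \<beta>" and \<alpha>: "\<beta> < \<alpha>" and \<kappa>: "\<kappa> = 0 \<or> \<kappa> = 1"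
    and m: "m = least_above (\<alpha> - \<beta>)"
  obtains C p q where "0 \<le> C" "- 1 < p" "q < - 1"
    "\<And>(f :: real^'d::finite \<Rightarrow> real) M A t x s. ess_bounded M f \<Longrightarrow> Lip_bound \<alpha> f A \<Longrightarrow> 0 < t \<Longrightarrow> t \<le> 1 \<Longrightarrow>
       \<bar>poisson m t (frac_integrand \<kappa> \<beta> f s) x\<bar> \<le> C * (M + A) * t powr (\<alpha> - \<beta> - real m - 1) * two_power p q (s / t)"
proof -
  define k where "k = least_above \<beta>"
  define n where "n = least_above \<alpha>"
  define c where "c = profile_const \<alpha> n"
  have \<kappa>0: "0 \<le> \<kappa>" "\<kappa> \<le> 1" using \<kappa> by auto
  have k: "\<beta> < real k" unfolding k_def by (rule less_least_above)
  have mm: "\<alpha> - \<beta> < real m" unfolding m by (rule less_least_above)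
  have nmk: "n \<le> m + k" unfolding n_def using k mm by (intro least_above_le) auto
  define \<gamma> where "\<gamma> = real (m + k) - \<alpha>"
  have \<gamma>: "0 \<le> \<gamma>" "\<gamma> \<le> real (m + k)" "real k - \<beta> < \<gamma>" using k mm \<alpha> \<beta> by (auto simp: \<gamma>_def)
  \<comment> \<open>Integrability at \<open>s = \<infinity>\<close> needs \<open>g > k - \<beta>\<close>, the bound for differences needs \<open>g < k\<close> and \<open>g \<le> \<gamma>\<close>.\<close>
  define g where "g = ((real k - \<beta>) + min (real k) \<gamma>) / 2"
  have g: "real k - \<beta> < g" "g < real k" "g \<le> \<gamma>" "0 < g" using \<gamma> k \<beta> by (auto simp: g_def min_def)
  have kpos: "0 < real k" using k \<beta> by linarith
  define \<eta> where "\<eta> = g / real k"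
  have \<eta>: "0 \<le> \<eta>" "\<eta> < 1" "real k * \<eta> = g" using g kpos by (auto simp: \<eta>_def)
  have "\<exists>C\<ge>0. \<forall>L u s r. lip_profile \<alpha> n c L u \<longrightarrow> 0 < s \<longrightarrow> 0 < r \<longrightarrow>
            \<bar>(fwd_diff s ^^ k) (\<lambda>r. exp (-\<kappa> * r) * u m r) r\<bar>
               \<le> C * L * s powr (real k * (1 - 0)) * r powr (-(\<gamma> - real k * 0))"
    by (rule lip_profile_fwd_diff_bound)
      (use \<gamma> nmk \<kappa> in \<open>auto simp: n_def c_def profile_const_nonneg less_least_above \<gamma>_def\<close>)
  then obtain C1 where C1: "0 \<le> C1" "\<And>L u s r. lip_profile \<alpha> n c L u \<Longrightarrow> 0 < s \<Longrightarrow> 0 < r \<Longrightarrow>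
            \<bar>(fwd_diff s ^^ k) (\<lambda>r. exp (-\<kappa> * r) * u m r) r\<bar> \<le> C1 * L * s powr real k * r powr (-\<gamma>)"
    by auto
  have "\<exists>C\<ge>0. \<forall>L u s r. lip_profile \<alpha> n c L u \<longrightarrow> 0 < s \<longrightarrow> 0 < r \<longrightarrow>
            \<bar>(fwd_diff s ^^ k) (\<lambda>r. exp (-\<kappa> * r) * u m r) r\<bar>
               \<le> C * L * s powr (real k * (1 - \<eta>)) * r powr (-(\<gamma> - real k * \<eta>))"
    by (rule lip_profile_fwd_diff_bound)
      (use \<gamma> g \<eta> nmk \<kappa> in \<open>auto simp: n_def c_def profile_const_nonneg less_least_above \<gamma>_def\<close>)
  moreover have "real k * (1 - \<eta>) = real k - g" using \<eta>(3) by (simp add: algebra_simps)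
  ultimately obtain C2 where C2: "0 \<le> C2" "\<And>L u s r. lip_profile \<alpha> n c L u \<Longrightarrow> 0 < s \<Longrightarrow> 0 < r \<Longrightarrow>
            \<bar>(fwd_diff s ^^ k) (\<lambda>r. exp (-\<kappa> * r) * u m r) r\<bar> \<le> C2 * L * s powr (real k - g) * r powr (-(\<gamma> - g))"
    unfolding \<eta>(3) by auto
  let ?p = "real k - \<beta> - 1" and ?q = "real k - g - \<beta> - 1"
  show thesis
  proof (rule that[of "exp 1 * (C1 + C2)" ?p ?q])
    show "0 \<le> exp 1 * (C1 + C2)" using C1 C2 by simp
    show "- 1 < ?p" using k by simp
    show "?q < - 1" using g by simp
    fix f :: "real^'d \<Rightarrow> real" and M A t s :: real and x
    assume f: "ess_bounded M f" and A: "Lip_bound \<alpha> f A" and t: "0 < t" "t \<le> 1"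
    define L where "L = M + A"
    have L: "0 \<le> L" using ess_bounded_nonneg[OF f] Lip_bound_nonneg[OF f A] by (auto simp: L_def)
    have prof: "lip_profile \<alpha> n c L (\<lambda>j r. poisson j r f x)"
      unfolding L_def n_def c_def by (rule Lip_imp_lip_profile[OF f A])
    show "\<bar>poisson m t (frac_integrand \<kappa> \<beta> f s) x\<bar> \<le> exp 1 * (C1 + C2) * (M + A) * t powr (\<alpha> - \<beta> - real m - 1) * two_power ?p ?q (s / t)"
    proof (cases "0 < s")
      case False
      then have z: "frac_integrand \<kappa> \<beta> f s = (\<lambda>y. 0 * f y)" by (auto simp: frac_integrand_def)
      have "poisson m t (frac_integrand \<kappa> \<beta> f s) x = 0" unfolding z poisson_cmult by simp
      then show ?thesis using C1 C2 L by (simp add: two_power_nonneg L_def)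
    next
      case s: True
      define D where "D = (fwd_diff s ^^ k) (\<lambda>r. exp (-\<kappa> * r) * poisson m r f x) t"
      have D1: "\<bar>D\<bar> \<le> C1 * L * s powr real k * t powr (-\<gamma>)" unfolding D_def by (rule C1(2)[OF prof s t(1)])
      have D2: "\<bar>D\<bar> \<le> C2 * L * s powr (real k - g) * t powr (-(\<gamma> - g))" unfolding D_def by (rule C2(2)[OF prof s t(1)])
      have st: "s powr a * t powr b = t powr (a + b) * (s / t) powr a" for a b
        using s t by (simp add: powr_divide powr_add)
      have st0: "\<not> s / t \<le> 0" using divide_pos_pos[OF s t(1)] by linarith
      have "frac_integrand \<kappa> \<beta> f s = (\<lambda>y. s powr (- \<beta> - 1) * (frac_op \<kappa> s ^^ k) f y)"
        using s by (auto simp: frac_integrand_eq[OF \<kappa>0(1) f] k_def)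
      then have "poisson m t (frac_integrand \<kappa> \<beta> f s) x = s powr (- \<beta> - 1) * (exp (\<kappa> * t) * D)"
        by (simp only: poisson_cmult poisson_frac_op_iter[OF s \<kappa>0(1) f t(1)] D_def)
      then have "\<bar>poisson m t (frac_integrand \<kappa> \<beta> f s) x\<bar> = exp (\<kappa> * t) * (s powr (- \<beta> - 1) * \<bar>D\<bar>)"
        by (simp add: abs_mult)
      also have "\<dots> \<le> exp 1 * (s powr (- \<beta> - 1) * \<bar>D\<bar>)"
        using \<kappa>0 t by (intro mult_right_mono) (auto intro: mult_le_one)
      also have "s powr (- \<beta> - 1) * \<bar>D\<bar> \<le> (C1 + C2) * L * (t powr (\<alpha> - \<beta> - real m - 1) * two_power ?p ?q (s / t))"
      proof (cases "s \<le> t")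
        case True
        have "s powr (- \<beta> - 1) * \<bar>D\<bar> \<le> s powr (- \<beta> - 1) * (C1 * L * s powr real k * t powr (-\<gamma>))"
          using D1 by (intro mult_left_mono) auto
        also have "\<dots> = C1 * L * ((s powr (- \<beta> - 1) * s powr real k) * t powr (-\<gamma>))" by simp
        also have "s powr (- \<beta> - 1) * s powr real k = s powr ?p" unfolding powr_add[symmetric] by (simp add: algebra_simps)
        also have "s powr ?p * t powr (-\<gamma>) = t powr (\<alpha> - \<beta> - real m - 1) * two_power ?p ?q (s / t)"
          unfolding st using st0 True s t by (simp add: two_power_def \<gamma>_def algebra_simps)
        also have "C1 * L * \<dots> \<le> (C1 + C2) * L * (t powr (\<alpha> - \<beta> - real m - 1) * two_power ?p ?q (s / t))"
          using C2 L by (intro mult_right_mono) (auto simp: two_power_nonneg)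
        finally show ?thesis .
      next
        case False
        have "s powr (- \<beta> - 1) * \<bar>D\<bar> \<le> s powr (- \<beta> - 1) * (C2 * L * s powr (real k - g) * t powr (-(\<gamma> - g)))"
          using D2 by (intro mult_left_mono) auto
        also have "\<dots> = C2 * L * ((s powr (- \<beta> - 1) * s powr (real k - g)) * t powr (-(\<gamma> - g)))" by simp
        also have "s powr (- \<beta> - 1) * s powr (real k - g) = s powr ?q" unfolding powr_add[symmetric] by (simp add: algebra_simps)
        also have "s powr ?q * t powr (-(\<gamma> - g)) = t powr (\<alpha> - \<beta> - real m - 1) * two_power ?p ?q (s / t)"
          unfolding st using st0 False s t by (simp add: two_power_def \<gamma>_def algebra_simps)
        also have "C2 * L * \<dots> \<le> (C1 + C2) * L * (t powr (\<alpha> - \<beta> - real m - 1) * two_power ?p ?q (s / t))"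
          using C1 L by (intro mult_right_mono) (auto simp: two_power_nonneg)
        finally show ?thesis .
      qed
      finally show ?thesis by (simp add: L_def mult.assoc)
    qed
  qed
qed

text \<open>Integrating the two majorants in \<open>s\<close> gives the sup norm bound and, for \<open>t \<le> 1\<close>, the Lipschitz bound; the
  scaling \<open>s \<mapsto> s / t\<close> produces the exponent \<open>\<alpha> - \<beta> - m\<close>.  For \<open>t > 1\<close> the Lipschitz bound holds for every bounded
  function, because \<open>\<partial>\<^sup>m P\<^sub>t / \<partial>t\<^sup>m\<close> has norm \<open>O(t\<^bsup>-m\<^esup>)\<close> and \<open>\<alpha> > \<beta>\<close>.\<close>
lemma frac_deriv_Lip_estimate:
  fixes \<alpha> \<beta> \<kappa> :: real
  assumes \<beta>: "1 \<le> \<beta>" and \<alpha>: "\<beta> < \<alpha>" and \<kappa>: "\<kappa> = 0 \<or> \<kappa> = 1"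
  obtains C where "0 \<le> C"
    "\<And>(f :: real^'d::finite \<Rightarrow> real) M A. ess_bounded M f \<Longrightarrow> Lip_bound \<alpha> f A \<Longrightarrow>
       (AE x in lborel. integrable lborel (\<lambda>s. frac_integrand \<kappa> \<beta> f s x)) \<and>
       ess_bounded (C * (M + A)) (frac_deriv \<kappa> \<beta> f) \<and> Lip_bound (\<alpha> - \<beta>) (frac_deriv \<kappa> \<beta> f) (C * (M + A))"
proof -
  define m where "m = least_above (\<alpha> - \<beta>)"
  obtain C0 p0 where C0: "0 \<le> C0" "- 1 < p0"
    "\<And>(f :: real^'d \<Rightarrow> real) M A. ess_bounded M f \<Longrightarrow> Lip_bound \<alpha> f A \<Longrightarrow>
       AE x in lborel. \<forall>s. \<bar>frac_integrand \<kappa> \<beta> f s x\<bar> \<le> C0 * (M + A) * two_power p0 (- \<beta> - 1) s"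
    using frac_integrand_bound[OF \<beta> \<alpha> \<kappa>] by blast
  obtain C1 p q where C1: "0 \<le> C1" "- 1 < p" "q < - 1"
    "\<And>(f :: real^'d \<Rightarrow> real) M A t x s. ess_bounded M f \<Longrightarrow> Lip_bound \<alpha> f A \<Longrightarrow> 0 < t \<Longrightarrow> t \<le> 1 \<Longrightarrow>
       \<bar>poisson m t (frac_integrand \<kappa> \<beta> f s) x\<bar> \<le> C1 * (M + A) * t powr (\<alpha> - \<beta> - real m - 1) * two_power p q (s / t)"
    using poisson_frac_integrand_bound[OF \<beta> \<alpha> \<kappa> m_def] by blast
  define J0 where "J0 = (LINT s|lborel. two_power p0 (- \<beta> - 1) s)"
  define J1 where "J1 = (LINT s|lborel. two_power p q s)"
  have int0: "integrable lborel (two_power p0 (- \<beta> - 1))" using C0 \<beta> by (intro integrable_two_power) auto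
  have int1: "integrable lborel (two_power p q)" using C1 by (intro integrable_two_power) auto
  have J: "0 \<le> J0" "0 \<le> J1" unfolding J0_def J1_def by (auto intro!: integral_nonneg_AE simp: two_power_nonneg)
  define a where "a = \<bar>1 / frac_const \<beta>\<bar>"
  define CS where "CS = a * C0 * J0"
  have CS: "0 \<le> CS" using C0 J by (simp add: CS_def a_def)
  define C where "C = CS + a * C1 * J1 + subord_const m * CS"
  have C: "0 \<le> C" "CS \<le> C" "a * C1 * J1 \<le> C" "subord_const m * CS \<le> C"
    using CS C1 J subord_const_nonneg[of m] by (auto simp: C_def a_def)
  show thesis
  proof (rule that[OF C(1)])
    fix f :: "real^'d \<Rightarrow> real" and M A
    assume f: "ess_bounded M f" and A: "Lip_bound \<alpha> f A"
    have [measurable]: "f \<in> borel_measurable borel" using f by (rule ess_bounded_measurable)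
    note [measurable] = measurable_frac_integrand[of f]
    define L where "L = M + A"
    have L: "0 \<le> L" using ess_bounded_nonneg[OF f] Lip_bound_nonneg[OF f A] by (auto simp: L_def)
    let ?F = "frac_integrand \<kappa> \<beta> f"
    let ?B = "\<lambda>s. C0 * L * two_power p0 (- \<beta> - 1) s"
    have B: "integrable lborel ?B" by (intro integrable_mult_right int0)
    have bound: "AE x in lborel. \<forall>s. \<bar>?F s x\<bar> \<le> ?B s" unfolding L_def by (rule C0(3)[OF f A])
    have Fm: "(\<lambda>(s, y). ?F s y) \<in> borel_measurable (borel \<Otimes>\<^sub>M borel)" by measurable
    have int: "integrable lborel (\<lambda>s. ?F s x) \<and> \<bar>LINT s|lborel. ?F s x\<bar> \<le> C0 * L * J0" if x: "\<forall>s. \<bar>?F s x\<bar> \<le> ?B s" for x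
    proof -
      have i: "integrable lborel (\<lambda>s. ?F s x)"
      proof (rule Bochner_Integration.integrable_bound[OF B])
        show "(\<lambda>s. ?F s x) \<in> borel_measurable lborel" by measurable
        show "AE s in lborel. norm (?F s x) \<le> norm (?B s)" using x by (auto intro!: AE_I2 intro: order_trans[OF _ abs_ge_self])
      qed
      have "\<bar>LINT s|lborel. ?F s x\<bar> \<le> (LINT s|lborel. \<bar>?F s x\<bar>)" by (rule integral_abs_bound)
      also have "\<dots> \<le> (LINT s|lborel. ?B s)" using x by (intro integral_mono integrable_abs i B) auto
      also have "\<dots> = C0 * L * J0" by (simp add: J0_def)
      finally show ?thesis using i by simp
    qed
    have 1: "AE x in lborel. integrable lborel (\<lambda>s. ?F s x)" using bound by eventually_elim (use int in blast)
    have Dm: "frac_deriv \<kappa> \<beta> f \<in> borel_measurable borel"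
    proof -
      have "(\<lambda>y. LINT s|lborel. ?F s y) \<in> borel_measurable borel"
        by (rule borel_measurable_parametric_integral) measurable
      then show ?thesis unfolding frac_deriv_def[abs_def] by measurable
    qed
    have D: "ess_bounded (CS * L) (frac_deriv \<kappa> \<beta> f)"
    proof -
      have "AE x in lborel. \<bar>frac_deriv \<kappa> \<beta> f x\<bar> \<le> CS * L"
        using bound
      proof eventually_elim
        fix x assume "\<forall>s. \<bar>?F s x\<bar> \<le> ?B s"
        from int[OF this] have "a * \<bar>LINT s|lborel. ?F s x\<bar> \<le> a * (C0 * L * J0)" by (intro mult_left_mono) (auto simp: a_def)
        then show "\<bar>frac_deriv \<kappa> \<beta> f x\<bar> \<le> CS * L" by (simp add: frac_deriv_def abs_mult a_def CS_def mult_ac)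
      qed
      then show ?thesis using Dm by (simp add: ess_bounded_def)
    qed
    have mono: "ess_bounded b g" if "ess_bounded a g" "a \<le> b" for a b and g :: "real^'d \<Rightarrow> real"
      using that unfolding ess_bounded_def by (auto elim!: eventually_mono)
    have "ess_bounded (C * L) (frac_deriv \<kappa> \<beta> f)" using C L by (intro mono[OF D] mult_right_mono) auto
    moreover have "Lip_bound (\<alpha> - \<beta>) (frac_deriv \<kappa> \<beta> f) (C * L)"
      unfolding Lip_bound_iff[OF D] m_def[symmetric]
    proof (intro allI impI)
      fix t :: real assume t: "0 < t"
      have pm: "poisson m t (frac_deriv \<kappa> \<beta> f) \<in> borel_measurable borel"
        using ess_bounded_poisson[OF t D] by (rule ess_bounded_measurable)
      have "\<bar>poisson m t (frac_deriv \<kappa> \<beta> f) x\<bar> \<le> C * L * t powr (\<alpha> - \<beta> - real m)" for x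
      proof (cases "t \<le> 1")
        case True
        have "poisson m t (frac_deriv \<kappa> \<beta> f) x = 1 / frac_const \<beta> * poisson m t (\<lambda>y. LINT s|lborel. ?F s y) x"
          unfolding frac_deriv_def[abs_def] by (rule poisson_cmult)
        also have "poisson m t (\<lambda>y. LINT s|lborel. ?F s y) x = (LINT s|lborel. poisson m t (?F s) x)"
          by (rule poisson_integral_commute[OF t Fm B bound])
        finally have eq: "\<bar>poisson m t (frac_deriv \<kappa> \<beta> f) x\<bar> = a * \<bar>LINT s|lborel. poisson m t (?F s) x\<bar>"
          by (simp add: abs_mult a_def)
        let ?G = "\<lambda>s. C1 * L * t powr (\<alpha> - \<beta> - real m - 1) * two_power p q (s / t)"
        have it: "integrable lborel (\<lambda>s. two_power p q (s / t))" "(LINT s|lborel. two_power p q (s / t)) = t * J1"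
        proof -
          show "integrable lborel (\<lambda>s. two_power p q (s / t))"
            using lborel_integrable_real_affine[OF int1, of "1 / t" 0] t by simp
          show "(LINT s|lborel. two_power p q (s / t)) = t * J1"
            using lborel_integral_real_affine[of "1 / t" "two_power p q" 0] t by (simp add: J1_def)
        qed
        have "\<bar>LINT s|lborel. poisson m t (?F s) x\<bar> \<le> (LINT s|lborel. ?G s)"
        proof -
          have i: "integrable lborel ?G" by (intro integrable_mult_right it)
          have le: "\<bar>poisson m t (?F s) x\<bar> \<le> ?G s" for s using C1(4)[OF f A t True] by (simp add: L_def)
          show ?thesis
          proof (cases "integrable lborel (\<lambda>s. poisson m t (?F s) x)")
            case True
            have "\<bar>LINT s|lborel. poisson m t (?F s) x\<bar> \<le> (LINT s|lborel. \<bar>poisson m t (?F s) x\<bar>)" by (rule integral_abs_bound)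
            also have "\<dots> \<le> (LINT s|lborel. ?G s)" using le by (intro integral_mono integrable_abs True i) auto
            finally show ?thesis .
          next
            case False
            then show ?thesis using C1(1) L t J by (simp add: not_integrable_integral_eq it)
          qed
        qed
        also have "\<dots> = C1 * J1 * L * (t powr (\<alpha> - \<beta> - real m - 1) * t)" by (simp add: it)
        also have "t powr (\<alpha> - \<beta> - real m - 1) * t = t powr (\<alpha> - \<beta> - real m)"
          using t powr_add[of t "\<alpha> - \<beta> - real m - 1" 1] by simp
        finally have "a * \<bar>LINT s|lborel. poisson m t (?F s) x\<bar> \<le> a * (C1 * J1 * L * t powr (\<alpha> - \<beta> - real m))"
          by (intro mult_left_mono) (auto simp: a_def)
        also have "\<dots> = (a * C1 * J1) * L * t powr (\<alpha> - \<beta> - real m)" by simp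
        also have "\<dots> \<le> C * L * t powr (\<alpha> - \<beta> - real m)" using C L by (intro mult_right_mono) auto
        finally show ?thesis unfolding eq .
      next
        case False
        have "\<bar>poisson m t (frac_deriv \<kappa> \<beta> f) x\<bar> \<le> subord_const m * t powr (- real m) * (CS * L)"
          by (rule abs_poisson_le[OF t D])
        also have "\<dots> = (subord_const m * CS) * L * t powr (- real m)" by simp
        also have "\<dots> \<le> C * L * t powr (\<alpha> - \<beta> - real m)"
          using False C L \<alpha> by (intro mult_mono powr_mono) auto
        finally show ?thesis .
      qed
      then show "ess_bounded (C * L * t powr (\<alpha> - \<beta> - real m)) (poisson m t (frac_deriv \<kappa> \<beta> f))"
        using pm by (simp add: ess_bounded_def)
    qed
    ultimately show "(AE x in lborel. integrable lborel (\<lambda>s. ?F s x)) \<and>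
       ess_bounded (C * (M + A)) (frac_deriv \<kappa> \<beta> f) \<and> Lip_bound (\<alpha> - \<beta>) (frac_deriv \<kappa> \<beta> f) (C * (M + A))"
      using 1 unfolding L_def by blast
  qed
qed

lemma frac_deriv_bounded_Lip:
  fixes \<alpha> \<beta> \<kappa> :: real
    and S :: "(real^'d::finite \<Rightarrow> real) \<Rightarrow> real^'d \<Rightarrow> real"
    and I :: "(real^'d::finite \<Rightarrow> real) \<Rightarrow> real^'d \<Rightarrow> real \<Rightarrow> real"
  assumes \<beta>: "1 \<le> \<beta>" and \<alpha>: "\<beta> < \<alpha>" and \<kappa>: "\<kappa> = 0 \<or> \<kappa> = 1"
    and I: "\<And>f M s y. ess_bounded M f \<Longrightarrow> indicator {0<..} s *\<^sub>R I f y s = frac_integrand \<kappa> \<beta> f s y"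
    and S: "\<And>f y. S f y = 1 / frac_const \<beta> * (LINT s:{0<..}|lborel. I f y s)"
  shows "well_defined_on (Lip \<alpha>) I \<and> bounded_Lip \<alpha> (\<alpha> - \<beta>) S"
proof -
  obtain C where C: "0 \<le> C"
    "\<And>(f :: real^'d \<Rightarrow> real) M A. ess_bounded M f \<Longrightarrow> Lip_bound \<alpha> f A \<Longrightarrow>
       (AE x in lborel. integrable lborel (\<lambda>s. frac_integrand \<kappa> \<beta> f s x)) \<and>
       ess_bounded (C * (M + A)) (frac_deriv \<kappa> \<beta> f) \<and> Lip_bound (\<alpha> - \<beta>) (frac_deriv \<kappa> \<beta> f) (C * (M + A))"
    using frac_deriv_Lip_estimate[OF \<beta> \<alpha> \<kappa>] by blast
  have key: "(AE x in gauss. set_integrable lborel {0<..} (I f x)) \<and> S f \<in> Lip (\<alpha> - \<beta>) \<and>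
      Lip_norm (\<alpha> - \<beta>) (S f) \<le> 2 * C * Lip_norm \<alpha> f" if f: "f \<in> Lip \<alpha>" for f
  proof -
    define M A where "M = real_of_ereal (Linf_norm f)" and "A = Lip_const \<alpha> f"
    have fb: "ess_bounded M f" using f unfolding M_def by (intro Linf_imp_ess_bounded) (simp add: Lip_def)
    have A: "Lip_bound \<alpha> f A" unfolding A_def by (rule Lip_const_props(1)[OF f])
    have Sf: "S f = frac_deriv \<kappa> \<beta> f"
    proof
      show "S f y = frac_deriv \<kappa> \<beta> f y" for y
        unfolding S frac_deriv_def set_lebesgue_integral_def I[OF fb] ..
    qed
    note * = C(2)[OF fb A, folded Sf]
    have lip: "S f \<in> Lip (\<alpha> - \<beta>)" using * ess_bounded_imp_Linf(1) by (auto simp: Lip_def)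
    have "Lip_norm (\<alpha> - \<beta>) (S f) \<le> C * (M + A) + C * (M + A)"
      unfolding Lip_norm_def using * by (intro add_mono ess_bounded_imp_Linf(2) Lip_const_props(2)[OF lip]) auto
    also have "\<dots> = 2 * C * Lip_norm \<alpha> f" by (simp add: Lip_norm_def M_def A_def)
    finally show ?thesis using * lip unfolding AE_gauss_iff set_integrable_def I[OF fb] by blast
  qed
  then show ?thesis unfolding well_defined_on_def bounded_Lip_def by blast
qed

theorem theorem3p4:
  fixes \<alpha> \<beta> :: real
  assumes "1 \<le> \<beta>" and "\<beta> < \<alpha>"
  shows
    "(well_defined_on (Lip \<alpha>)
        (riesz_integrand \<beta> :: (real ^ 'd::finite \<Rightarrow> real) \<Rightarrow> real ^ 'd \<Rightarrow> real \<Rightarrow> real) \<and>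
      bounded_Lip \<alpha> (\<alpha> - \<beta>)
        (riesz_deriv \<beta> :: (real ^ 'd::finite \<Rightarrow> real) \<Rightarrow> real ^ 'd \<Rightarrow> real)) \<and>
     (well_defined_on (Lip \<alpha>)
        (bessel_integrand \<beta> :: (real ^ 'd::finite \<Rightarrow> real) \<Rightarrow> real ^ 'd \<Rightarrow> real \<Rightarrow> real) \<and>
      bounded_Lip \<alpha> (\<alpha> - \<beta>)
        (bessel_deriv \<beta> :: (real ^ 'd::finite \<Rightarrow> real) \<Rightarrow> real ^ 'd \<Rightarrow> real))"
proof
  show "well_defined_on (Lip \<alpha>)
        (riesz_integrand \<beta> :: (real ^ 'd::finite \<Rightarrow> real) \<Rightarrow> real ^ 'd \<Rightarrow> real \<Rightarrow> real) \<and>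
      bounded_Lip \<alpha> (\<alpha> - \<beta>) (riesz_deriv \<beta> :: (real ^ 'd::finite \<Rightarrow> real) \<Rightarrow> real ^ 'd \<Rightarrow> real)"
    by (rule frac_deriv_bounded_Lip[OF assms, of 0]) (simp, erule riesz_integrand_eq, rule riesz_deriv_def)
  show "well_defined_on (Lip \<alpha>)
        (bessel_integrand \<beta> :: (real ^ 'd::finite \<Rightarrow> real) \<Rightarrow> real ^ 'd \<Rightarrow> real \<Rightarrow> real) \<and>
      bounded_Lip \<alpha> (\<alpha> - \<beta>) (bessel_deriv \<beta> :: (real ^ 'd::finite \<Rightarrow> real) \<Rightarrow> real ^ 'd \<Rightarrow> real)"
    by (rule frac_deriv_bounded_Lip[OF assms, of 1]) (simp, erule bessel_integrand_eq, rule bessel_deriv_def)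
qed

end
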